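(* Let $f$ be the restriction to a compact invariant set $X$ of a $C^1$ random map of an $m$-dimensional Riemannian manifold satisfying $\int(\log^+\|Df_\omega\|_\infty+\log^+\|(Df_\omega)^{-1}\|_\infty)\,d\mathbb P<\infty$, and let $1\le k\le m$. Then $f$ is $k$-coexpanding if and only if $\lambda_-^{[m-k]}(\mu)>\Sigma_m(\mu)$ for every $\mu\in\mathcal I(f)$.
   Context: Setting. $M$ is a Riemannian manifold of dimension $m$. $(T,\mathscr A,p)$ is a probability space and $(\Omega,\mathscr F,\mathbb P)=(T^{\mathbb N},\mathscr A^{\mathbb N},p^{\mathbb N})$. A $C^1$ random map is a measurable map $f:\Omega\times M\to M$ such that $f_\omega:=f(\omega,\cdot)=f_{\omega_0}$ depends only on the coordinate $\omega_0$ of $\omega$ and is a $C^1$ local diffeomorphism for $\mathbb P$-a.e. $\omega$. $X\subset M$ is compact with $f_\omega(X)\subset X$ for $\mathbb P$-a.e. $\omega$; $f$ also denotes the restriction to $\Omega\times X$. $\|Df_\omega\|_\infty=\sup_{x\in X}\|Df_\omega(x)\|$, $\|(Df_\omega)^{-1}\|_\infty=\sup_{x\in X}\|Df_\omega(x)^{-1}\|$. $\mathcal I(f)$ is the set of $f$-stationary Borel probability measures on $X$ ($\mu=\int (f_\omega)_*\mu\,d\mathbb P$). $\Sigma_m(\mu)=\lambda_1(\mu)+\dots+\lambda_m(\mu)=\int\log|\det Df_\omega(x)|\,d\mathbb P\,d\mu$ is the sum of all Lyapunov exponents. For $1\le j\le m$, $\hat X_j=\bigsqcup_{x\in X}\mathrm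 G_j(T_xM)$ is the Grassmannian bundle of $j$-planes; $f^{[j]}_\omega(x,E)=(f_\omega(x),Df_\omega(x)E)$; $\mathrm{Jac}_j(L|_E)=\|\wedge^j(L|_E)\|$; $\phi_f^{[j]}(x,E)=\int\log\mathrm{Jac}_j(Df_\omega(x)|_E)\,d\mathbb P$; $\mathcal I_\mu(f^{[j]})$ is the set of $f^{[j]}$-stationary probability measures on $\hat X_j$ projecting to $\mu$; $\lambda_-^{[j]}(\mu)=\inf_{\hat\mu\in\mathcal I_\mu(f^{[j]})}\int\phi_f^{[j]}\,d\hat\mu$. By convention $\lambda_-^{[0]}(\mu)=0$. Cotangent version: $(Df_\omega(x)^{-1})^*\xi=\xi\circ Df_\omega(x)^{-1}$; on $\tilde X_k=\mathrm G_k(T_X^*M)$, $\tilde f^{[k]}_\omega(x,F)=(f_\omega(x),(Df_\omega(x)^{-1})^*F)$ and $\tilde\phi_f^{[k]}(x,F)=\int\log\mathrm{Jac}_k((Df_\omega(x)^{-1})^*|_F)\,d\mathbb P$; $\tilde\lambda_-^{[k]}(\mu)=\inf\int\tilde\phi_f^{[k]}\,d\tilde\mu$ over $\tilde f^{[k]}$-stationary probability measures $\tilde\mu$ on $\tilde X_k$ projecting to $\mu$. $f$ is $k$-coexpanding if $\tilde\lambda_-^{[k]}(\mu)>0$ for every $\mu\in\mathcal I(f)$. *)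

theory Defs
  imports "HOL-Probability.Probability" "Jordan_Normal_Form.Determinant"
begin

section \<open>Riemannian manifolds\<close>

text \<open>Class \<open>C\<^sup>n\<close> for maps on an open set \<open>S\<close>: \<open>at x\<close> is not restricted to \<open>S\<close>.\<close>

primrec Ck_on :: "nat \<Rightarrow> 'v::real_normed_vector set \<Rightarrow> ('v \<Rightarrow> 'w::real_normed_vector) \<Rightarrow> bool"
where
  "Ck_on 0 S h \<longleftrightarrow> continuous_on S h"
| "Ck_on (Suc n) S h \<longleftrightarrow>
     (\<forall>x\<in>S. h differentiable (at x)) \<and> (\<forall>v. Ck_on n S (\<lambda>x. frechet_derivative h (at x) v))"

definition smooth_on :: "'v::real_normed_vector set \<Rightarrow> ('v \<Rightarrow> 'w::real_normed_vector) \<Rightarrow> bool" where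
  "smooth_on S h \<longleftrightarrow> (\<forall>n. Ck_on n S h)"

text \<open>A chart is a pair of its domain and its coordinate map.\<close>

type_synonym ('a, 'm) chart = "'a set \<times> ('a \<Rightarrow> real ^ 'm)"

definition chart_inv :: "('a, 'm::finite) chart \<Rightarrow> real ^ 'm \<Rightarrow> 'a" where
  "chart_inv c = inv_into (fst c) (snd c)"

text \<open>The points of the manifold are the elements of the type \<open>'a\<close> and its dimension is
  \<open>CARD('m)\<close>.  As part of the structure, each point \<open>x\<close> carries a distinguished chart
  \<open>chart_at M x\<close> around it; the tangent space at \<open>x\<close> is \<open>real ^ 'm\<close>, a vector being given by
  its coordinates in this chart.  The map \<open>x \<mapsto> chart_at M x\<close> need not have any regularity,
  so everything depending on the base point is expressed in the charts of the atlas by means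
  of \<open>tangent_coords\<close>.\<close>

record ('a, 'm) riemannian =
  atlas :: "('a, 'm) chart set"
  chart_at :: "'a \<Rightarrow> ('a, 'm) chart"
  metric :: "'a \<Rightarrow> real ^ 'm \<Rightarrow> real ^ 'm \<Rightarrow> real"

definition transition :: "('a, 'm::finite) chart \<Rightarrow> ('a, 'm) chart \<Rightarrow> real ^ 'm \<Rightarrow> real ^ 'm" where
  "transition c c' = snd c' \<circ> chart_inv c"

definition coord_change ::
  "('a, 'm::finite) chart \<Rightarrow> ('a, 'm) chart \<Rightarrow> 'a \<Rightarrow> real ^ 'm \<Rightarrow> real ^ 'm" where
  "coord_change c c' x = frechet_derivative (transition c c') (at (snd c x))"

text \<open>The coordinates in the chart \<open>c\<close> of a tangent vector at \<open>x\<close>.\<close>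

definition tangent_coords ::
  "('a, 'm::finite) riemannian \<Rightarrow> ('a, 'm) chart \<Rightarrow> 'a \<Rightarrow> real ^ 'm \<Rightarrow> real ^ 'm" where
  "tangent_coords M c x = coord_change (chart_at M x) c x"

definition smooth_manifold ::
  "('a::{second_countable_topology,t2_space}, 'm::finite) riemannian \<Rightarrow> bool" where
  "smooth_manifold M \<longleftrightarrow>
     (\<forall>c\<in>atlas M. open (fst c) \<and> open (snd c ` fst c) \<and>
        homeomorphism (fst c) (snd c ` fst c) (snd c) (chart_inv c)) \<and>
     (\<forall>c\<in>atlas M. \<forall>c'\<in>atlas M. smooth_on (snd c ` (fst c \<inter> fst c')) (transition c c')) \<and>
     (\<forall>x. chart_at M x \<in> atlas M \<and> x \<in> fst (chart_at M x))"

definition riemannian_manifold ::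
  "('a::{second_countable_topology,t2_space}, 'm::finite) riemannian \<Rightarrow> bool" where
  "riemannian_manifold M \<longleftrightarrow> smooth_manifold M \<and>
     (\<forall>x. bilinear (metric M x) \<and> (\<forall>u v. metric M x u v = metric M x v u) \<and>
          (\<forall>u. u \<noteq> 0 \<longrightarrow> metric M x u u > 0)) \<and>
     (\<forall>c\<in>atlas M. \<forall>u v. smooth_on (snd c ` fst c)
        (\<lambda>y. let x = chart_inv c y; K = coord_change c (chart_at M x) x in metric M x (K u) (K v)))"

subsection \<open>Maps of class \<open>C\<^sup>1\<close> and their derivatives\<close>

definition C1_map_on ::
  "('a::topological_space, 'm::finite) riemannian \<Rightarrow> 'a set \<Rightarrow> ('a \<Rightarrow> 'a) \<Rightarrow> bool" where
  "C1_map_on M S h \<longleftrightarrow> continuous_on S h \<and>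
     (\<forall>c\<in>atlas M. \<forall>c'\<in>atlas M.
        Ck_on 1 (snd c ` (S \<inter> fst c \<inter> h -` fst c')) (snd c' \<circ> h \<circ> chart_inv c))"

definition C1_local_diffeo ::
  "('a::topological_space, 'm::finite) riemannian \<Rightarrow> ('a \<Rightarrow> 'a) \<Rightarrow> bool" where
  "C1_local_diffeo M h \<longleftrightarrow> (\<forall>x. \<exists>U. open U \<and> x \<in> U \<and> open (h ` U) \<and> inj_on h U \<and>
     C1_map_on M U h \<and> C1_map_on M (h ` U) (the_inv_into U h))"

definition mderiv ::
  "('a, 'm::finite) riemannian \<Rightarrow> ('a \<Rightarrow> 'a) \<Rightarrow> 'a \<Rightarrow> real ^ 'm \<Rightarrow> real ^ 'm" where
  "mderiv M h x = frechet_derivative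
     (snd (chart_at M (h x)) \<circ> h \<circ> chart_inv (chart_at M x)) (at (snd (chart_at M x) x))"

subsection \<open>Cotangent spaces\<close>

definition dual_inverse ::
  "('v::real_normed_vector \<Rightarrow> 'w::real_normed_vector) \<Rightarrow> ('v \<Rightarrow>\<^sub>L real) \<Rightarrow> ('w \<Rightarrow>\<^sub>L real)" where
  "dual_inverse L \<xi> = Blinfun (\<lambda>w. blinfun_apply \<xi> (inv_into UNIV L w))"

definition sharp ::
  "('a, 'm::finite) riemannian \<Rightarrow> 'a \<Rightarrow> ((real ^ 'm) \<Rightarrow>\<^sub>L real) \<Rightarrow> real ^ 'm" where
  "sharp M x \<xi> = (THE u. \<forall>v. metric M x u v = blinfun_apply \<xi> v)"

definition cometric ::
  "('a, 'm::finite) riemannian \<Rightarrow> 'a \<Rightarrow> ((real ^ 'm) \<Rightarrow>\<^sub>L real) \<Rightarrow> ((real ^ 'm) \<Rightarrow>\<^sub>L real) \<Rightarrow> real" where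
  "cometric M x \<xi> \<eta> = metric M x (sharp M x \<xi>) (sharp M x \<eta>)"

section \<open>Norms, Jacobians and determinants\<close>

text \<open>The operator norm of \<open>L\<close> for the inner products \<open>g\<close> on its source and \<open>h\<close> on its target.\<close>

definition op_norm :: "('v \<Rightarrow> 'v \<Rightarrow> real) \<Rightarrow> ('w \<Rightarrow> 'w \<Rightarrow> real) \<Rightarrow> ('v \<Rightarrow> 'w) \<Rightarrow> real" where
  "op_norm g h L = (SUP v\<in>{v. sqrt (g v v) \<le> 1}. sqrt (h (L v) (L v)))"

text \<open>An element \<open>\<Sum> a v\<^sub>0 \<and> \<dots> \<and> v\<^bsub>j-1\<^esub>\<close> of the \<open>j\<close>-th exterior power is represented by the
  list of its terms \<open>(a, v)\<close>.  The inner product induced by \<open>g\<close> is the bilinear extension of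
  \<open>\<langle>v\<^sub>0 \<and> \<dots> \<and> v\<^bsub>j-1\<^esub>, w\<^sub>0 \<and> \<dots> \<and> w\<^bsub>j-1\<^esub>\<rangle> = det (g (v\<^sub>i) (w\<^sub>l))\<close>; two lists represent the same
  element iff their difference has norm zero.\<close>

type_synonym 'v multivector = "(real \<times> (nat \<Rightarrow> 'v)) list"

definition wedge_inner ::
  "('v \<Rightarrow> 'v \<Rightarrow> real) \<Rightarrow> nat \<Rightarrow> 'v multivector \<Rightarrow> 'v multivector \<Rightarrow> real" where
  "wedge_inner g j S S' = (\<Sum>(a, v)\<leftarrow>S. \<Sum>(b, w)\<leftarrow>S'.
     a * b * Determinant.det (Matrix.mat j j (\<lambda>(i, l). g (v i) (w l))))"

definition wedge_norm :: "('v \<Rightarrow> 'v \<Rightarrow> real) \<Rightarrow> nat \<Rightarrow> 'v multivector \<Rightarrow> real" where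
  "wedge_norm g j S = sqrt (wedge_inner g j S S)"

definition wedge_map :: "('v \<Rightarrow> 'w) \<Rightarrow> 'v multivector \<Rightarrow> 'w multivector" where
  "wedge_map L = map (\<lambda>(a, v). (a, L \<circ> v))"

definition multivectors :: "nat \<Rightarrow> 'v set \<Rightarrow> 'v multivector set" where
  "multivectors j E = {S. \<forall>(a, v)\<in>set S. \<forall>i<j. v i \<in> E}"

text \<open>The operator norm of the \<open>j\<close>-th exterior power of the restriction of \<open>L\<close> to \<open>E\<close>.\<close>

definition jac ::
  "nat \<Rightarrow> ('v \<Rightarrow> 'v \<Rightarrow> real) \<Rightarrow> ('w \<Rightarrow> 'w \<Rightarrow> real) \<Rightarrow> ('v \<Rightarrow> 'w) \<Rightarrow> 'v set \<Rightarrow> real" where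
  "jac j g h L E =
     (SUP S\<in>{S \<in> multivectors j E. wedge_norm g j S \<le> 1}. wedge_norm h j (wedge_map L S))"

text \<open>The absolute value of the determinant of \<open>L\<close> with respect to a \<open>g\<close>-orthonormal basis of
  the source and an \<open>h\<close>-orthonormal basis of the target: the base change from the standard
  basis to an orthonormal one has determinant of absolute value \<open>1 / sqrt (gram_det g)\<close>.\<close>

definition gram_det :: "(real ^ 'm \<Rightarrow> real ^ 'm \<Rightarrow> real) \<Rightarrow> real" where
  "gram_det g = Determinants.det (\<chi> i l. g (axis i 1) (axis l 1))"

definition abs_det ::
  "(real ^ 'm \<Rightarrow> real ^ 'm \<Rightarrow> real) \<Rightarrow> (real ^ 'm \<Rightarrow> real ^ 'm \<Rightarrow> real) \<Rightarrow>
   (real ^ 'm \<Rightarrow> real ^ 'm) \<Rightarrow> real" where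
  "abs_det g h L = \<bar>Determinants.det (matrix L)\<bar> * sqrt (gram_det h) / sqrt (gram_det g)"

section \<open>Grassmannian bundles\<close>

definition grassmannian :: "nat \<Rightarrow> 'v::real_vector set set" where
  "grassmannian j = {E. subspace E \<and> dim E = j}"

text \<open>Subspaces are close if their distance functions are close pointwise.  Distance functions
  being 1-Lipschitz and homogeneous, for a finite-dimensional space this is the topology of
  the Hausdorff distance between unit balls, i.e. the usual topology of the Grassmannian.\<close>

definition grassmannian_topology :: "nat \<Rightarrow> 'v::real_normed_vector set topology" where
  "grassmannian_topology j = pullback_topology (grassmannian j) (\<lambda>E v. infdist v E) euclidean"

text \<open>The bundle of \<open>j\<close>-planes over \<open>X\<close>, for the tangent or the cotangent bundle: \<open>\<tau> c x\<close> maps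
  the fibre over \<open>x\<close> to the model space by taking coordinates in the chart \<open>c\<close>.  The topology is
  the one for which all \<open>(x, E) \<mapsto> (x, \<tau> c x ` E)\<close> are homeomorphisms from the part of the bundle
  over the domain of \<open>c\<close> onto a product.\<close>

definition plane_bundle_topology ::
  "('a::topological_space, 'm::finite) riemannian \<Rightarrow> 'a set \<Rightarrow> nat \<Rightarrow>
   (('a, 'm) chart \<Rightarrow> 'a \<Rightarrow> 'v::real_normed_vector \<Rightarrow> 'v) \<Rightarrow> ('a \<times> 'v set) topology" where
  "plane_bundle_topology M X j \<tau> = topology_generated_by
     {{(x, E). x \<in> X \<inter> fst c \<inter> U \<and> E \<in> grassmannian j \<and> \<tau> c x ` E \<in> V} | c U V.
        c \<in> atlas M \<and> open U \<and> openin (grassmannian_topology j) V}"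

definition borel_of_topology :: "'b topology \<Rightarrow> 'b measure" where
  "borel_of_topology T = sigma (topspace T) {U. openin T U}"

definition grass_bundle_borel ::
  "('a::topological_space, 'm::finite) riemannian \<Rightarrow> 'a set \<Rightarrow> nat \<Rightarrow>
   ('a \<times> (real ^ 'm) set) measure" where
  "grass_bundle_borel M X j =
     borel_of_topology (plane_bundle_topology M X j (tangent_coords M))"

definition cograss_bundle_borel ::
  "('a::topological_space, 'm::finite) riemannian \<Rightarrow> 'a set \<Rightarrow> nat \<Rightarrow>
   ('a \<times> ((real ^ 'm) \<Rightarrow>\<^sub>L real) set) measure" where
  "cograss_bundle_borel M X k =
     borel_of_topology (plane_bundle_topology M X k (\<lambda>c x. dual_inverse (tangent_coords M c x)))"

section \<open>Random maps and stationary measures\<close>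

abbreviation noise :: "'t measure \<Rightarrow> (nat \<Rightarrow> 't) measure" where
  "noise p \<equiv> PiM UNIV (\<lambda>_. p)"

definition C1_random_map ::
  "('a::topological_space, 'm::finite) riemannian \<Rightarrow> 't measure \<Rightarrow> ((nat \<Rightarrow> 't) \<Rightarrow> 'a \<Rightarrow> 'a) \<Rightarrow> bool"
where
  "C1_random_map M p f \<longleftrightarrow>
     (\<lambda>(\<omega>, x). f \<omega> x) \<in> measurable (noise p \<Otimes>\<^sub>M borel) borel \<and>
     (\<forall>\<omega>\<in>space (noise p). \<forall>\<omega>'\<in>space (noise p). \<omega> 0 = \<omega>' 0 \<longrightarrow> f \<omega> = f \<omega>') \<and>
     (AE \<omega> in noise p. C1_local_diffeo M (f \<omega>))"

text \<open>The random map \<open>F\<close> need only preserve \<open>space B\<close> and be measurable for almost every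
  \<open>\<omega>\<close>; the other values of \<open>\<omega>\<close> do not contribute to the integral.\<close>

definition stationary ::
  "'s measure \<Rightarrow> 'b measure \<Rightarrow> ('s \<Rightarrow> 'b \<Rightarrow> 'b) \<Rightarrow> 'b measure \<Rightarrow> bool" where
  "stationary P B F \<nu> \<longleftrightarrow> prob_space \<nu> \<and> sets \<nu> = sets B \<and>
     (\<forall>A\<in>sets B. emeasure \<nu> A = (\<integral>\<^sup>+\<omega>. emeasure \<nu> (F \<omega> -` A \<inter> space B) \<partial>P))"

definition stationary_measures ::
  "'t measure \<Rightarrow> 'a::topological_space set \<Rightarrow> ((nat \<Rightarrow> 't) \<Rightarrow> 'a \<Rightarrow> 'a) \<Rightarrow> 'a measure set" where
  "stationary_measures p X f = {\<mu>. stationary (noise p) (restrict_space borel X) f \<mu>}"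

definition deriv_sup_norm ::
  "('a, 'm::finite) riemannian \<Rightarrow> 'a set \<Rightarrow> ('a \<Rightarrow> 'a) \<Rightarrow> real" where
  "deriv_sup_norm M X h = (SUP x\<in>X. op_norm (metric M x) (metric M (h x)) (mderiv M h x))"

definition inv_deriv_sup_norm ::
  "('a, 'm::finite) riemannian \<Rightarrow> 'a set \<Rightarrow> ('a \<Rightarrow> 'a) \<Rightarrow> real" where
  "inv_deriv_sup_norm M X h =
     (SUP x\<in>X. op_norm (metric M (h x)) (metric M x) (inv_into UNIV (mderiv M h x)))"

definition log_plus :: "real \<Rightarrow> real" where
  "log_plus t = max 0 (ln t)"

section \<open>Exponents\<close>

text \<open>The integrands in \<open>\<omega>\<close> below are meaningful, and measurable, only outside a null set on
  which \<open>f \<omega>\<close> fails to be a local diffeomorphism.  Integrating over the completion makes the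
  Bochner integral insensitive to the values on that null set.\<close>

definition sum_lyapunov ::
  "('a, 'm::finite) riemannian \<Rightarrow> 't measure \<Rightarrow> ((nat \<Rightarrow> 't) \<Rightarrow> 'a \<Rightarrow> 'a) \<Rightarrow> 'a measure \<Rightarrow> real" where
  "sum_lyapunov M p f \<mu> = (\<integral>x. (\<integral>\<omega>.
     ln (abs_det (metric M x) (metric M (f \<omega> x)) (mderiv M (f \<omega>) x)) \<partial>completion (noise p)) \<partial>\<mu>)"

definition grass_map ::
  "('a, 'm::finite) riemannian \<Rightarrow> ((nat \<Rightarrow> 't) \<Rightarrow> 'a \<Rightarrow> 'a) \<Rightarrow> (nat \<Rightarrow> 't) \<Rightarrow>
   'a \<times> (real ^ 'm) set \<Rightarrow> 'a \<times> (real ^ 'm) set" where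
  "grass_map M f \<omega> = (\<lambda>(x, E). (f \<omega> x, mderiv M (f \<omega>) x ` E))"

definition grass_potential ::
  "('a, 'm::finite) riemannian \<Rightarrow> 't measure \<Rightarrow> ((nat \<Rightarrow> 't) \<Rightarrow> 'a \<Rightarrow> 'a) \<Rightarrow> nat \<Rightarrow>
   'a \<times> (real ^ 'm) set \<Rightarrow> real" where
  "grass_potential M p f j = (\<lambda>(x, E). \<integral>\<omega>.
     ln (jac j (metric M x) (metric M (f \<omega> x)) (mderiv M (f \<omega>) x) E) \<partial>completion (noise p))"

definition grass_lifts ::
  "('a::topological_space, 'm::finite) riemannian \<Rightarrow> 't measure \<Rightarrow> 'a set \<Rightarrow>
   ((nat \<Rightarrow> 't) \<Rightarrow> 'a \<Rightarrow> 'a) \<Rightarrow> nat \<Rightarrow> 'a measure \<Rightarrow> ('a \<times> (real ^ 'm) set) measure set" where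
  "grass_lifts M p X f j \<mu> =
     {\<nu>. stationary (noise p) (grass_bundle_borel M X j) (grass_map M f) \<nu> \<and>
         distr \<nu> (restrict_space borel X) fst = \<mu>}"

definition lambda_minus ::
  "('a::topological_space, 'm::finite) riemannian \<Rightarrow> 't measure \<Rightarrow> 'a set \<Rightarrow>
   ((nat \<Rightarrow> 't) \<Rightarrow> 'a \<Rightarrow> 'a) \<Rightarrow> nat \<Rightarrow> 'a measure \<Rightarrow> ereal" where
  "lambda_minus M p X f j \<mu> = (if j = 0 then 0
     else INF \<nu>\<in>grass_lifts M p X f j \<mu>. ereal (\<integral>z. grass_potential M p f j z \<partial>\<nu>))"

definition cograss_map ::
  "('a, 'm::finite) riemannian \<Rightarrow> ((nat \<Rightarrow> 't) \<Rightarrow> 'a \<Rightarrow> 'a) \<Rightarrow> (nat \<Rightarrow> 't) \<Rightarrow>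
   'a \<times> ((real ^ 'm) \<Rightarrow>\<^sub>L real) set \<Rightarrow> 'a \<times> ((real ^ 'm) \<Rightarrow>\<^sub>L real) set" where
  "cograss_map M f \<omega> = (\<lambda>(x, F). (f \<omega> x, dual_inverse (mderiv M (f \<omega>) x) ` F))"

definition cograss_potential ::
  "('a, 'm::finite) riemannian \<Rightarrow> 't measure \<Rightarrow> ((nat \<Rightarrow> 't) \<Rightarrow> 'a \<Rightarrow> 'a) \<Rightarrow> nat \<Rightarrow>
   'a \<times> ((real ^ 'm) \<Rightarrow>\<^sub>L real) set \<Rightarrow> real" where
  "cograss_potential M p f k = (\<lambda>(x, F). \<integral>\<omega>.
     ln (jac k (cometric M x) (cometric M (f \<omega> x)) (dual_inverse (mderiv M (f \<omega>) x)) F)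
       \<partial>completion (noise p))"

definition cograss_lifts ::
  "('a::topological_space, 'm::finite) riemannian \<Rightarrow> 't measure \<Rightarrow> 'a set \<Rightarrow>
   ((nat \<Rightarrow> 't) \<Rightarrow> 'a \<Rightarrow> 'a) \<Rightarrow> nat \<Rightarrow> 'a measure \<Rightarrow>
   ('a \<times> ((real ^ 'm) \<Rightarrow>\<^sub>L real) set) measure set" where
  "cograss_lifts M p X f k \<mu> =
     {\<nu>. stationary (noise p) (cograss_bundle_borel M X k) (cograss_map M f) \<nu> \<and>
         distr \<nu> (restrict_space borel X) fst = \<mu>}"

definition colambda_minus ::
  "('a::topological_space, 'm::finite) riemannian \<Rightarrow> 't measure \<Rightarrow> 'a set \<Rightarrow>
   ((nat \<Rightarrow> 't) \<Rightarrow> 'a \<Rightarrow> 'a) \<Rightarrow> nat \<Rightarrow> 'a measure \<Rightarrow> ereal" where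
  "colambda_minus M p X f k \<mu> =
     (INF \<nu>\<in>cograss_lifts M p X f k \<mu>. ereal (\<integral>z. cograss_potential M p f k z \<partial>\<nu>))"

definition coexpanding ::
  "('a::topological_space, 'm::finite) riemannian \<Rightarrow> 't measure \<Rightarrow> 'a set \<Rightarrow>
   ((nat \<Rightarrow> 't) \<Rightarrow> 'a \<Rightarrow> 'a) \<Rightarrow> nat \<Rightarrow> bool" where
  "coexpanding M p X f k \<longleftrightarrow> (\<forall>\<mu>\<in>stationary_measures p X f. colambda_minus M p X f k \<mu> > 0)"

end

theory Submission
  imports Defs
begin

text \<open>Taking annihilators identifies the bundle of \<open>(m-k)\<close>-planes of the tangent bundle with the
  bundle of \<open>k\<close>-planes of the cotangent bundle.  The identification is a Borel isomorphism (even a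
  homeomorphism), it conjugates the two induced random maps, and in orthonormal bases adapted to a
  plane \<open>E\<close> and its image \<open>L(E)\<close>, in which \<open>L\<close> is block triangular, one reads off
  \<open>Jac\<^sub>k((L\<^sup>-\<^sup>1)\<^sup>*|E\<^sup>0) = Jac\<^bsub>m-k\<^esub>(L|E) / |det L|\<close>.  Taking logarithms and integrating, the stationary
  lifts of \<open>\<mu>\<close> correspond to each other and the integrals of the potentials differ by
  \<open>\<Sigma>\<^sub>m(\<mu>)\<close>.

  Integrating the difference term by term needs integrability of both potentials.  They are bounded because
  \<open>|log Jac\<^sub>j|\<close> is bounded, up to a constant, by \<open>j\<close> times the integrand of the moment condition;
  they are measurable because, in charts, the Jacobian is a rational expression in the partial
  derivatives, the metric coefficients and the entries of the orthogonal projection onto the plane,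
  up to a square root.\<close>

subsection \<open>Determinants and Jacobians\<close>

text \<open>A \<open>j\<close>-plane has a one-dimensional top exterior power, so the supremum
  defining \<open>jac\<close> becomes a quotient of Gram determinants on any basis of the plane. The
  Jacobian identity is then a statement about blocks: when a matrix is block triangular, so is its
  inverse, and the complementary diagonal block of the inverse has determinant
  \<open>det A11 / det A\<close>. The bulk of the work is measure-theoretic. The maps
  \<open>f \<omega>\<close> are local diffeomorphisms only off a set that need not be measurable;
  tangent vectors at \<open>x\<close> are written in \<open>chart_at M x\<close>, which may vary
  wildly with \<open>x\<close>; and the moment integrand is not known to be measurable. These are
  met by a fixed measurable null set on which integrands are redefined, by rewriting Jacobians in
  countably many charts of the atlas, and by a lower integral that bounds every measurable function
  below the integrand. The case \<open>k = m\<close> needs care of its own: the value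
  \<open>0\<close> set by convention for \<open>0\<close>-planes has to be recognised as an infimum
  over lifts.\<close>

abbreviation jdet :: "nat \<Rightarrow> (nat \<Rightarrow> nat \<Rightarrow> real) \<Rightarrow> real" where
  "jdet n A \<equiv> Determinant.det (Matrix.mat n n (\<lambda>(i, l). A i l))"

lemma jdet_mult:
  "jdet n A * jdet n B = jdet n (\<lambda>i l. \<Sum>q<n. A i q * B q l)"
proof -
  have "Matrix.mat n n (\<lambda>(i, l). A i l) * Matrix.mat n n (\<lambda>(i, l). B i l) =
        Matrix.mat n n (\<lambda>(i, l). \<Sum>q<n. A i q * B q l)"
    by (rule eq_matI) (auto simp: scalar_prod_def lessThan_atLeast0 intro!: sum.cong)
  then show ?thesis
    by (metis Determinant.det_mult mat_carrier)
qed

lemma jdet_transpose: "jdet n (\<lambda>i l. A l i) = jdet n A"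
proof -
  have "Matrix.mat n n (\<lambda>(i, l). A l i) = (Matrix.mat n n (\<lambda>(i, l). A i l))\<^sup>T"
    by (rule eq_matI) auto
  then show ?thesis
    by (metis Determinant.det_transpose mat_carrier)
qed

lemma jdet_cong: "(\<And>i l. i < n \<Longrightarrow> l < n \<Longrightarrow> A i l = B i l) \<Longrightarrow> jdet n A = jdet n B"
  by (rule arg_cong[where f = Determinant.det]) (auto intro!: eq_matI)

lemma jdet_id: "jdet n (\<lambda>i l. if i = l then 1 else 0) = 1"
proof -
  have "Matrix.mat n n (\<lambda>(i, l). if i = l then 1 else 0) = (1\<^sub>m n :: real Matrix.mat)"
    by (rule eq_matI) auto
  then show ?thesis by simp
qed

text \<open>The Leibniz sum is the form from which bounds and measurability in the entries can be
  read off.\<close>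

lemma jdet_expand:
  "jdet n A = (\<Sum>p | p permutes {..<n}. of_int (sign p) * (\<Prod>i<n. A i (p i)))"
proof -
  have "p i < n" if "p permutes {..<n}" "i < n" for p i
    using permutes_in_image[OF that(1), of i] that(2) by simp
  then show ?thesis
    unfolding det_def'[OF mat_carrier] atLeast0LessThan
    by (intro sum.cong arg_cong2[where f = times] prod.cong refl) simp_all
qed

lemma jdet_block:
  assumes "\<And>i l. i < n \<Longrightarrow> n \<le> l \<Longrightarrow> l < n + k \<Longrightarrow> A i l = 0"
  shows "jdet (n + k) A = jdet n A * jdet k (\<lambda>i l. A (n + i) (n + l))"
proof -
  \<comment> \<open>Transposition moves the zero block to the lower left, where the block formula
    expects it.\<close>
  let ?T = "\<lambda>i l. A l i"
  have "Matrix.mat (n + k) (n + k) (\<lambda>(i, l). ?T i l) =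
      four_block_mat (Matrix.mat n n (\<lambda>(i, l). ?T i l)) (Matrix.mat n k (\<lambda>(i, l). ?T i (n + l)))
        (0\<^sub>m k n) (Matrix.mat k k (\<lambda>(i, l). ?T (n + i) (n + l)))"
    using assms by (intro eq_matI) auto
  then have "jdet (n + k) ?T = jdet n ?T * jdet k (\<lambda>i l. ?T (n + i) (n + l))"
    by (simp only: det_four_block_mat_lower_left_zero[OF mat_carrier mat_carrier refl mat_carrier])
  then show ?thesis
    by (simp only: jdet_transpose[of "n + k" A] jdet_transpose[of n A]
        jdet_transpose[of k "\<lambda>i l. A (n + i) (n + l)"])
qed

text \<open>Both determinants are Leibniz sums; the enumeration \<open>b\<close> turns permutations
  of the numbers below \<open>CARD('m)\<close> into permutations of the index type and preserves
  signs.\<close>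

lemma det_eq_jdet:
  fixes A :: "real ^ 'm ^ 'm"
  assumes b: "bij_betw b {..<CARD('m::finite)} (UNIV :: 'm set)"
  shows "Determinants.det A = jdet CARD('m) (\<lambda>i l. A $ b i $ b l)"
proof -
  let ?n = "CARD('m)"
  let ?T = "\<lambda>p. map_permutation {..<?n} b p"
  have inj: "inj_on b {..<?n}" and im: "b ` {..<?n} = UNIV"
    using b by (auto simp: bij_betw_def)
  have eq: "?T p = (\<lambda>x. if x \<in> UNIV then b (p (inv_into {..<?n} b x)) else x)" for p
    by (auto simp: map_permutation_def im restrict_id_def)
  have bij: "bij_betw ?T {p. p permutes {..<?n}} {p. p permutes UNIV}"
    using bij_betw_permutations[OF b] unfolding eq .
  have "Determinants.det A = (\<Sum>p | p permutes UNIV. of_int (sign p) * (\<Prod>i\<in>UNIV. A $ i $ p i))"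
    by (simp add: Determinants.det_def)
  also have "\<dots> = (\<Sum>p | p permutes {..<?n}. of_int (sign (?T p)) * (\<Prod>i\<in>UNIV. A $ i $ ?T p i))"
    by (rule sum.reindex_bij_betw[OF bij, symmetric])
  also have "\<dots> = (\<Sum>p | p permutes {..<?n}. of_int (sign p) * (\<Prod>i<?n. A $ b i $ b (p i)))"
  proof (rule sum.cong)
    fix p assume "p \<in> {p. p permutes {..<?n}}"
    then have p: "p permutes {..<?n}" by simp
    have "(\<Prod>i\<in>UNIV. A $ i $ ?T p i) = (\<Prod>i<?n. A $ b i $ ?T p (b i))"
      by (rule prod.reindex_bij_betw[OF b, symmetric])
    also have "\<dots> = (\<Prod>i<?n. A $ b i $ b (p i))"
      by (rule prod.cong) (simp_all add: map_permutation_apply[OF inj])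
    finally show "of_int (sign (?T p)) * (\<Prod>i\<in>UNIV. A $ i $ ?T p i) =
        of_int (sign p) * (\<Prod>i<?n. A $ b i $ b (p i))"
      by (simp add: sign_map_permutation[OF inj p])
  qed simp
  also have "\<dots> = jdet ?n (\<lambda>i l. A $ b i $ b l)"
    by (simp add: jdet_expand)
  finally show ?thesis .
qed

section \<open>Gram determinants, frames and top exterior powers\<close>

definition gramd :: "nat \<Rightarrow> ('v \<Rightarrow> 'v \<Rightarrow> real) \<Rightarrow> (nat \<Rightarrow> 'v) \<Rightarrow> real" where
  "gramd j g v = jdet j (\<lambda>i l. g (v i) (v l))"

definition inner_product :: "('v::real_vector \<Rightarrow> 'v \<Rightarrow> real) \<Rightarrow> bool" where
  "inner_product g \<longleftrightarrow> bilinear g \<and> (\<forall>u v. g u v = g v u) \<and> (\<forall>u. u \<noteq> 0 \<longrightarrow> g u u > 0)"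

text \<open>The mixed Gram matrix factors as \<open>A\<close>, times the Gram matrix of
  \<open>e\<close>, times the transpose of \<open>B\<close>; determinants are
  multiplicative.\<close>

lemma gram_expand:
  assumes g: "bilinear g"
    and v: "\<And>i. i < j \<Longrightarrow> v i = (\<Sum>q<j. A i q *\<^sub>R e q)"
    and w: "\<And>i. i < j \<Longrightarrow> w i = (\<Sum>q<j. B i q *\<^sub>R e q)"
  shows "jdet j (\<lambda>i l. g (v i) (w l)) = jdet j A * gramd j g e * jdet j B"
proof -
  have "jdet j (\<lambda>i l. g (v i) (w l)) =
      jdet j (\<lambda>i l. \<Sum>q<j. A i q * (\<Sum>r<j. g (e q) (e r) * B l r))"
  proof (rule jdet_cong)
    fix i l assume "i < j" "l < j"
    then have "g (v i) (w l) = (\<Sum>(q, r)\<in>{..<j} \<times> {..<j}. g (A i q *\<^sub>R e q) (B l r *\<^sub>R e r))"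
      by (simp add: v w bilinear_sum[OF g])
    also have "\<dots> = (\<Sum>q<j. A i q * (\<Sum>r<j. g (e q) (e r) * B l r))"
      by (simp add: sum.cartesian_product[symmetric] bilinear_lmul[OF g] bilinear_rmul[OF g]
          sum_distrib_left algebra_simps)
    finally show "g (v i) (w l) = (\<Sum>q<j. A i q * (\<Sum>r<j. g (e q) (e r) * B l r))" .
  qed
  also have "\<dots> = jdet j A * jdet j (\<lambda>q l. \<Sum>r<j. g (e q) (e r) * B l r)"
    by (rule jdet_mult[symmetric])
  also have "jdet j (\<lambda>q l. \<Sum>r<j. g (e q) (e r) * B l r) = gramd j g e * jdet j (\<lambda>r l. B l r)"
    unfolding gramd_def by (rule jdet_mult[symmetric])
  finally show ?thesis by (simp add: jdet_transpose[of j B])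
qed

lemma gramd_expand:
  assumes "bilinear g" "\<And>i. i < j \<Longrightarrow> v i = (\<Sum>q<j. A i q *\<^sub>R e q)"
  shows "gramd j g v = (jdet j A)\<^sup>2 * gramd j g e"
  using gram_expand[OF assms(1), of j v A e v A] assms(2)
  by (simp add: gramd_def power2_eq_square)

text \<open>A spanning tuple of prescribed length, a notion inherited by images under every linear
  map. If \<open>j\<close> is the dimension of \<open>E\<close> the tuple is a basis, which
  \<open>gramd_frame_pos\<close> expresses by a positive Gram determinant.\<close>

definition frame :: "nat \<Rightarrow> 'v::real_vector set \<Rightarrow> (nat \<Rightarrow> 'v) \<Rightarrow> bool" where
  "frame j E e \<longleftrightarrow> (\<forall>i<j. e i \<in> E) \<and> (\<forall>u\<in>E. \<exists>a. u = (\<Sum>q<j. a q *\<^sub>R e q))"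

lemma frameD:
  assumes "frame j E e" "\<And>i. i < j \<Longrightarrow> v i \<in> E"
  obtains A where "\<And>i. i < j \<Longrightarrow> v i = (\<Sum>q<j. A i q *\<^sub>R e q)"
proof -
  have "\<forall>i. \<exists>a. i < j \<longrightarrow> v i = (\<Sum>q<j. a q *\<^sub>R e q)"
    using assms by (metis frame_def)
  then show ?thesis using that by metis
qed

lemma frame_image:
  assumes "linear L" "frame j E e" shows "frame j (L ` E) (L \<circ> e)"
  using assms by (fastforce simp: frame_def linear_sum linear_scale)

text \<open>The coefficient of the multivector \<open>S\<close> with respect to \<open>e\<^sub>0 \<and> \<dots> \<and> e\<^bsub>j-1\<^esub>\<close>, provided its entries lie
  in the span of the \<open>e\<^sub>i\<close>.\<close>

definition coord_sum :: "nat \<Rightarrow> (nat \<Rightarrow> 'v::real_vector) \<Rightarrow> 'v multivector \<Rightarrow> real" where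
  "coord_sum j e S = (\<Sum>(a, v)\<leftarrow>S. a *
     jdet j (SOME A. \<forall>i<j. v i = (\<Sum>q<j. A i q *\<^sub>R e q)))"

text \<open>Each term \<open>(a, v)\<close> of \<open>S\<close> equals the wedge of the frame scaled
  by \<open>a\<close> times the determinant of the coefficients of \<open>v\<close>. Hence all of
  \<open>S\<close> is one multiple of that wedge, with factor
  \<open>coord_sum j e S\<close>.\<close>

lemma wedge_inner_frame:
  assumes g: "bilinear g" and L: "linear L" and e: "frame j E e" and S: "S \<in> multivectors j E"
  shows "wedge_inner g j (wedge_map L S) (wedge_map L S) =
    (coord_sum j e S)\<^sup>2 * gramd j g (L \<circ> e)"
proof -
  let ?A = "\<lambda>v. SOME A. \<forall>i<j. v i = (\<Sum>q<j. A i q *\<^sub>R e q)"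
  have A: "\<forall>i<j. v i = (\<Sum>q<j. ?A v i q *\<^sub>R e q)" if "(a, v) \<in> set S" for a v
  proof -
    have "\<forall>i<j. v i \<in> E" using S that by (auto simp: multivectors_def)
    then have "\<exists>A. \<forall>i<j. v i = (\<Sum>q<j. A i q *\<^sub>R e q)"
      using frameD[OF e, of v] by metis
    then show ?thesis by (rule someI_ex)
  qed
  have D: "jdet j (\<lambda>i l. g (L (v i)) (L (w l))) = jdet j (?A v) * jdet j (?A w) * gramd j g (L \<circ> e)"
    if "(a, v) \<in> set S" "(b, w) \<in> set S" for a b v w
  proof -
    have exp: "L (u i) = (\<Sum>q<j. ?A u i q *\<^sub>R (L \<circ> e) q)"
      if "(c, u) \<in> set S" "i < j" for c u i
    proof -
      have "L (u i) = L (\<Sum>q<j. ?A u i q *\<^sub>R e q)"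
        using A[OF that(1)] that(2) by simp
      then show ?thesis by (simp add: linear_sum[OF L] linear_scale[OF L])
    qed
    have "jdet j (\<lambda>i l. g (L (v i)) (L (w l))) =
        jdet j (?A v) * gramd j g (L \<circ> e) * jdet j (?A w)"
      by (rule gram_expand[OF g]) (rule exp[OF that(1)], assumption, rule exp[OF that(2)], assumption)
    then show ?thesis by (simp only: mult_ac)
  qed
  have "wedge_inner g j (wedge_map L S) (wedge_map L S) =
    (\<Sum>(a, v)\<leftarrow>S. \<Sum>(b, w)\<leftarrow>S. a * b * jdet j (\<lambda>i l. g (L (v i)) (L (w l))))"
    unfolding wedge_inner_def wedge_map_def by (simp add: split_def comp_def)
  also have "\<dots> = (\<Sum>(a, v)\<leftarrow>S. \<Sum>(b, w)\<leftarrow>S.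
      (a * jdet j (?A v)) * (b * jdet j (?A w)) * gramd j g (L \<circ> e))"
    by (rule arg_cong[where f = sum_list], rule map_cong[OF refl], clarify,
        rule arg_cong[where f = sum_list], rule map_cong[OF refl], clarify) (simp add: D)
  also have "\<dots> = (coord_sum j e S)\<^sup>2 * gramd j g (L \<circ> e)"
    unfolding coord_sum_def power2_eq_square split_def
    by (simp add: sum_list_const_mult sum_list_mult_const)
  finally show ?thesis .
qed


text \<open>On a line the operator norm is the ratio of the norms of the image of one nonzero vector
  and of that vector. Assuming only bilinearity and the signs of two Gram determinants lets the
  lemma apply directly to cometrics.\<close>

lemma jac_frame:
  assumes g: "bilinear g" and h: "bilinear h" and L: "linear L" and e: "frame j E e"
    and pos: "gramd j g e > 0" and nonneg: "gramd j h (L \<circ> e) \<ge> 0"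
  shows "jac j g h L E = sqrt (gramd j h (L \<circ> e)) / sqrt (gramd j g e)"
proof -
  let ?G = "gramd j g e" and ?H = "gramd j h (L \<circ> e)"
  have G: "wedge_norm g j S = \<bar>coord_sum j e S\<bar> * sqrt ?G" if "S \<in> multivectors j E" for S
    using wedge_inner_frame[OF g linear_id e that]
    by (simp add: wedge_norm_def wedge_map_def real_sqrt_mult)
  have H: "wedge_norm h j (wedge_map L S) = \<bar>coord_sum j e S\<bar> * sqrt ?H"
    if "S \<in> multivectors j E" for S
    using wedge_inner_frame[OF h L e that] by (simp add: wedge_norm_def real_sqrt_mult)
  \<comment> \<open>The wedge of the frame, normalised to length one: it attains the
    supremum.\<close>
  let ?S = "[(1 / sqrt ?G, e)]"
  have S: "?S \<in> multivectors j E" using e by (simp add: multivectors_def frame_def)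
  have S1: "wedge_norm g j ?S = 1"
    using pos by (simp add: wedge_norm_def wedge_inner_def gramd_def[symmetric])
  then have c: "\<bar>coord_sum j e ?S\<bar> = 1 / sqrt ?G"
    using G[OF S] pos by (simp add: field_simps)
  show ?thesis
    unfolding jac_def
  proof (rule cSup_eq_maximum)
    show "sqrt ?H / sqrt ?G \<in> (\<lambda>S. wedge_norm h j (wedge_map L S)) `
        {S \<in> multivectors j E. wedge_norm g j S \<le> 1}"
      by (rule image_eqI[of _ _ ?S]) (use H[OF S] c S S1 in simp_all)
  next
    fix y assume "y \<in> (\<lambda>S. wedge_norm h j (wedge_map L S)) `
        {S \<in> multivectors j E. wedge_norm g j S \<le> 1}"
    then obtain S where S: "S \<in> multivectors j E" "wedge_norm g j S \<le> 1"
      and y: "y = wedge_norm h j (wedge_map L S)" by blast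
    have "\<bar>coord_sum j e S\<bar> \<le> 1 / sqrt ?G"
      using S(2) G[OF S(1)] pos by (simp add: field_simps)
    then have "\<bar>coord_sum j e S\<bar> * sqrt ?H \<le> 1 / sqrt ?G * sqrt ?H"
      by (rule mult_right_mono) (simp add: nonneg)
    then show "y \<le> sqrt ?H / sqrt ?G"
      by (simp add: y H[OF S(1)])
  qed
qed

lemma inner_productD:
  assumes "inner_product g"
  shows "bilinear g" "g u v = g v u" "u \<noteq> 0 \<Longrightarrow> g u u > 0" "g u u \<ge> 0"
  using assms bilinear_lzero[of g 0] by (cases "u = 0"; force simp: inner_product_def)+

lemma inner_product_pullback:
  assumes h: "inner_product h" and L: "linear L" "inj L"
  shows "inner_product (\<lambda>u v. h (L u) (L v))"
proof -
  have "L u \<noteq> 0" if "u \<noteq> 0" for u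
    using that linear_injective_0[OF L(1)] L(2) by auto
  then show ?thesis
    using h L(1) unfolding inner_product_def bilinear_def
    by (auto intro!: linear_compose[of L, unfolded comp_def])
qed

lemma inner_product_Cauchy_Schwarz:
  assumes h: "inner_product h"
  shows "(h u v)\<^sup>2 \<le> h u u * h v v"
proof (cases "v = 0")
  case True
  then show ?thesis using bilinear_rzero[OF inner_productD(1)[OF h]] by simp
next
  case False
  note b = inner_productD(1)[OF h]
  \<comment> \<open>The component of \<open>u\<close> orthogonal to \<open>v\<close>, scaled by
    \<open>h v v\<close> to avoid division.\<close>
  let ?w = "h v v *\<^sub>R u - h u v *\<^sub>R v"
  have "0 \<le> h ?w ?w" by (rule inner_productD(4)[OF h])
  also have "h ?w ?w = h v v * (h u u * h v v - (h u v)\<^sup>2)"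
    by (simp add: bilinear_lsub[OF b] bilinear_rsub[OF b] bilinear_lmul[OF b] bilinear_rmul[OF b]
        inner_productD(2)[OF h, of v u] power2_eq_square algebra_simps)
  finally show ?thesis
    using inner_productD(3)[OF h False] by (simp add: zero_le_mult_iff)
qed

section \<open>Orthonormal systems for an arbitrary inner product\<close>

definition orthonormal :: "nat \<Rightarrow> ('v \<Rightarrow> 'v \<Rightarrow> real) \<Rightarrow> (nat \<Rightarrow> 'v) \<Rightarrow> bool" where
  "orthonormal n g e \<longleftrightarrow> (\<forall>i<n. \<forall>l<n. g (e i) (e l) = (if i = l then 1 else 0))"

lemma orthonormal_gramd: "orthonormal n g e \<Longrightarrow> gramd n g e = 1"
  unfolding gramd_def orthonormal_def
  by (subst jdet_cong[of n _ "\<lambda>i l. if i = l then 1 else 0"]) (auto simp: jdet_id)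

lemma orthonormal_coeff:
  assumes "bilinear g" "orthonormal n g e" "l < n"
  shows "g (\<Sum>i<n. a i *\<^sub>R e i) (e l) = a l"
proof -
  have "g (\<Sum>i<n. a i *\<^sub>R e i) (e l) = (\<Sum>i<n. a i * g (e i) (e l))"
  proof -
    have "linear (\<lambda>u. g u (e l))" using assms(1) by (simp add: bilinear_def)
    note lin = linear_sum[OF this] linear_scale[OF this]
    show ?thesis by (simp add: lin)
  qed
  also have "\<dots> = (\<Sum>i<n. if i = l then a i else 0)"
    using assms by (intro sum.cong) (auto simp: orthonormal_def)
  finally show ?thesis using assms(3) by simp
qed

lemma orthonormal_independent:
  assumes g: "bilinear g" and e: "orthonormal n g e"
  shows "inj_on e {..<n}" "independent (e ` {..<n})"
proof -
  show inj: "inj_on e {..<n}"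
  proof (rule inj_onI)
    fix i l assume "i \<in> {..<n}" "l \<in> {..<n}" "e i = e l"
    then show "i = l" using e unfolding orthonormal_def by (metis lessThan_iff zero_neq_one)
  qed
  show "independent (e ` {..<n})"
  proof
    assume "dependent (e ` {..<n})"
    then obtain u v where "v \<in> e ` {..<n}" "u v \<noteq> 0" "(\<Sum>v\<in>e ` {..<n}. u v *\<^sub>R v) = 0"
      by (auto simp: real_vector.dependent_finite)
    then obtain l where l: "l < n" "u (e l) \<noteq> 0" and 0: "(\<Sum>i<n. u (e i) *\<^sub>R e i) = 0"
      by (auto simp: sum.reindex[OF inj])
    from orthonormal_coeff[OF g e l(1), of "\<lambda>i. u (e i)"] show False
      using 0 l(2) bilinear_lzero[OF g] by simp
  qed
qed

lemma orthonormal_append: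
  assumes g: "inner_product g" and e: "orthonormal n g e" and w: "w \<noteq> 0" "\<And>i. i < n \<Longrightarrow> g w (e i) = 0"
  shows "orthonormal (Suc n) g (e(n := w /\<^sub>R sqrt (g w w)))"
proof -
  note b = inner_productD(1)[OF g]
  let ?w = "w /\<^sub>R sqrt (g w w)"
  have "g w w > 0" using inner_productD(3)[OF g w(1)] .
  then have 1: "g ?w ?w = 1"
    by (simp add: bilinear_lmul[OF b] bilinear_rmul[OF b] flip: mult.assoc)
       (simp add: field_simps flip: power2_eq_square)
  have 0: "g ?w (e i) = 0" "g (e i) ?w = 0" if "i < n" for i
    using w(2)[OF that] inner_productD(2)[OF g, of w "e i"]
    by (simp_all add: bilinear_lmul[OF b] bilinear_rmul[OF b])
  show ?thesis
    unfolding orthonormal_def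
  proof (intro allI impI)
    fix i l assume "i < Suc n" "l < Suc n"
    then consider "i < n" "l < n" | "i = n" "l < n" | "i < n" "l = n" | "i = n" "l = n" by linarith
    then show "g ((e(n := ?w)) i) ((e(n := ?w)) l) = (if i = l then 1 else 0)"
      by cases (use e 0 1 in \<open>simp_all add: orthonormal_def\<close>)
  qed
qed

text \<open>Gram-Schmidt: fewer than \<open>dim E\<close> vectors leave some \<open>v\<close> in
  \<open>E\<close> outside their span, and its orthogonal component can be normalised and appended.
  Starting from a given system \<open>e\<close> is what later yields bases of the whole space
  adapted to a plane.\<close>

lemma orthonormal_extend:
  fixes E :: "'v::euclidean_space set"
  assumes g: "inner_product g" and E: "subspace E" and n: "n \<le> dim E"
    and e: "orthonormal n g e" "\<And>i. i < n \<Longrightarrow> e i \<in> E"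
  obtains e' where "orthonormal (dim E) g e'" "\<forall>i<dim E. e' i \<in> E" "\<forall>i<n. e' i = e i"
proof -
  note b = inner_productD(1)[OF g]
  have "\<exists>e'. orthonormal d g e' \<and> (\<forall>i<d. e' i \<in> E) \<and> (\<forall>i<n. e' i = e i)"
    if "n \<le> d" "d \<le> dim E" for d
    using that
  proof (induction d rule: dec_induct)
    case base
    then show ?case using e by blast
  next
    case (step d)
    then obtain e' where e': "orthonormal d g e'" "\<forall>i<d. e' i \<in> E" "\<forall>i<n. e' i = e i" by auto
    have "\<not> E \<subseteq> span (e' ` {..<d})"
    proof
      assume "E \<subseteq> span (e' ` {..<d})"
      then have "dim E \<le> card (e' ` {..<d})" by (rule dim_le_card) simp
      also have "\<dots> \<le> d" using card_image_le[of "{..<d}" e'] by simp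
      finally show False using step.prems by simp
    qed
    then obtain v where v: "v \<in> E" "v \<notin> span (e' ` {..<d})" by blast
    let ?p = "\<Sum>i<d. g v (e' i) *\<^sub>R e' i"
    have p: "?p \<in> span (e' ` {..<d})"
      by (intro span_sum span_scale span_base) auto
    have pE: "?p \<in> E"
      using e'(2) E by (intro subspace_sum subspace_scale) auto
    let ?w = "v - ?p"
    have w: "?w \<noteq> 0" using p v by auto
    have "g ?w (e' i) = 0" if "i < d" for i
      using orthonormal_coeff[OF b e'(1) that, of "\<lambda>i. g v (e' i)"] by (simp add: bilinear_lsub[OF b])
    from orthonormal_append[OF g e'(1) w this]
    have "orthonormal (Suc d) g (e'(d := ?w /\<^sub>R sqrt (g ?w ?w)))" .
    moreover have "\<forall>i<Suc d. (e'(d := ?w /\<^sub>R sqrt (g ?w ?w))) i \<in> E"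
      using e'(2) subspace_diff[OF E v(1) pE] E by (auto simp: less_Suc_eq subspace_scale)
    moreover have "\<forall>i<n. (e'(d := ?w /\<^sub>R sqrt (g ?w ?w))) i = e i"
      using e'(3) step.hyps by auto
    ultimately show ?case by blast
  qed
  from this[OF n order_refl] that show ?thesis by blast
qed

text \<open>A nonzero remainder \<open>u - ?p\<close>, once normalised, would give
  \<open>dim E + 1\<close> orthonormal and hence independent vectors in \<open>E\<close>.\<close>

lemma orthonormal_expand:
  fixes E :: "'v::euclidean_space set"
  assumes g: "inner_product g" and E: "subspace E" and e: "orthonormal (dim E) g e"
    and eE: "\<And>i. i < dim E \<Longrightarrow> e i \<in> E" and u: "u \<in> E"
  shows "u = (\<Sum>i<dim E. g u (e i) *\<^sub>R e i)"
proof (rule ccontr)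
  note b = inner_productD(1)[OF g]
  let ?d = "dim E"
  let ?p = "\<Sum>i<?d. g u (e i) *\<^sub>R e i"
  let ?w = "u - ?p"
  let ?e = "e(?d := ?w /\<^sub>R sqrt (g ?w ?w))"
  assume "u \<noteq> ?p"
  then have w: "?w \<noteq> 0" by simp
  have "g ?w (e i) = 0" if "i < ?d" for i
    using orthonormal_coeff[OF b e that, of "\<lambda>i. g u (e i)"] by (simp add: bilinear_lsub[OF b])
  from orthonormal_append[OF g e w this] have on: "orthonormal (Suc ?d) g ?e" .
  have pE: "?p \<in> E" using eE E by (intro subspace_sum subspace_scale) auto
  have sub: "?e ` {..<Suc ?d} \<subseteq> E"
    using eE subspace_diff[OF E u pE] E by (auto simp: less_Suc_eq subspace_scale)
  have "Suc ?d = card (?e ` {..<Suc ?d})"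
    using card_image[OF orthonormal_independent(1)[OF b on]] by (simp only: card_lessThan)
  also have "\<dots> \<le> ?d"
    by (rule independent_card_le_dim[OF sub orthonormal_independent(2)[OF b on]])
  finally show False by simp
qed

lemma orthonormal_frame:
  fixes E :: "'v::euclidean_space set"
  assumes g: "inner_product g" and E: "subspace E" and e: "orthonormal (dim E) g e"
    and eE: "\<And>i. i < dim E \<Longrightarrow> e i \<in> E"
  shows "frame (dim E) E e"
  unfolding frame_def
proof (intro conjI allI impI ballI)
  show "\<exists>a. u = (\<Sum>i<dim E. a i *\<^sub>R e i)" if "u \<in> E" for u
    by (rule exI, rule orthonormal_expand[OF g E e eE that])
qed (rule eE)

lemma orthonormal_frame_exists:
  fixes E :: "'v::euclidean_space set"
  assumes g: "inner_product g" and E: "subspace E"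
  obtains e where "orthonormal (dim E) g e" "frame (dim E) E e"
proof -
  have "orthonormal 0 g (\<lambda>_. 0)" by (simp add: orthonormal_def)
  from orthonormal_extend[OF g E le0 this]
  obtain e where e: "orthonormal (dim E) g e" and eE: "\<forall>i<dim E. e i \<in> E"
    by auto
  show ?thesis by (rule that[OF e orthonormal_frame[OF g E e]]) (simp add: eE)
qed

lemma grassmannian_frame_exists:
  fixes E :: "'v::euclidean_space set"
  assumes g: "inner_product g" and E: "E \<in> grassmannian j"
  obtains e where "orthonormal j g e" "frame j E e"
proof -
  have E': "subspace E" "dim E = j" using E by (simp_all add: grassmannian_def)
  show ?thesis
    by (rule orthonormal_frame_exists[OF g E'(1)], unfold E'(2)) (rule that)
qed

text \<open>Expanding an orthonormal basis of \<open>E\<close> in the frame exhibits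
  \<open>1\<close> as a square times \<open>gramd (dim E) g e\<close>.\<close>

lemma gramd_frame_pos:
  fixes E :: "'v::euclidean_space set"
  assumes g: "inner_product g" and E: "subspace E" and e: "frame (dim E) E e"
  shows "gramd (dim E) g e > 0"
proof -
  obtain o' where o': "orthonormal (dim E) g o'" "frame (dim E) E o'"
    by (rule orthonormal_frame_exists[OF g E])
  obtain A where "\<And>i. i < dim E \<Longrightarrow> o' i = (\<Sum>q<dim E. A i q *\<^sub>R e q)"
    by (rule frameD[OF e, of o']) (use o'(2) in \<open>auto simp: frame_def\<close>)
  from gramd_expand[OF inner_productD(1)[OF g] this] orthonormal_gramd[OF o'(1)]
  have "1 = (jdet (dim E) A)\<^sup>2 * gramd (dim E) g e" by simp
  then have "0 < (jdet (dim E) A)\<^sup>2 * gramd (dim E) g e" by simp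
  then show ?thesis by (simp add: zero_less_mult_iff)
qed

lemma jac_frame_inj:
  fixes E :: "'v::euclidean_space set" and L :: "'v \<Rightarrow> 'w::real_vector"
  assumes g: "inner_product g" and h: "inner_product h" and L: "linear L" "inj L"
    and E: "E \<in> grassmannian j" and e: "frame j E e"
  shows "jac j g h L E = sqrt (gramd j h (L \<circ> e)) / sqrt (gramd j g e)"
    "gramd j h (L \<circ> e) > 0" "gramd j g e > 0"
proof -
  have E': "subspace E" "dim E = j" using E by (auto simp: grassmannian_def)
  show G: "gramd j g e > 0" 
    by (rule gramd_frame_pos[OF g E'(1), of e, unfolded E'(2), OF e])
  \<comment> \<open>Seen as a Gram determinant of \<open>e\<close> itself, for the pulled back inner
    product, it is positive by the same lemma.\<close>
  have "gramd j h (L \<circ> e) = gramd j (\<lambda>u v. h (L u) (L v)) e" by (simp add: gramd_def)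
  also have "\<dots> > 0"
    by (rule gramd_frame_pos[OF inner_product_pullback[OF h L] E'(1), of e, unfolded E'(2), OF e])
  finally show H: "gramd j h (L \<circ> e) > 0" .
  show "jac j g h L E = sqrt (gramd j h (L \<circ> e)) / sqrt (gramd j g e)"
    using jac_frame[OF inner_productD(1)[OF g] inner_productD(1)[OF h] L(1) e G] H by simp
qed


section \<open>Upper and lower bounds for Jacobians\<close>

lemma jdet_bound:
  assumes "\<And>i l. i < n \<Longrightarrow> l < n \<Longrightarrow> \<bar>A i l\<bar> \<le> c"
  shows "\<bar>jdet n A\<bar> \<le> fact n * c ^ n"
proof -
  have p: "p i < n" if "p permutes {..<n}" "i < n" for p i
    using permutes_in_image[OF that(1), of i] that(2) by simp
  have "\<bar>jdet n A\<bar> \<le> (\<Sum>p | p permutes {..<n}. \<bar>of_int (sign p) * (\<Prod>i<n. A i (p i))\<bar>)"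
    unfolding jdet_expand by (rule sum_abs)
  also have "\<dots> \<le> (\<Sum>p | p permutes {..<n}. c ^ n)"
  proof (rule sum_mono)
    fix p assume "p \<in> {p. p permutes {..<n}}"
    then have perm: "p permutes {..<n}" by simp
    have "\<bar>A i (p i)\<bar> \<le> c" if "i < n" for i
      by (rule assms[OF that p[OF perm that]])
    then have "(\<Prod>i<n. \<bar>A i (p i)\<bar>) \<le> (\<Prod>i<n. c)"
      by (intro prod_mono) simp
    then show "\<bar>of_int (sign p) * (\<Prod>i<n. A i (p i))\<bar> \<le> c ^ n"
      by (simp add: abs_mult abs_prod sign_def)
  qed
  also have "\<dots> = fact n * c ^ n"
    by (simp add: card_permutations[of "{..<n}" n])
  finally show ?thesis .
qed

text \<open>By Cauchy-Schwarz the Gram entries of the image of an orthonormal basis are at most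
  \<open>C\<^sup>2\<close>; the Leibniz sum with its \<open>j!\<close> terms produces the factor
  \<open>sqrt (fact j)\<close>. This is cruder than Hadamard's inequality, but after the logarithm
  it only adds a constant.\<close>

lemma jac_bound:
  fixes E :: "'v::euclidean_space set" and L :: "'v \<Rightarrow> 'w::real_vector"
  assumes g: "inner_product g" and h: "inner_product h" and L: "linear L" "inj L"
    and E: "E \<in> grassmannian j"
    and C: "C \<ge> 0" "\<And>u. h (L u) (L u) \<le> C\<^sup>2 * g u u"
  shows "jac j g h L E \<le> sqrt (fact j) * C ^ j"
proof -
  obtain e where e: "orthonormal j g e" "frame j E e"
    by (rule grassmannian_frame_exists[OF g E])
  have "\<bar>h (L (e i)) (L (e l))\<bar> \<le> C\<^sup>2" if "i < j" "l < j" for i l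
  proof -
    have "h (L (e q)) (L (e q)) \<le> C\<^sup>2" if "q < j" for q
      using C(2)[of "e q"] e(1) that by (simp add: orthonormal_def)
    note q = this
    have "(h (L (e i)) (L (e l)))\<^sup>2 \<le> h (L (e i)) (L (e i)) * h (L (e l)) (L (e l))"
      by (rule inner_product_Cauchy_Schwarz[OF h])
    also have "\<dots> \<le> C\<^sup>2 * C\<^sup>2"
      by (rule mult_mono[OF q[OF that(1)] q[OF that(2)] zero_le_power2 inner_productD(4)[OF h]])
    also have "\<dots> = (C\<^sup>2)\<^sup>2" by (simp add: power2_eq_square)
    finally show ?thesis
      using abs_le_square_iff[of "h (L (e i)) (L (e l))" "C\<^sup>2"] by simp
  qed
  from jdet_bound[OF this]
  have "gramd j h (L \<circ> e) \<le> fact j * (C\<^sup>2) ^ j"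
    unfolding gramd_def comp_def by (rule abs_le_D1)
  then have "sqrt (gramd j h (L \<circ> e)) \<le> sqrt (fact j * (C\<^sup>2) ^ j)" by simp
  also have "\<dots> = sqrt (fact j) * C ^ j"
    using C(1) by (simp add: real_sqrt_mult real_sqrt_power)
  finally show ?thesis
    by (simp only: jac_frame_inj(1)[OF g h L E e(2)] orthonormal_gramd[OF e(1)] real_sqrt_one div_by_1)
qed

lemma linear_inv_into:
  assumes "linear L" "bij L"
  shows "linear (inv_into UNIV L)"
proof (rule linearI)
  have eq: "inv_into UNIV L w = v \<longleftrightarrow> L v = w" for v w
    using assms(2) by (metis bij_inv_eq_iff)
  have L: "L (inv_into UNIV L w) = w" for w using eq by blast
  show "inv_into UNIV L (u + v) = inv_into UNIV L u + inv_into UNIV L v" for u v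
    unfolding eq by (simp add: linear_add[OF assms(1)] L)
  show "inv_into UNIV L (r *\<^sub>R v) = r *\<^sub>R inv_into UNIV L v" for r v
    unfolding eq by (simp add: linear_scale[OF assms(1)] L)
qed

lemma grassmannian_image:
  fixes E :: "'v::euclidean_space set" and L :: "'v \<Rightarrow> 'w::euclidean_space"
  assumes "linear L" "inj L" "E \<in> grassmannian j"
  shows "L ` E \<in> grassmannian j"
proof -
  have "dim (L ` E) = dim E"
    by (rule dim_image_eq[OF assms(1)]) (rule inj_on_subset[OF assms(2) subset_UNIV])
  then show ?thesis
    using assms(3) linear_subspace_image[OF assms(1), of E] by (simp add: grassmannian_def)
qed

lemma jac_pos:
  fixes E :: "'v::euclidean_space set" and L :: "'v \<Rightarrow> 'w::real_vector"
  assumes g: "inner_product g" and h: "inner_product h" and L: "linear L" "inj L"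
    and E: "E \<in> grassmannian j"
  shows "jac j g h L E > 0"
proof -
  obtain e where e: "frame j E e"
    by (rule grassmannian_frame_exists[OF g E])
  show ?thesis using jac_frame_inj[OF g h L E e] by simp
qed

text \<open>The tuple \<open>L \<circ> e\<close> is a frame of the image plane and the inverse
  carries it back to \<open>e\<close>, so the two Gram determinants merely trade places.\<close>

lemma jac_inverse:
  fixes E :: "'v::euclidean_space set" and L :: "'v \<Rightarrow> 'w::euclidean_space"
  assumes g: "inner_product g" and h: "inner_product h" and L: "linear L" "bij L"
    and E: "E \<in> grassmannian j"
  shows "jac j h g (inv_into UNIV L) (L ` E) = inverse (jac j g h L E)"
proof -
  obtain e where e: "frame j E e"
    by (rule grassmannian_frame_exists[OF g E])
  have inj: "inj L" and Linv: "linear (inv_into UNIV L)" "inj (inv_into UNIV L)"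
    using L by (auto simp: bij_is_inj bij_is_surj linear_inv_into surj_imp_inj_inv)
  note 1 = jac_frame_inj[OF g h L(1) inj E e]
  note 2 = jac_frame_inj[OF h g Linv grassmannian_image[OF L(1) inj E] frame_image[OF L(1) e]]
  have "inv_into UNIV L \<circ> (L \<circ> e) = e" by (simp add: fun_eq_iff inj)
  then show ?thesis using 1(1) 2(1) by simp
qed

lemma ln_le_log_plus: "t \<ge> 0 \<Longrightarrow> 0 < x \<Longrightarrow> x \<le> c * t ^ j \<Longrightarrow> c \<ge> 1 \<Longrightarrow> ln x \<le> ln c + j * log_plus t"
  for t x c :: real and j :: nat
proof -
  assume t: "t \<ge> 0" and x: "0 < x" "x \<le> c * t ^ j" and c: "c \<ge> 1"
  \<comment> \<open>Passing from \<open>t\<close> to \<open>max 1 t\<close> includes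
    \<open>t = 0\<close> and makes the logarithm nonnegative.\<close>
  have "x \<le> c * max 1 t ^ j"
    using x(2) t c by (elim order_trans) (intro mult_left_mono power_mono; simp)
  then have "ln x \<le> ln (c * max 1 t ^ j)"
    using x(1) by (simp add: ln_mono)
  also have "\<dots> = ln c + j * ln (max 1 t)"
    using c by (simp add: ln_mult ln_realpow)
  also have "ln (max 1 t) \<le> log_plus t"
    by (simp add: log_plus_def max_def)
  finally show ?thesis by (simp add: mult_left_mono)
qed

text \<open>The lower bound is the upper bound for the inverse map on the image plane, whose
  Jacobian is the reciprocal.\<close>

lemma abs_ln_jac_bound:
  fixes E :: "'v::euclidean_space set" and L :: "'v \<Rightarrow> 'w::euclidean_space"
  assumes g: "inner_product g" and h: "inner_product h" and L: "linear L" "bij L"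
    and E: "E \<in> grassmannian j"
    and C: "C \<ge> 0" "\<And>u. h (L u) (L u) \<le> C\<^sup>2 * g u u"
    and D: "D \<ge> 0" "\<And>u. g (inv_into UNIV L u) (inv_into UNIV L u) \<le> D\<^sup>2 * h u u"
  shows "\<bar>ln (jac j g h L E)\<bar> \<le> ln (sqrt (fact j)) + j * (log_plus C + log_plus D)"
proof -
  have inj: "inj L" and Linv: "linear (inv_into UNIV L)" "inj (inv_into UNIV L)"
    using L by (auto simp: bij_is_inj bij_is_surj linear_inv_into surj_imp_inj_inv)
  note E' = grassmannian_image[OF L(1) inj E]
  have c: "sqrt (fact j) \<ge> (1::real)" by simp
  note pos = jac_pos[OF g h L(1) inj E]
  have 1: "ln (jac j g h L E) \<le> ln (sqrt (fact j)) + j * log_plus C"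
    by (rule ln_le_log_plus[OF C(1) pos jac_bound[OF g h L(1) inj E C] c])
  have 2: "ln (jac j h g (inv_into UNIV L) (L ` E)) \<le> ln (sqrt (fact j)) + j * log_plus D"
    by (rule ln_le_log_plus[OF D(1) jac_pos[OF h g Linv E'] jac_bound[OF h g Linv E' D] c])
  have 3: "ln (jac j h g (inv_into UNIV L) (L ` E)) = - ln (jac j g h L E)"
    unfolding jac_inverse[OF g h L E] using pos by (simp add: ln_inverse)
  have "log_plus C \<ge> 0" "log_plus D \<ge> 0" by (simp_all add: log_plus_def)
  then have "j * log_plus C \<ge> 0" "j * log_plus D \<ge> 0" by simp_all
  with 1 2 3 show ?thesis by (simp add: algebra_simps abs_le_iff)
qed

no_notation vec_index (infixl "$" 100)
no_notation scalar_prod (infix "\<bullet>" 70)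

text \<open>For the standard basis, the Gram matrix of the images is the matrix of \<open>h\<close>
  multiplied by \<open>matrix L\<close> on the right and its transpose on the left. Treating the
  determinant as the Jacobian of the full tangent space gives it the measurability and the bounds
  proved for Jacobians.\<close>

lemma abs_det_eq_jac:
  fixes g h :: "real ^ 'm \<Rightarrow> real ^ 'm \<Rightarrow> real"
  assumes g: "inner_product g" and h: "inner_product h" and L: "linear L" "bij L"
  shows "abs_det g h L = jac CARD('m::finite) g h L UNIV"
proof -
  let ?m = "CARD('m)"
  note bg = inner_productD(1)[OF g] and bh = inner_productD(1)[OF h]
  obtain b where b: "bij_betw b {..<?m} (UNIV :: 'm set)"
    using ex_bij_betw_nat_finite[of "UNIV :: 'm set"] by (auto simp: atLeast0LessThan)
  let ?e = "\<lambda>i. axis (b i) 1 :: real ^ 'm"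
  have frame: "frame ?m UNIV ?e"
    unfolding frame_def
  proof (intro conjI allI impI ballI exI)
    show "u = (\<Sum>q<?m. (u $ b q) *\<^sub>R ?e q)" for u
    proof -
      have "u = (\<Sum>i\<in>UNIV. (u $ i) *\<^sub>R axis i 1)"
        using basis_expansion[of u] by (simp add: scalar_mult_eq_scaleR)
      also have "\<dots> = (\<Sum>q<?m. (u $ b q) *\<^sub>R ?e q)"
        by (rule sum.reindex_bij_betw[OF b, symmetric])
      finally show ?thesis .
    qed
  qed simp
  have U: "(UNIV :: (real ^ 'm) set) \<in> grassmannian ?m"
    by (simp add: grassmannian_def)
  note j = jac_frame_inj[OF g h L(1) bij_is_inj[OF L(2)] U frame]
  have G: "gramd ?m g ?e = gram_det g"
    unfolding gramd_def gram_det_def det_eq_jdet[OF b] by simp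
  let ?H = "\<chi> i l. h (axis i 1) (axis l 1)"
  have "h (L (axis i 1)) (L (axis l 1)) = (transpose (matrix L) ** ?H ** matrix L) $ i $ l" for i l
  proof -
    have exp: "L (axis i 1) = (\<Sum>q\<in>UNIV. matrix L $ q $ i *\<^sub>R axis q 1)" for i
      using basis_expansion[of "L (axis i 1)"] by (simp add: scalar_mult_eq_scaleR matrix_def)
    have "h (L (axis i 1)) (L (axis l 1)) =
      (\<Sum>q\<in>UNIV. \<Sum>r\<in>UNIV. matrix L $ q $ i * (matrix L $ r $ l * h (axis q 1) (axis r 1)))"
      unfolding exp bilinear_sum[OF bh] sum.cartesian_product[symmetric]
      by (simp add: bilinear_lmul[OF bh] bilinear_rmul[OF bh] mult.left_commute)
    also have "\<dots> = (\<Sum>r\<in>UNIV. \<Sum>q\<in>UNIV. matrix L $ q $ i * (matrix L $ r $ l * h (axis q 1) (axis r 1)))"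
      by (rule sum.swap)
    also have "\<dots> = (transpose (matrix L) ** ?H ** matrix L) $ i $ l"
      by (simp add: matrix_matrix_mult_def Finite_Cartesian_Product.transpose_def sum_distrib_left mult_ac)
    finally show ?thesis .
  qed
  then have "gramd ?m h (L \<circ> ?e) = Determinants.det (transpose (matrix L) ** ?H ** matrix L)"
    unfolding gramd_def det_eq_jdet[OF b] by simp
  also have "\<dots> = (Determinants.det (matrix L))\<^sup>2 * gram_det h"
    by (simp add: det_mul det_transpose gram_det_def power2_eq_square)
  finally have "gramd ?m h (L \<circ> ?e) = (Determinants.det (matrix L))\<^sup>2 * gram_det h" .
  with j(1) G show ?thesis by (simp add: abs_det_def real_sqrt_mult)
qed

subsection \<open>Annihilators and the duality of Jacobians\<close>

definition ann :: "'v::real_normed_vector set \<Rightarrow> ('v \<Rightarrow>\<^sub>L real) set" where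
  "ann E = {\<xi>. \<forall>v\<in>E. blinfun_apply \<xi> v = 0}"

lemma dual_inverse_apply:
  fixes L :: "'v::euclidean_space \<Rightarrow> 'w::euclidean_space"
  assumes "linear L" "bij L"
  shows "blinfun_apply (dual_inverse L \<xi>) w = blinfun_apply \<xi> (inv_into UNIV L w)"
proof -
  have "bounded_linear (\<lambda>w. blinfun_apply \<xi> (inv_into UNIV L w))"
    using linear_compose[OF linear_inv_into[OF assms], of "blinfun_apply \<xi>"]
    by (simp add: linear_conv_bounded_linear comp_def blinfun.bounded_linear_right)
  then show ?thesis by (simp add: dual_inverse_def bounded_linear_Blinfun_apply)
qed

lemma linear_dual_inverse:
  fixes L :: "'v::euclidean_space \<Rightarrow> 'w::euclidean_space"
  assumes "linear L" "bij L"
  shows "linear (dual_inverse L)"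
  by (rule linearI; rule blinfun_eqI)
    (simp_all add: dual_inverse_apply[OF assms] blinfun.add_left blinfun.scaleR_left)

lemma ann_image:
  fixes L :: "'v::euclidean_space \<Rightarrow> 'w::euclidean_space"
  assumes L: "linear L" "bij L"
  shows "ann (L ` E) = dual_inverse L ` ann E"
proof (intro equalityI subsetI)
  fix \<xi> assume \<xi>: "\<xi> \<in> ann (L ` E)"
  have lin: "bounded_linear (\<lambda>v. blinfun_apply \<xi> (L v))"
    using linear_compose[OF L(1), of "blinfun_apply \<xi>"]
    by (simp add: linear_conv_bounded_linear comp_def blinfun.bounded_linear_right)
  show "\<xi> \<in> dual_inverse L ` ann E"
  proof (rule image_eqI)
    show "Blinfun (\<lambda>v. blinfun_apply \<xi> (L v)) \<in> ann E"
      using \<xi> by (simp add: ann_def bounded_linear_Blinfun_apply[OF lin])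
    show "\<xi> = dual_inverse L (Blinfun (\<lambda>v. blinfun_apply \<xi> (L v)))"
      by (rule blinfun_eqI) (simp add: dual_inverse_apply[OF L] bounded_linear_Blinfun_apply[OF lin]
          surj_f_inv_f[OF bij_is_surj[OF L(2)]])
  qed
next
  have inv: "inv_into UNIV L (L v) = v" for v using L(2) by (simp add: bij_is_inj)
  fix \<xi> assume "\<xi> \<in> dual_inverse L ` ann E"
  then show "\<xi> \<in> ann (L ` E)" by (auto simp: ann_def dual_inverse_apply[OF L] inv)
qed

section \<open>The dual inner product in an orthonormal basis\<close>

context
  fixes M :: "('a, 'm::finite) riemannian" and x :: 'a and e :: "nat \<Rightarrow> real ^ 'm"
  assumes g: "inner_product (metric M x)" and e: "orthonormal CARD('m) (metric M x) e"
begin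

lemma orthonormal_basis_expand: "u = (\<Sum>i<CARD('m). metric M x u (e i) *\<^sub>R e i)"
  using orthonormal_expand[OF g subspace_UNIV, of e u] e by simp

text \<open>The coordinates of \<open>sharp M x \<xi>\<close> in an orthonormal basis are the values
  of \<open>\<xi>\<close> on that basis, so the cometric is the standard inner product of these
  tuples of values.\<close>

lemma cometric_expand:
  "cometric M x \<xi> \<eta> = (\<Sum>i<CARD('m). blinfun_apply \<xi> (e i) * blinfun_apply \<eta> (e i))"
proof -
  note b = inner_productD(1)[OF g]
  let ?s = "\<lambda>\<xi>. \<Sum>i<CARD('m). blinfun_apply \<xi> (e i) *\<^sub>R e i"
  have lin: "linear (\<lambda>u. metric M x u v)" for v using b by (simp add: bilinear_def)
  have s: "metric M x (?s \<xi>) v = blinfun_apply \<xi> v" for \<xi> v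
  proof -
    have "metric M x (?s \<xi>) v = (\<Sum>i<CARD('m). blinfun_apply \<xi> (e i) * metric M x v (e i))"
      using inner_productD(2)[OF g, of v] by (simp add: linear_sum[OF lin] linear_scale[OF lin])
    also have "\<dots> = blinfun_apply \<xi> (\<Sum>i<CARD('m). metric M x v (e i) *\<^sub>R e i)"
      by (simp add: blinfun.sum_right blinfun.scaleR_right mult.commute)
    finally show ?thesis by (simp flip: orthonormal_basis_expand)
  qed
  have "sharp M x \<xi> = ?s \<xi>" for \<xi>
    unfolding sharp_def
  proof (rule the_equality)
    show "\<forall>v. metric M x (?s \<xi>) v = blinfun_apply \<xi> v" using s by blast
    show "u = ?s \<xi>" if "\<forall>v. metric M x u v = blinfun_apply \<xi> v" for u
      using orthonormal_basis_expand[of u] that by simp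
  qed
  then show ?thesis
    unfolding cometric_def s by (simp add: s blinfun.sum_right blinfun.scaleR_right mult.commute)
qed

lemma bilinear_cometric: "bilinear (cometric M x)"
  unfolding bilinear_def cometric_expand
  by (auto intro!: linearI simp: blinfun.add_left blinfun.scaleR_left sum.distrib sum_distrib_left
      algebra_simps)

end

lemma sum_lessThan_add: "(\<Sum>i<n + k. f i) = (\<Sum>i<n. f i) + (\<Sum>i<k. f (n + i))"
  for f :: "nat \<Rightarrow> 'b::comm_monoid_add"
  by (induction k) (simp_all add: add.assoc)

text \<open>In adapted bases the matrix \<open>N\<close> of the inverse of \<open>L\<close> is block
  triangular. Its first diagonal block inverts that of \<open>A\<close> and has determinant
  \<open>\<plusminus> 1 / Jac\<^sub>j\<close>, the whole of \<open>N\<close> has determinant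
  \<open>\<plusminus> 1 / abs_det\<close>, and the remaining block describes the dual map on
  annihilators.\<close>

lemma jac_dual:
  fixes M :: "('a, 'm::finite) riemannian"
  assumes g: "inner_product (metric M x)" and h: "inner_product (metric M y)"
    and L: "linear L" "bij L" and E: "E \<in> grassmannian j" and jk: "j + k = CARD('m)"
  shows "jac k (cometric M x) (cometric M y) (dual_inverse L) (ann E) =
    jac j (metric M x) (metric M y) L E / abs_det (metric M x) (metric M y) L"
proof -
  let ?g = "metric M x" and ?h = "metric M y" and ?m = "CARD('m)" and ?I = "inv_into UNIV L"
  note bg = inner_productD(1)[OF g] and bh = inner_productD(1)[OF h]
  have inj: "inj L" using L(2) by (rule bij_is_inj)
  have IL: "?I (L u) = u" for u using inj by simp
  have LI: "L (?I u) = u" for u by (rule surj_f_inv_f[OF bij_is_surj[OF L(2)]])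
  have E': "subspace E" "dim E = j" using E by (auto simp: grassmannian_def)
  have LE: "subspace (L ` E)" "dim (L ` E) = j"
    using grassmannian_image[OF L(1) inj E] by (auto simp: grassmannian_def)
  \<comment> \<open>An orthonormal basis of the plane is chosen first and then completed, so that
    the bases of source and target respect \<open>E\<close> and its image.\<close>
  have adapted: "\<exists>e. orthonormal ?m q e \<and> orthonormal j q e \<and> (\<forall>i<j. e i \<in> S)"
    if q: "inner_product q" and S: "subspace S" "dim S = j" for q :: "real ^ 'm \<Rightarrow> _" and S
  proof -
    obtain e0 where e0: "orthonormal j q e0" "frame j S e0"
      by (rule grassmannian_frame_exists[OF q, of S j]) (use S in \<open>simp_all add: grassmannian_def\<close>)
    have "j \<le> dim (UNIV :: (real ^ 'm) set)" using jk by simp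
    from orthonormal_extend[OF q subspace_UNIV this e0(1)]
    obtain e where e: "orthonormal ?m q e" "\<forall>i<j. e i = e0 i" by auto
    have "orthonormal j q e" "\<forall>i<j. e i \<in> S"
      using e(2) e0 by (simp_all add: orthonormal_def frame_def)
    with e(1) show ?thesis by blast
  qed
  obtain e where e: "orthonormal ?m ?g e" "orthonormal j ?g e" "\<forall>i<j. e i \<in> E"
    using adapted[OF g E'] by blast
  obtain e' where e': "orthonormal ?m ?h e'" "orthonormal j ?h e'" "\<forall>i<j. e' i \<in> L ` E"
    using adapted[OF h LE] by blast
  have frameE: "frame j E e"
    using orthonormal_frame[OF g E'(1), of e] e E' by simp
  have frameU: "frame ?m UNIV e"
    using orthonormal_frame[OF g subspace_UNIV, of e] e by simp
  have frameLE: "frame j (L ` E) e'"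
    using orthonormal_frame[OF h LE(1), of e'] e' LE by simp
  have U: "(UNIV :: (real ^ 'm) set) \<in> grassmannian ?m" by (simp add: grassmannian_def)
  have orth: "q u (b i) = 0" if i: "j \<le> i" "i < ?m" and u: "u \<in> S" and fr: "frame j S b" "orthonormal ?m q b"
    and q: "inner_product q"
    for q :: "real ^ 'm \<Rightarrow> _" and u S b i
  proof -
    obtain a where "u = (\<Sum>l<j. a l *\<^sub>R b l)" using fr(1) u by (auto simp: frame_def)
    moreover have lin: "linear (\<lambda>u. q u (b i))" using inner_productD(1)[OF q] by (simp add: bilinear_def)
    moreover have "q (b l) (b i) = 0" if "l < j" for l
      using fr(2) that i by (auto simp: orthonormal_def)
    ultimately show ?thesis by (simp add: linear_sum[OF lin] linear_scale[OF lin])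
  qed
  \<comment> \<open>Row \<open>i\<close> of \<open>A\<close> lists the coordinates of
    \<open>L (e i)\<close> in the basis \<open>e'\<close>; row \<open>l\<close> of \<open>N\<close>
    lists those of the preimage of \<open>e' l\<close> in the basis \<open>e\<close>.\<close>
  define A where "A i l = ?h (L (e i)) (e' l)" for i l
  define N where "N l i = ?g (?I (e' l)) (e i)" for l i
  have A0: "A i l = 0" if "i < j" "j \<le> l" "l < j + k" for i l
    unfolding A_def using that e(3) by (intro orth[OF _ _ _ frameLE e'(1) h]) (auto simp: jk)
  have N0: "N l i = 0" if "l < j" "j \<le> i" "i < j + k" for i l
    unfolding N_def using that e'(3) IL by (intro orth[OF _ _ _ frameE e(1) g]) (auto simp: jk)
  have NA: "(\<Sum>i<?m. N l i * A i l') = (if l = l' then 1 else 0)" if "l < ?m" "l' < ?m" for l l'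
  proof -
    have lin: "linear (\<lambda>u. ?h u (e' l'))" using bh by (simp add: bilinear_def)
    have "(\<Sum>i<?m. N l i * A i l') = ?h (L (\<Sum>i<?m. N l i *\<^sub>R e i)) (e' l')"
      unfolding A_def by (simp add: linear_sum[OF L(1)] linear_scale[OF L(1)] linear_sum[OF lin] linear_scale[OF lin])
    also have "(\<Sum>i<?m. N l i *\<^sub>R e i) = ?I (e' l)"
      unfolding N_def by (rule orthonormal_basis_expand[OF g e(1), symmetric])
    finally show ?thesis using e'(1) that by (simp add: LI orthonormal_def)
  qed
  have detNA: "jdet ?m N * jdet ?m A = 1"
    unfolding jdet_mult using jdet_cong[OF NA] jdet_id by simp
  \<comment> \<open>The upper right block of \<open>N\<close> vanishes, so truncating the sum at
    \<open>j\<close> loses nothing and the upper left blocks are mutually inverse.\<close>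
  have NA1: "(\<Sum>i<j. N l i * A i l') = (if l = l' then 1 else 0)" if "l < j" "l' < j" for l l'
  proof -
    have "(\<Sum>i<j. N l i * A i l') = (\<Sum>i<?m. N l i * A i l')"
      by (rule sum.mono_neutral_left) (use N0 that jk in auto)
    then show ?thesis using NA that jk by simp
  qed
  have detNA1: "jdet j N * jdet j A = 1"
    unfolding jdet_mult using jdet_cong[OF NA1] jdet_id by simp
  let ?N2 = "\<lambda>l i. N (j + l) (j + i)"
  have detN: "jdet ?m N = jdet j N * jdet k ?N2"
    unfolding jk[symmetric] by (rule jdet_block) (rule N0)
  have J1: "jac j ?g ?h L E = \<bar>jdet j A\<bar>"
  proof -
    have "(L \<circ> e) i = (\<Sum>q<j. A i q *\<^sub>R e' q)" if "i < j" for i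
      using orthonormal_expand[OF h LE(1), of e' "L (e i)"] e' e that unfolding LE(2) A_def by simp
    from gramd_expand[OF bh, of j "L \<circ> e" A e', OF this] have "gramd j ?h (L \<circ> e) = (jdet j A)\<^sup>2"
      using orthonormal_gramd[OF e'(2)] by simp
    then show ?thesis
      using jac_frame_inj(1)[OF g h L(1) inj E frameE] orthonormal_gramd[OF e(2)] by simp
  qed
  have Jm: "abs_det ?g ?h L = \<bar>jdet ?m A\<bar>"
  proof -
    have "(L \<circ> e) i = (\<Sum>q<?m. A i q *\<^sub>R e' q)" for i
      using orthonormal_basis_expand[OF h e'(1), of "L (e i)"] unfolding A_def by simp
    from gramd_expand[OF bh, of ?m "L \<circ> e" A e', OF this] have "gramd ?m ?h (L \<circ> e) = (jdet ?m A)\<^sup>2"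
      using orthonormal_gramd[OF e'(1)] by simp
    then show ?thesis
      using jac_frame_inj(1)[OF g h L(1) inj U frameU] orthonormal_gramd[OF e(1)]
        abs_det_eq_jac[OF g h L] by simp
  qed
  \<comment> \<open>The basis dual to \<open>e\<close>: its last \<open>k\<close> members form an
    orthonormal frame of the annihilator of \<open>E\<close>.\<close>
  define \<epsilon> where "\<epsilon> i = Blinfun (?g (e i))" for i
  have \<epsilon>: "blinfun_apply (\<epsilon> i) u = ?g (e i) u" for i u
  proof -
    have "bounded_linear (?g (e i))"
      using bg by (simp add: bilinear_def linear_conv_bounded_linear)
    then show ?thesis by (simp add: \<epsilon>_def bounded_linear_Blinfun_apply)
  qed
  have frame\<epsilon>: "frame k (ann E) (\<lambda>i. \<epsilon> (j + i))"
    unfolding frame_def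
  proof (intro conjI allI impI ballI)
    show "\<epsilon> (j + i) \<in> ann E" if "i < k" for i
      unfolding ann_def using that orth[OF _ _ _ frameE e(1) g, of "j + i"]
      by (auto simp: \<epsilon> inner_productD(2)[OF g, of "e (j + i)"] jk[symmetric])
    fix \<xi> assume \<xi>: "\<xi> \<in> ann E"
    have "\<xi> = (\<Sum>i<k. blinfun_apply \<xi> (e (j + i)) *\<^sub>R \<epsilon> (j + i))"
    proof (rule blinfun_eqI)
      fix u
      have "blinfun_apply \<xi> u = blinfun_apply \<xi> (\<Sum>i<?m. ?g u (e i) *\<^sub>R e i)"
        by (simp flip: orthonormal_basis_expand[OF g e(1)])
      also have "\<dots> = (\<Sum>i<j+k. ?g u (e i) * blinfun_apply \<xi> (e i))"
        by (simp add: blinfun.sum_right blinfun.scaleR_right jk)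
      also have "\<dots> = (\<Sum>i<j. ?g u (e i) * blinfun_apply \<xi> (e i)) +
          (\<Sum>i<k. ?g u (e (j + i)) * blinfun_apply \<xi> (e (j + i)))"
        by (rule sum_lessThan_add)
      also have "(\<Sum>i<j. ?g u (e i) * blinfun_apply \<xi> (e i)) = 0"
        using \<xi> e(3) by (simp add: ann_def)
      finally show "blinfun_apply \<xi> u = blinfun_apply (\<Sum>i<k. blinfun_apply \<xi> (e (j + i)) *\<^sub>R \<epsilon> (j + i)) u"
        by (simp add: blinfun.sum_left blinfun.scaleR_left \<epsilon> inner_productD(2)[OF g, of u] mult.commute)
    qed
    then show "\<exists>a. \<xi> = (\<Sum>i<k. a i *\<^sub>R \<epsilon> (j + i))"
      by (rule exI[of _ "\<lambda>i. blinfun_apply \<xi> (e (j + i))"])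
  qed
  have \<epsilon>e: "blinfun_apply (\<epsilon> i) (e l) = (if i = l then 1 else 0)" if "i < ?m" "l < ?m" for i l
    using e(1) that by (simp add: \<epsilon> orthonormal_def)
  have G\<epsilon>: "gramd k (cometric M x) (\<lambda>i. \<epsilon> (j + i)) = 1"
  proof (rule orthonormal_gramd, unfold orthonormal_def, intro allI impI)
    fix a b assume ab: "a < k" "b < k"
    have "cometric M x (\<epsilon> (j + a)) (\<epsilon> (j + b)) =
        (\<Sum>i<?m. (if j + a = i then 1 else 0) * (if j + b = i then 1 else 0))"
      unfolding cometric_expand[OF g e(1)]
      by (intro sum.cong refl) (use ab jk in \<open>simp add: \<epsilon>e\<close>)
    also have "\<dots> = (\<Sum>i<?m. if i = j + a then (if a = b then 1 else 0) else 0)"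
      by (intro sum.cong) auto
    also have "\<dots> = (if a = b then 1 else 0)" using ab jk by simp
    finally show "cometric M x (\<epsilon> (j + a)) (\<epsilon> (j + b)) = (if a = b then 1 else 0)" .
  qed
  \<comment> \<open>The vanishing block of \<open>N\<close> removes the first \<open>j\<close> terms
    of each cometric value; what is left is the Gram matrix of the columns of
    \<open>?N2\<close>.\<close>
  have H\<epsilon>: "gramd k (cometric M y) (dual_inverse L \<circ> (\<lambda>i. \<epsilon> (j + i))) = (jdet k ?N2)\<^sup>2"
  proof -
    have "cometric M y (dual_inverse L (\<epsilon> (j + a))) (dual_inverse L (\<epsilon> (j + b))) =
        (\<Sum>l<k. N (j + l) (j + a) * N (j + l) (j + b))" if "a < k" "b < k" for a b
    proof -
      have "cometric M y (dual_inverse L (\<epsilon> (j + a))) (dual_inverse L (\<epsilon> (j + b))) =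
          (\<Sum>l<j+k. N l (j + a) * N l (j + b))"
        unfolding cometric_expand[OF h e'(1)] dual_inverse_apply[OF L] \<epsilon> N_def jk
        by (simp add: inner_productD(2)[OF g, of "e (j + a)"] inner_productD(2)[OF g, of "e (j + b)"])
      also have "\<dots> = (\<Sum>l<j. N l (j + a) * N l (j + b)) + (\<Sum>l<k. N (j + l) (j + a) * N (j + l) (j + b))"
        by (rule sum_lessThan_add)
      also have "(\<Sum>l<j. N l (j + a) * N l (j + b)) = 0" using N0 that by simp
      finally show ?thesis by simp
    qed
    then have "gramd k (cometric M y) (dual_inverse L \<circ> (\<lambda>i. \<epsilon> (j + i))) =
        jdet k (\<lambda>a b. \<Sum>l<k. N (j + l) (j + a) * N (j + l) (j + b))"
      unfolding gramd_def comp_def by (intro jdet_cong) simp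
    also have "\<dots> = jdet k (\<lambda>a l. ?N2 l a) * jdet k ?N2" by (rule jdet_mult[symmetric])
    also have "jdet k (\<lambda>a l. ?N2 l a) = jdet k ?N2" by (rule jdet_transpose)
    finally show ?thesis by (simp add: power2_eq_square comp_def)
  qed
  have "jac k (cometric M x) (cometric M y) (dual_inverse L) (ann E) = \<bar>jdet k ?N2\<bar>"
    using jac_frame[OF bilinear_cometric[OF g e(1)] bilinear_cometric[OF h e'(1)]
        linear_dual_inverse[OF L] frame\<epsilon>] G\<epsilon> H\<epsilon> by simp
  \<comment> \<open>Multiplying \<open>det N * det A = 1\<close> by the upper left minor of
    \<open>A\<close> cancels that of \<open>N\<close>.\<close>
  also have "\<bar>jdet k ?N2\<bar> = \<bar>jdet j A\<bar> / \<bar>jdet ?m A\<bar>"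
  proof -
    have "jdet j N * jdet k ?N2 * jdet ?m A = 1" using detNA detN by simp
    then have "jdet j A * (jdet j N * jdet k ?N2 * jdet ?m A) = jdet j A" by simp
    then have "(jdet j N * jdet j A) * jdet k ?N2 * jdet ?m A = jdet j A" by (simp only: mult_ac)
    then have "jdet k ?N2 * jdet ?m A = jdet j A" using detNA1 by simp
    moreover have "jdet ?m A \<noteq> 0" using detNA by auto
    ultimately show ?thesis by (metis abs_divide nonzero_mult_div_cancel_right)
  qed
  finally show ?thesis using J1 Jm by simp
qed


lemma bilinear_axis_expand:
  fixes b :: "real ^ 'm \<Rightarrow> real ^ 'm \<Rightarrow> real"
  assumes b: "bilinear b"
  shows "b u w = (\<Sum>p\<in>UNIV. \<Sum>q\<in>UNIV. u $ p * (w $ q) * b (axis p 1) (axis q 1))"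
proof -
  have "b u w = b (\<Sum>p\<in>UNIV. (u $ p) *\<^sub>R axis p 1) (\<Sum>q\<in>UNIV. (w $ q) *\<^sub>R axis q 1)"
    using basis_expansion[of u] basis_expansion[of w] by (simp add: scalar_mult_eq_scaleR)
  then show ?thesis
    unfolding bilinear_sum[OF b] sum.cartesian_product[symmetric]
    by (simp add: bilinear_lmul[OF b] bilinear_rmul[OF b] mult_ac)
qed

lemma linear_axis_expand:
  fixes L :: "real ^ 'm \<Rightarrow> real ^ 'm"
  assumes L: "linear L"
  shows "L u $ p = (\<Sum>l\<in>UNIV. u $ l * (L (axis l 1) $ p))"
proof -
  have "L u = L (\<Sum>l\<in>UNIV. (u $ l) *\<^sub>R axis l 1)"
    using basis_expansion[of u] by (simp add: scalar_mult_eq_scaleR)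
  then show ?thesis by (simp add: linear_sum[OF L] linear_scale[OF L])
qed

subsection \<open>Orthogonal projections\<close>

lemma orth_decomp:
  fixes E :: "'v::euclidean_space set"
  assumes "subspace E"
  obtains a b where "v = a + b" "a \<in> E" "b \<in> E\<^sup>\<bottom>"
proof -
  have span: "span E = E" using assms by (simp add: span_eq_iff)
  from orthogonal_subspace_decomp_exists[of E v]
  obtain a b where ab: "a \<in> E" "\<And>w. w \<in> E \<Longrightarrow> real_inner_class.orthogonal b w" "v = a + b"
    unfolding span by blast
  have "b \<in> E\<^sup>\<bottom>"
    unfolding orthogonal_comp_def using ab(2) by (simp add: orthogonal_commute)
  from that[OF ab(3,1) this] show ?thesis .
qed

lemma orth_compD: "b \<in> E\<^sup>\<bottom> \<Longrightarrow> a \<in> E \<Longrightarrow> inner a b = 0"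
  by (simp add: orthogonal_comp_def real_inner_class.orthogonal_def)

lemma infdist_orth:
  fixes E :: "'v::euclidean_space set"
  assumes E: "subspace E" and a: "a \<in> E" and b: "b \<in> E\<^sup>\<bottom>"
  shows "infdist (a + b) E = norm b"
proof (rule antisym)
  show "infdist (a + b) E \<le> norm b"
    using infdist_le[OF a, of "a + b"] by (simp add: dist_norm)
  have "norm b \<le> dist (a + b) v" if "v \<in> E" for v
  proof -
    have "inner (a - v) b = 0" by (rule orth_compD[OF b subspace_diff[OF E a that]])
    then have "(norm (a - v + b))\<^sup>2 = (norm (a - v))\<^sup>2 + (norm b)\<^sup>2"
      by (intro norm_add_Pythagorean) (simp add: real_inner_class.orthogonal_def)
    then have "(norm b)\<^sup>2 \<le> (dist (a + b) v)\<^sup>2"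
      by (simp add: dist_norm algebra_simps)
    then show ?thesis by (rule power2_le_imp_le) simp
  qed
  note le = this
  have "E \<noteq> {}" using a by blast
  then show "norm b \<le> infdist (a + b) E"
    unfolding infdist_notempty[OF \<open>E \<noteq> {}\<close>] by (rule cINF_greatest) (rule le)
qed

lemma norm_orth:
  assumes "a \<in> E" "b \<in> E\<^sup>\<bottom>"
  shows "(norm (a + b))\<^sup>2 = (norm a)\<^sup>2 + (norm b)\<^sup>2"
  by (rule norm_add_Pythagorean) (simp add: real_inner_class.orthogonal_def orth_compD[OF assms(2,1)])

text \<open>For a subspace \<open>E\<close> this is the quadratic form of the orthogonal projection onto \<open>E\<close>; polarizing it
  expresses the projection through the distance function of \<open>E\<close>, which generates the topology of
  the Grassmannian.\<close>

definition proj_form :: "'v::real_normed_vector set \<Rightarrow> 'v \<Rightarrow> real" where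
  "proj_form E v = (norm v)\<^sup>2 - (infdist v E)\<^sup>2"

definition proj :: "(real ^ 'm) set \<Rightarrow> real ^ 'm \<Rightarrow> real ^ 'm" where
  "proj E v = (\<chi> l. (proj_form E (v + axis l 1) - proj_form E (v - axis l 1)) / 4)"

text \<open>On \<open>a + b\<close> the form \<open>proj_form E\<close> is the squared norm of
  \<open>a\<close>. Polarising it against \<open>axis l 1\<close> gives the inner product of
  \<open>a\<close> with the component of that axis vector in \<open>E\<close>, which is the
  coordinate \<open>a $ l\<close>.\<close>

lemma proj_orth:
  fixes E :: "(real ^ 'm::finite) set"
  assumes E: "subspace E" and a: "a \<in> E" and b: "b \<in> E\<^sup>\<bottom>"
  shows "proj E (a + b) = a"
proof -
  have form: "proj_form E (a + b) = (norm a)\<^sup>2" if "a \<in> E" "b \<in> E\<^sup>\<bottom>" for a b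
    using infdist_orth[OF E that] norm_orth[OF that] by (simp add: proj_form_def)
  have "(proj E (a + b)) $ l = a $ l" for l
  proof -
    obtain a' b' where l: "axis l 1 = a' + b'" "a' \<in> E" "b' \<in> E\<^sup>\<bottom>"
      using orth_decomp[OF E] by blast
    have "proj_form E (a + b + axis l 1) = (norm (a + a'))\<^sup>2"
      using form[of "a + a'" "b + b'"] l a b E subspace_orthogonal_comp[of E]
      by (simp add: subspace_add algebra_simps)
    moreover have "proj_form E (a + b - axis l 1) = (norm (a - a'))\<^sup>2"
      using form[of "a - a'" "b - b'"] l a b E subspace_orthogonal_comp[of E]
      by (simp add: subspace_diff algebra_simps)
    moreover have "inner a a' = a $ l"
      using orth_compD[OF l(3) a] cart_eq_inner_axis[of a l] by (simp add: l(1) inner_add_right)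
    ultimately show ?thesis
      by (simp add: proj_def power2_norm_eq_inner inner_add_left inner_add_right inner_diff_left
          inner_diff_right inner_commute)
  qed
  then show ?thesis by (simp add: Finite_Cartesian_Product.vec_eq_iff)
qed

lemma proj_in:
  fixes E :: "(real ^ 'm::finite) set"
  assumes E: "subspace E"
  shows "proj E v \<in> E"
proof -
  obtain a b where "v = a + b" "a \<in> E" "b \<in> E\<^sup>\<bottom>" using orth_decomp[OF E] by blast
  then show ?thesis using proj_orth[OF E, of a b] by simp
qed

lemma linear_proj: 
  fixes E :: "(real ^ 'm::finite) set"
  assumes E: "subspace E"
  shows "linear (proj E)"
proof (rule linearI)
  note S = subspace_orthogonal_comp[of E]
  fix u v :: "real ^ 'm" and r :: real
  obtain a b where u: "u = a + b" "a \<in> E" "b \<in> E\<^sup>\<bottom>" using orth_decomp[OF E] by blast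
  obtain c d where v: "v = c + d" "c \<in> E" "d \<in> E\<^sup>\<bottom>" using orth_decomp[OF E] by blast
  have "proj E ((a + c) + (b + d)) = a + c"
    using proj_orth[OF E, of "a + c" "b + d"] u v subspace_add[OF E] subspace_add[OF S] by simp
  then show "proj E (u + v) = proj E u + proj E v"
    using proj_orth[OF E u(2,3)] proj_orth[OF E v(2,3)] u(1) v(1) by (simp add: add_ac)
  have "proj E (r *\<^sub>R a + r *\<^sub>R b) = r *\<^sub>R a"
    using proj_orth[OF E, of "r *\<^sub>R a" "r *\<^sub>R b"] u subspace_scale[OF E] subspace_scale[OF S] by simp
  then show "proj E (r *\<^sub>R u) = r *\<^sub>R proj E u"
    using proj_orth[OF E u(2,3)] u(1) by (simp add: scaleR_add_right)
qed

text \<open>The projections of the coordinate vectors span \<open>E\<close>, so \<open>j\<close> of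
  them form a basis. Index tuples are taken from \<open>\<rightarrow>\<^sub>E\<close> to have a
  finite set over which all minors can be summed.\<close>

lemma proj_frame_exists:
  fixes E :: "(real ^ 'm::finite) set"
  assumes E: "E \<in> grassmannian j"
  obtains I where "I \<in> {..<j} \<rightarrow>\<^sub>E (UNIV :: 'm set)" "frame j E (\<lambda>i. proj E (axis (I i) 1))"
proof -
  have E': "subspace E" "dim E = j" using E by (auto simp: grassmannian_def)
  let ?S = "(\<lambda>i. proj E (axis i 1)) ` (UNIV :: 'm set)"
  have "E \<subseteq> span ?S"
  proof
    fix u assume "u \<in> E"
    then have "u = proj E u"
      using proj_orth[OF E'(1), of u 0] subspace_0[OF subspace_orthogonal_comp[of E]] by simp
    also have "\<dots> = proj E (\<Sum>i\<in>UNIV. (u $ i) *\<^sub>R axis i 1)"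
      using basis_expansion[of u] by (simp add: scalar_mult_eq_scaleR)
    also have "\<dots> = (\<Sum>i\<in>UNIV. (u $ i) *\<^sub>R proj E (axis i 1))"
      by (simp add: linear_sum[OF linear_proj[OF E'(1)]] linear_scale[OF linear_proj[OF E'(1)]])
    also have "\<dots> \<in> span ?S"
      by (intro span_sum span_scale span_base) auto
    finally show "u \<in> span ?S" .
  qed
  moreover have SE: "?S \<subseteq> E" using proj_in[OF E'(1)] by auto
  ultimately have span: "span ?S = E" using span_minimal[OF SE E'(1)] by blast
  obtain B where B: "B \<subseteq> ?S" "independent B" "?S \<subseteq> span B" "card B = dim ?S"
    by (rule basis_exists)
  have cB: "card B = j" using B(4) E'(2) span by (metis dim_span)
  have fB: "finite B" using B(1) by (rule finite_subset) simp
  have EB: "E \<subseteq> span B" using B(3) span by (metis span_minimal subspace_span)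
  obtain b where b: "bij_betw b {..<j} B"
    using ex_bij_betw_nat_finite[OF fB] cB by (auto simp: atLeast0LessThan)
  have "\<forall>i. \<exists>l. i < j \<longrightarrow> b i = proj E (axis l 1)"
    using b B(1) by (auto simp: bij_betw_def)
  then obtain I0 where I0: "\<And>i. i < j \<Longrightarrow> b i = proj E (axis (I0 i) 1)" by metis
  have "frame j E b"
    unfolding frame_def
  proof (intro conjI allI impI ballI)
    show "b i \<in> E" if "i < j" for i using I0[OF that] proj_in[OF E'(1)] by simp
    fix u assume "u \<in> E"
    then have "u \<in> span B" using EB by blast
    then obtain c where "u = (\<Sum>v\<in>B. c v *\<^sub>R v)"
      by (auto simp: span_finite[OF fB])
    also have "\<dots> = (\<Sum>q<j. c (b q) *\<^sub>R b q)"
      by (rule sum.reindex_bij_betw[OF b, symmetric])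
    finally show "\<exists>a. u = (\<Sum>q<j. a q *\<^sub>R b q)"
      by (intro exI[of _ "\<lambda>q. c (b q)"])
  qed
  then have "frame j E (\<lambda>i. proj E (axis (restrict I0 {..<j} i) 1))"
    using I0 by (simp add: frame_def)
  then show ?thesis by (intro that[of "restrict I0 {..<j}"]) auto
qed

text \<open>Expressing the Jacobian through all minors at once, rather than through a choice of basis
  of \<open>E\<close>, makes its measurability in \<open>E\<close> evident.\<close>

lemma jac_sum_minors:
  fixes E :: "(real ^ 'm::finite) set" and L :: "real ^ 'm \<Rightarrow> real ^ 'm"
  assumes g: "inner_product g" and h: "inner_product h" and L: "linear L" "inj L"
    and E: "E \<in> grassmannian j"
  shows "jac j g h L E =
    sqrt (\<Sum>I\<in>{..<j} \<rightarrow>\<^sub>E (UNIV :: 'm set). gramd j h (\<lambda>i. L (proj E (axis (I i) 1)))) /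
    sqrt (\<Sum>I\<in>{..<j} \<rightarrow>\<^sub>E (UNIV :: 'm set). gramd j g (\<lambda>i. proj E (axis (I i) 1)))"
proof -
  have E': "subspace E" "dim E = j" using E by (auto simp: grassmannian_def)
  obtain e where e: "orthonormal j g e" "frame j E e"
    by (rule grassmannian_frame_exists[OF g E])
  let ?F = "{..<j} \<rightarrow>\<^sub>E (UNIV :: 'm set)"
  let ?v = "\<lambda>I i. proj E (axis (I i) 1)"
  have "\<exists>A. \<forall>i<j. ?v I i = (\<Sum>q<j. A i q *\<^sub>R e q)" for I
    by (rule frameD[OF e(2), of "?v I"]) (use proj_in[OF E'(1)] in auto)
  then obtain A where A: "\<And>I i. i < j \<Longrightarrow> ?v I i = (\<Sum>q<j. A I i q *\<^sub>R e q)" by metis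
  \<comment> \<open>For each tuple \<open>I\<close> the Gram determinants before and after
    \<open>L\<close> carry the same factor, so the quotient of the sums is the quotient for the
    single frame \<open>e\<close>.\<close>
  have G: "gramd j g (?v I) = (jdet j (A I))\<^sup>2" for I
    using gramd_expand[OF inner_productD(1)[OF g], of j "?v I" "A I" e, OF A] orthonormal_gramd[OF e(1)]
    by simp
  have H: "gramd j h (\<lambda>i. L (?v I i)) = (jdet j (A I))\<^sup>2 * gramd j h (L \<circ> e)" for I
    by (rule gramd_expand[OF inner_productD(1)[OF h]])
       (simp add: A linear_sum[OF L(1)] linear_scale[OF L(1)])
  obtain I where I: "I \<in> ?F" "frame j E (?v I)" by (rule proj_frame_exists[OF E])
  have "gramd j g (?v I) > 0"
    by (rule gramd_frame_pos[OF g E'(1), of "?v I", unfolded E'(2), OF I(2)])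
  \<comment> \<open>The factors are squares, and the tuple that frames \<open>E\<close> contributes
    a positive one.\<close>
  then have pos: "(\<Sum>I\<in>?F. (jdet j (A I))\<^sup>2) > 0"
    unfolding G using I(1) by (intro sum_pos2[of _ I]) (auto simp: finite_PiE)
  have "jac j g h L E = sqrt (gramd j h (L \<circ> e))"
    using jac_frame_inj(1)[OF g h L E e(2)] orthonormal_gramd[OF e(1)] by simp
  then show ?thesis
    unfolding G H using pos by (simp add: real_sqrt_mult flip: sum_distrib_right)
qed

section \<open>Annihilators as orthogonal complements under the Riesz isomorphism\<close>

lemma norm_blinfun_inner_right: "norm (blinfun_inner_right w) = norm w"
proof (rule antisym)
  show "norm (blinfun_inner_right w) \<le> norm w"
    by (rule norm_blinfun_bound) (simp_all add: blinfun_inner_right.rep_eq Cauchy_Schwarz_ineq2)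
  have "norm w * norm w \<le> norm (blinfun_inner_right w) * norm w"
    using norm_blinfun[of "blinfun_inner_right w" w]
    by (simp add: blinfun_inner_right.rep_eq flip: power2_norm_eq_inner power2_eq_square)
  then show "norm w \<le> norm (blinfun_inner_right w)"
    by (cases "w = 0") auto
qed

lemma linear_blinfun_inner_right: "linear blinfun_inner_right"
  using bounded_linear_blinfun_inner_right by (rule bounded_linear.linear)

lemma bij_blinfun_inner_right:
  "bij (blinfun_inner_right :: 'v::euclidean_space \<Rightarrow> 'v \<Rightarrow>\<^sub>L real)"
proof (rule bijI)
  show "inj (blinfun_inner_right :: 'v \<Rightarrow> 'v \<Rightarrow>\<^sub>L real)"
    unfolding linear_injective_0[OF linear_blinfun_inner_right]
    by (metis norm_blinfun_inner_right norm_eq_zero)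
  show "surj (blinfun_inner_right :: 'v \<Rightarrow> 'v \<Rightarrow>\<^sub>L real)"
  proof (rule surjI)
    fix \<xi> :: "'v \<Rightarrow>\<^sub>L real"
    show "blinfun_inner_right (\<Sum>b\<in>Basis. blinfun_apply \<xi> b *\<^sub>R b) = \<xi>"
    proof (rule blinfun_eqI)
      fix v
      have "blinfun_apply \<xi> v = blinfun_apply \<xi> (\<Sum>b\<in>Basis. (v \<bullet> b) *\<^sub>R b)"
        by (simp add: euclidean_representation)
      then show "blinfun_apply (blinfun_inner_right (\<Sum>b\<in>Basis. blinfun_apply \<xi> b *\<^sub>R b)) v = blinfun_apply \<xi> v"
        by (simp add: blinfun_inner_right.rep_eq inner_sum_left blinfun.sum_right blinfun.scaleR_right
            inner_commute[of v] mult.commute)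
    qed
  qed
qed

lemma ann_eq: "ann E = blinfun_inner_right ` (E\<^sup>\<bottom>)" for E :: "'v::euclidean_space set"
proof -
  have "\<xi> \<in> blinfun_inner_right ` (E\<^sup>\<bottom>)" if "\<xi> \<in> ann E" for \<xi>
  proof -
    obtain w where "\<xi> = blinfun_inner_right w"
      using bij_is_surj[OF bij_blinfun_inner_right] by (metis surjD)
    with that show ?thesis
      by (auto simp: ann_def orthogonal_comp_def real_inner_class.orthogonal_def blinfun_inner_right.rep_eq inner_commute)
  qed
  then show ?thesis
    by (auto simp: ann_def orthogonal_comp_def real_inner_class.orthogonal_def blinfun_inner_right.rep_eq inner_commute)
qed

text \<open>The Riesz map is an isometry carrying the orthogonal complement onto
  \<open>ann E\<close>, and the distance to that complement is the length of the component in
  \<open>E\<close>. Thus the squared distances to \<open>E\<close> and to \<open>ann E\<close> add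
  up to the squared norm, and either distance function determines the other.\<close>

lemma infdist_ann:
  fixes E :: "'v::euclidean_space set"
  assumes E: "subspace E"
  shows "infdist (blinfun_inner_right w) (ann E) = sqrt (proj_form E w)"
proof -
  obtain a b where w: "w = a + b" "a \<in> E" "b \<in> E\<^sup>\<bottom>" using orth_decomp[OF E] by blast
  have "dist (blinfun_inner_right u) (blinfun_inner_right v) = dist u v" for u v :: 'v
    by (simp add: dist_norm norm_blinfun_inner_right flip: linear_diff[OF linear_blinfun_inner_right])
  then have "infdist (blinfun_inner_right w) (ann E) = infdist w (E\<^sup>\<bottom>)"
    by (simp add: infdist_def ann_eq image_image)
  also have "\<dots> = norm a"
    using infdist_orth[OF subspace_orthogonal_comp w(3), of a] w by (simp add: orthogonal_comp_self[OF E] add.commute)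
  also have "\<dots> = sqrt (proj_form E w)"
    using infdist_orth[OF E w(2,3)] norm_orth[OF w(2,3)] w(1) by (simp add: proj_form_def)
  finally show ?thesis .
qed

text \<open>Up to the Riesz map, \<open>ann\<close> is the orthogonal complement, an involution on
  subspaces that exchanges complementary dimensions.\<close>

lemma bij_betw_ann:
  assumes jk: "j + k = DIM('v::euclidean_space)"
  shows "bij_betw ann (grassmannian j :: 'v set set) (grassmannian k)"
proof (rule bij_betwI')
  note inj = bij_is_inj[OF bij_blinfun_inner_right]
  fix E E' :: "'v set" assume E: "E \<in> grassmannian j" "E' \<in> grassmannian j"
  show "ann E = ann E' \<longleftrightarrow> E = E'"
  proof
    assume "ann E = ann E'"
    then have "E\<^sup>\<bottom> = E'\<^sup>\<bottom>" by (simp only: ann_eq inj_image_eq_iff[OF inj])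
    then have "E\<^sup>\<bottom>\<^sup>\<bottom> = E'\<^sup>\<bottom>\<^sup>\<bottom>" by (rule arg_cong)
    moreover have "subspace E" "subspace E'" using E by (simp_all add: grassmannian_def)
    ultimately show "E = E'" by (simp only: orthogonal_comp_self)
  qed simp
next
  note inj = bij_is_inj[OF bij_blinfun_inner_right] and lin = linear_blinfun_inner_right
  have comp: "E\<^sup>\<bottom> \<in> grassmannian (DIM('v) - l)" if "E \<in> grassmannian l" for E :: "'v set" and l
  proof -
    have "E\<^sup>\<bottom> = {y \<in> UNIV. \<forall>x\<in>E. real_inner_class.orthogonal x y}" by (auto simp: orthogonal_comp_def)
    then show ?thesis
      using dim_subspace_orthogonal_to_vectors[of E UNIV] that subspace_orthogonal_comp[of E]
      by (simp add: grassmannian_def)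
  qed
  have im: "blinfun_inner_right ` E \<in> grassmannian l \<longleftrightarrow> E \<in> grassmannian l" if "subspace E"
    for E :: "'v set" and l
    using dim_image_eq[OF lin inj_on_subset[OF inj subset_UNIV], of E] linear_subspace_image[OF lin that] that
    by (simp add: grassmannian_def)
  show "ann E \<in> grassmannian k" if "E \<in> grassmannian j" for E :: "'v set"
    unfolding ann_eq im[OF subspace_orthogonal_comp] using comp[OF that] jk[symmetric] by simp
  fix F :: "('v \<Rightarrow>\<^sub>L real) set" assume F: "F \<in> grassmannian k"
  let ?S = "blinfun_inner_right -` F"
  have S: "subspace ?S" using linear_subspace_vimage[OF lin, of F] F by (simp add: grassmannian_def)
  have FS: "F = blinfun_inner_right ` ?S"
    by (rule surj_image_vimage_eq[OF bij_is_surj[OF bij_blinfun_inner_right], symmetric])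
  then have "?S \<in> grassmannian k" using im[OF S] F by simp
  from comp[OF this] have "?S\<^sup>\<bottom> \<in> grassmannian j" using jk[symmetric] by simp
  moreover have "F = ann (?S\<^sup>\<bottom>)" using FS by (simp add: ann_eq orthogonal_comp_self[OF S])
  ultimately show "\<exists>E\<in>grassmannian j. F = ann E" by blast
qed

subsection \<open>Charts\<close>

definition chart_rep ::
  "('a, 'm::finite) chart \<Rightarrow> ('a, 'm) chart \<Rightarrow> ('a \<Rightarrow> 'a) \<Rightarrow> real ^ 'm \<Rightarrow> real ^ 'm" where
  "chart_rep c c' h = snd c' \<circ> h \<circ> chart_inv c"

definition chart_deriv ::
  "('a, 'm::finite) chart \<Rightarrow> ('a, 'm) chart \<Rightarrow> ('a \<Rightarrow> 'a) \<Rightarrow> 'a \<Rightarrow> real ^ 'm \<Rightarrow> real ^ 'm" where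
  "chart_deriv c c' h x = frechet_derivative (chart_rep c c' h) (at (snd c x))"

text \<open>The metric in the coordinates of \<open>c\<close>, written exactly as the expression
  whose smoothness is part of \<open>riemannian_manifold\<close>.\<close>

definition chart_metric ::
  "('a, 'm::finite) riemannian \<Rightarrow> ('a, 'm) chart \<Rightarrow> real ^ 'm \<Rightarrow> real ^ 'm \<Rightarrow> real ^ 'm \<Rightarrow> real" where
  "chart_metric M c y u v = (let x = chart_inv c y; K = coord_change c (chart_at M x) x
    in riemannian.metric M x (K u) (K v))"

lemma mderiv_eq_chart_deriv: "mderiv M h x = chart_deriv (chart_at M x) (chart_at M (h x)) h x"
  by (simp add: mderiv_def chart_deriv_def chart_rep_def)

text \<open>Coordinate changes are derivatives of chart representatives of \<open>id\<close>, so a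
  single chain rule also yields their cocycle identity.\<close>

lemma coord_change_eq_chart_deriv: "coord_change c c' x = chart_deriv c c' id x"
  by (simp add: coord_change_def transition_def chart_deriv_def chart_rep_def)

section \<open>Chain rule, coordinate changes and the metric in charts\<close>

locale riemannian_mfd =
  fixes M :: "('a::{second_countable_topology,t2_space}, 'm::finite) riemannian"
  assumes M: "riemannian_manifold M"
begin

lemma chart_at: "chart_at M x \<in> atlas M" "x \<in> fst (chart_at M x)"
  using M by (auto simp: riemannian_manifold_def smooth_manifold_def)

lemma chart:
  assumes "c \<in> atlas M"
  shows "open (fst c)" "open (snd c ` fst c)"
    "continuous_on (fst c) (snd c)" "continuous_on (snd c ` fst c) (chart_inv c)"
    "x \<in> fst c \<Longrightarrow> chart_inv c (snd c x) = x"
    "y \<in> snd c ` fst c \<Longrightarrow> snd c (chart_inv c y) = y"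
    "y \<in> snd c ` fst c \<Longrightarrow> chart_inv c y \<in> fst c"
proof -
  have 1: "open (fst c) \<and> open (snd c ` fst c) \<and>
      homeomorphism (fst c) (snd c ` fst c) (snd c) (chart_inv c)"
    using M assms by (auto simp: riemannian_manifold_def smooth_manifold_def)
  then show "open (fst c)" "open (snd c ` fst c)"
    "continuous_on (fst c) (snd c)" "continuous_on (snd c ` fst c) (chart_inv c)"
    "x \<in> fst c \<Longrightarrow> chart_inv c (snd c x) = x"
    "y \<in> snd c ` fst c \<Longrightarrow> snd c (chart_inv c y) = y"
    "y \<in> snd c ` fst c \<Longrightarrow> chart_inv c y \<in> fst c"
    by (auto simp: homeomorphism_def)
qed

lemma open_chart_image:
  assumes c: "c \<in> atlas M" and V: "open V" "V \<subseteq> fst c"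
  shows "open (snd c ` V)"
proof -
  have "snd c ` V = snd c ` fst c \<inter> chart_inv c -` V"
    using chart(5,6)[OF c] V(2) by (force simp: image_iff)
  then show ?thesis
    using continuous_open_preimage[OF chart(4)[OF c] chart(2)[OF c] V(1)] by simp
qed

lemma open_preimage_chart:
  assumes "c \<in> atlas M" "open V" "open U" "continuous_on U h"
  shows "open (fst c \<inter> (U \<inter> h -` V))"
  using assms chart(1) continuous_open_preimage by blast

lemma chart_rep_eq_near:
  assumes c: "c \<in> atlas M" "c' \<in> atlas M" and y: "y \<in> snd c ` (fst c \<inter> (U \<inter> h1 -` fst c'))"
  shows "chart_rep c c'' (h2 \<circ> h1) y = (chart_rep c' c'' h2 \<circ> chart_rep c c' h1) y"
  using y chart(5)[OF c(1)] chart(5)[OF c(2)] by (auto simp: chart_rep_def)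

text \<open>The representative of a composition factors only where the first map lands in the middle
  chart. Continuity on \<open>U\<close> makes this a neighbourhood, which is enough for
  derivatives.\<close>

lemma chart_rep_compose:
  assumes c: "c \<in> atlas M" "c' \<in> atlas M" and x: "x \<in> fst c" "x \<in> U" "h1 x \<in> fst c'"
    and U: "open U" "continuous_on U h1"
    and A: "(chart_rep c c' h1 has_derivative A) (at (snd c x))"
    and B: "(chart_rep c' c'' h2 has_derivative B) (at (snd c' (h1 x)))"
  shows "(chart_rep c c'' (h2 \<circ> h1) has_derivative (B \<circ> A)) (at (snd c x))"
proof (rule has_derivative_transform_within_open)
  have "chart_rep c c' h1 (snd c x) = snd c' (h1 x)"
    using chart(5)[OF c(1) x(1)] by (simp add: chart_rep_def)
  then show "(chart_rep c' c'' h2 \<circ> chart_rep c c' h1 has_derivative (B \<circ> A)) (at (snd c x))"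
    using diff_chain_at[OF A] B by simp
  show "open (snd c ` (fst c \<inter> (U \<inter> h1 -` fst c')))"
    by (rule open_chart_image[OF c(1)])
       (use open_preimage_chart[OF c(1) chart(1)[OF c(2)] U] in auto)
  show "snd c x \<in> snd c ` (fst c \<inter> (U \<inter> h1 -` fst c'))" using x by auto
qed (rule chart_rep_eq_near[OF c, symmetric])

lemma coord_change_deriv:
  assumes c: "c \<in> atlas M" "c' \<in> atlas M" and x: "x \<in> fst c" "x \<in> fst c'"
  shows "(chart_rep c c' id has_derivative coord_change c c' x) (at (snd c x))"
proof -
  have "smooth_on (snd c ` (fst c \<inter> fst c')) (transition c c')"
    using M c by (auto simp: riemannian_manifold_def smooth_manifold_def)
  then have "Ck_on (Suc 0) (snd c ` (fst c \<inter> fst c')) (transition c c')"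
    unfolding smooth_on_def by blast
  then have "transition c c' differentiable (at (snd c x))" using x by simp
  then show ?thesis
    unfolding coord_change_eq_chart_deriv chart_deriv_def
    by (simp add: chart_rep_def transition_def frechet_derivative_works)
qed

lemma coord_change_comp:
  assumes c: "c \<in> atlas M" "c' \<in> atlas M" "c'' \<in> atlas M" and x: "x \<in> fst c" "x \<in> fst c'" "x \<in> fst c''"
  shows "coord_change c' c'' x (coord_change c c' x u) = coord_change c c'' x u"
proof -
  have "(chart_rep c c'' (id \<circ> id) has_derivative (coord_change c' c'' x \<circ> coord_change c c' x)) (at (snd c x))"
    by (rule chart_rep_compose[where U = UNIV, OF c(1,2)])
       (use x coord_change_deriv c in \<open>auto simp: continuous_on_id[unfolded id_def[symmetric]]\<close>)
  then have "coord_change c' c'' x \<circ> coord_change c c' x = coord_change c c'' x"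
    using coord_change_deriv[OF c(1,3) x(1,3)] by (simp add: has_derivative_unique)
  then show ?thesis by (metis comp_apply)
qed

lemma coord_change_self:
  assumes c: "c \<in> atlas M" and x: "x \<in> fst c"
  shows "coord_change c c x u = u"
proof -
  have "((\<lambda>y. y) has_derivative (\<lambda>u. u)) (at (snd c x))" by simp
  then have "(chart_rep c c id has_derivative (\<lambda>u. u)) (at (snd c x))"
    by (rule has_derivative_transform_within_open[OF _ chart(2)[OF c]])
       (use chart[OF c] x in \<open>auto simp: chart_rep_def\<close>)
  then have "(\<lambda>u. u) = coord_change c c x"
    by (rule has_derivative_unique[OF _ coord_change_deriv[OF c c x x]])
  then show ?thesis by metis
qed

lemma coord_change_bij:
  assumes c: "c \<in> atlas M" "c' \<in> atlas M" and x: "x \<in> fst c" "x \<in> fst c'"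
  shows "linear (coord_change c c' x)" "bij (coord_change c c' x)"
proof -
  show "linear (coord_change c c' x)"
    using coord_change_deriv[OF c x] by (rule has_derivative_linear)
  show "bij (coord_change c c' x)"
    by (rule o_bij[of "coord_change c' c x"])
       (simp_all add: fun_eq_iff coord_change_comp[OF c(1) c(2) c(1) x(1) x(2) x(1)]
         coord_change_comp[OF c(2) c(1) c(2) x(2) x(1) x(2)] coord_change_self[OF c(1) x(1)]
         coord_change_self[OF c(2) x(2)])
qed

lemma tangent_coords_bij:
  assumes "c \<in> atlas M" "x \<in> fst c"
  shows "linear (tangent_coords M c x)" "bij (tangent_coords M c x)"
  unfolding tangent_coords_def
  using coord_change_bij[OF chart_at(1) assms(1) chart_at(2) assms(2)] by auto

lemma inner_product_metric: "inner_product (riemannian.metric M x)"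
  using M by (auto simp: riemannian_manifold_def inner_product_def)

lemma metric_eq_chart_metric:
  assumes c: "c \<in> atlas M" "x \<in> fst c"
  shows "riemannian.metric M x u v =
    chart_metric M c (snd c x) (tangent_coords M c x u) (tangent_coords M c x v)"
  using coord_change_comp[OF chart_at(1) c(1) chart_at(1) chart_at(2) c(2) chart_at(2)]
    coord_change_self[OF chart_at]
  by (simp add: chart_metric_def chart(5)[OF c] tangent_coords_def)

lemma inner_product_chart_metric:
  assumes c: "c \<in> atlas M" "x \<in> fst c"
  shows "inner_product (chart_metric M c (snd c x))"
  using inner_product_pullback[OF inner_product_metric
      coord_change_bij(1)[OF c(1) chart_at(1) c(2) chart_at(2)]
      bij_is_inj[OF coord_change_bij(2)[OF c(1) chart_at(1) c(2) chart_at(2)]]]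
  by (simp add: chart_metric_def[abs_def] chart(5)[OF c] Let_def)

lemma continuous_on_chart_metric:
  assumes c: "c \<in> atlas M"
  shows "continuous_on (snd c ` fst c) (\<lambda>y. chart_metric M c y u v)"
proof -
  have "smooth_on (snd c ` fst c) (\<lambda>y. chart_metric M c y u v)"
    using M c unfolding riemannian_manifold_def chart_metric_def by blast
  then have "Ck_on 0 (snd c ` fst c) (\<lambda>y. chart_metric M c y u v)"
    unfolding smooth_on_def by blast
  then show ?thesis by simp
qed

section \<open>A local diffeomorphism and its derivative in charts\<close>

context
  fixes h :: "'a \<Rightarrow> 'a"
  assumes h: "C1_local_diffeo M h"
begin

lemma local_diffeoE:
  obtains U where "open U" "x \<in> U" "open (h ` U)" "inj_on h U" "continuous_on U h"
    "\<And>c c'. c \<in> atlas M \<Longrightarrow> c' \<in> atlas M \<Longrightarrow>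
      Ck_on 1 (snd c ` (U \<inter> fst c \<inter> h -` fst c')) (chart_rep c c' h)"
    "\<And>c c'. c \<in> atlas M \<Longrightarrow> c' \<in> atlas M \<Longrightarrow>
      Ck_on 1 (snd c ` (h ` U \<inter> fst c \<inter> the_inv_into U h -` fst c')) (chart_rep c c' (the_inv_into U h))"
proof -
  obtain U where "open U" "x \<in> U" "open (h ` U)" "inj_on h U" "C1_map_on M U h"
    "C1_map_on M (h ` U) (the_inv_into U h)"
    using h unfolding C1_local_diffeo_def by blast
  then show ?thesis
    using that[of U] unfolding C1_map_on_def chart_rep_def by blast
qed

lemma continuous_local_diffeo: "continuous_on S h"
proof (rule continuous_at_imp_continuous_on, rule ballI)
  fix x
  obtain U where "open U" "x \<in> U" "continuous_on U h" by (rule local_diffeoE)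
  then show "isCont h x" by (simp add: continuous_on_eq_continuous_at)
qed

lemma open_chart_domain:
  assumes "c \<in> atlas M" "c' \<in> atlas M"
  shows "open (fst c \<inter> h -` fst c')" "open (snd c ` (fst c \<inter> h -` fst c'))"
proof -
  show 1: "open (fst c \<inter> h -` fst c')"
    using open_preimage_chart[OF assms(1) chart(1)[OF assms(2)] open_UNIV continuous_local_diffeo] by simp
  show "open (snd c ` (fst c \<inter> h -` fst c'))"
    by (rule open_chart_image[OF assms(1) 1]) simp
qed

lemma chart_deriv:
  assumes c: "c \<in> atlas M" "c' \<in> atlas M" and x: "x \<in> fst c" "h x \<in> fst c'"
  shows "(chart_rep c c' h has_derivative chart_deriv c c' h x) (at (snd c x))"
proof -
  obtain U where U: "x \<in> U" "Ck_on 1 (snd c ` (U \<inter> fst c \<inter> h -` fst c')) (chart_rep c c' h)"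
    using local_diffeoE[of x] c by metis
  then have "chart_rep c c' h differentiable (at (snd c x))" using x by simp
  then show ?thesis by (simp add: chart_deriv_def frechet_derivative_works)
qed

text \<open>The class \<open>C\<^sup>1\<close> is available only on neighbourhoods that vary with
  the point; continuity is local, so it extends to the full chart overlap.\<close>

lemma continuous_on_chart_deriv:
  assumes c: "c \<in> atlas M" "c' \<in> atlas M"
  shows "continuous_on (snd c ` (fst c \<inter> h -` fst c')) (\<lambda>y. chart_deriv c c' h (chart_inv c y) v)"
proof -
  have "isCont (\<lambda>y. chart_deriv c c' h (chart_inv c y) v) (snd c x)"
    if x: "x \<in> fst c" "h x \<in> fst c'" for x
  proof -
    obtain U where U: "open U" "x \<in> U"
      "Ck_on 1 (snd c ` (U \<inter> fst c \<inter> h -` fst c')) (chart_rep c c' h)"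
      using local_diffeoE[of x] c by metis
    let ?W = "snd c ` (U \<inter> fst c \<inter> h -` fst c')"
    have "continuous_on ?W (\<lambda>y. frechet_derivative (chart_rep c c' h) (at y) v)"
      using U(3) by simp
    then have "continuous_on ?W (\<lambda>y. chart_deriv c c' h (chart_inv c y) v)"
      by (rule continuous_on_eq) (auto simp: chart_deriv_def chart(5)[OF c(1)])
    moreover have "open ?W"
      using open_chart_image[OF c(1), of "U \<inter> (fst c \<inter> h -` fst c')"] U(1) open_chart_domain(1)[OF c]
      by (simp add: Int_assoc le_infI2 open_Int)
    moreover have "snd c x \<in> ?W" using x U(2) by blast
    ultimately show ?thesis using continuous_on_eq_continuous_at by blast
  qed
  then show ?thesis by (intro continuous_at_imp_continuous_on) auto
qed

text \<open>Differentiating the local inverse after \<open>h\<close> gives a left inverse of the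
  derivative; equality of dimensions turns injectivity into bijectivity.\<close>

lemma chart_deriv_bij:
  assumes c: "c \<in> atlas M" "c' \<in> atlas M" and x: "x \<in> fst c" "h x \<in> fst c'"
  shows "linear (chart_deriv c c' h x)" "bij (chart_deriv c c' h x)"
proof -
  show lin: "linear (chart_deriv c c' h x)"
    using chart_deriv[OF c x] by (rule has_derivative_linear)
  obtain U where U: "open U" "x \<in> U" "inj_on h U" "continuous_on U h"
    and inv: "Ck_on 1 (snd c' ` (h ` U \<inter> fst c' \<inter> the_inv_into U h -` fst c)) (chart_rep c' c (the_inv_into U h))"
    using local_diffeoE[of x] c by metis
  let ?k = "the_inv_into U h"
  have kx: "?k (h x) = x" by (rule the_inv_into_f_f[OF U(3,2)])
  then have "snd c' (h x) \<in> snd c' ` (h ` U \<inter> fst c' \<inter> ?k -` fst c)" using x U(2) by auto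
  then have "chart_rep c' c ?k differentiable (at (snd c' (h x)))"
    using inv unfolding One_nat_def Ck_on.simps by blast
  then obtain B where B: "(chart_rep c' c ?k has_derivative B) (at (snd c' (h x)))"
    by (auto simp: differentiable_def)
  have "(chart_rep c c (?k \<circ> h) has_derivative (B \<circ> chart_deriv c c' h x)) (at (snd c x))"
    by (rule chart_rep_compose[OF c x(1) U(2) x(2) U(1,4) chart_deriv[OF c x] B])
  moreover have "open (snd c ` (fst c \<inter> U))"
    by (rule open_chart_image[OF c(1)]) (use chart(1)[OF c(1)] U(1) in auto)
  ultimately have "((\<lambda>y. y) has_derivative (B \<circ> chart_deriv c c' h x)) (at (snd c x))"
    by (rule has_derivative_transform_within_open)
       (use x U the_inv_into_f_f[OF U(3)] in \<open>auto simp: chart_rep_def chart(5)[OF c(1)]\<close>)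
  then have "B \<circ> chart_deriv c c' h x = (\<lambda>u. u)"
    by (rule has_derivative_unique) simp
  then have inj: "inj (chart_deriv c c' h x)"
    by (metis inj_on_imageI2 inj_on_id2)
  then show "bij (chart_deriv c c' h x)"
    using linear_injective_imp_surjective[OF lin] by (simp add: bij_def)
qed

lemma mderiv_bij: "linear (mderiv M h x)" "bij (mderiv M h x)"
  unfolding mderiv_eq_chart_deriv by (rule chart_deriv_bij; rule chart_at)+

text \<open>Both sides come from the derivative of one representative of \<open>h\<close>, from
  \<open>chart_at M x\<close> to \<open>c'\<close>, factored once as \<open>id \<circ> h\<close> and
  once as \<open>h \<circ> id\<close>.\<close>

lemma tangent_coords_mderiv:
  assumes c: "c \<in> atlas M" "c' \<in> atlas M" and x: "x \<in> fst c" "h x \<in> fst c'"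
  shows "tangent_coords M c' (h x) (mderiv M h x u) = chart_deriv c c' h x (tangent_coords M c x u)"
proof -
  let ?d = "chart_at M x" and ?d' = "chart_at M (h x)"
  have 1: "(chart_rep ?d c' (id \<circ> h) has_derivative (coord_change ?d' c' (h x) \<circ> mderiv M h x)) (at (snd ?d x))"
    unfolding mderiv_eq_chart_deriv
    by (rule chart_rep_compose[where U = UNIV and c' = ?d'])
       (use x c chart_at chart_deriv coord_change_deriv continuous_local_diffeo in auto)
  have 2: "(chart_rep ?d c' (h \<circ> id) has_derivative (chart_deriv c c' h x \<circ> coord_change ?d c x)) (at (snd ?d x))"
    by (rule chart_rep_compose[where U = UNIV and c' = c])
       (use x c chart_at chart_deriv coord_change_deriv in \<open>auto simp: continuous_on_id[unfolded id_def[symmetric]]\<close>)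
  have "coord_change ?d' c' (h x) \<circ> mderiv M h x = chart_deriv c c' h x \<circ> coord_change ?d c x"
    using has_derivative_unique[OF 1] 2 by simp
  then show ?thesis unfolding tangent_coords_def by (metis comp_apply)
qed

text \<open>Taking coordinates preserves the Gram determinants of a frame. The right-hand side
  depends on the distinguished charts only through the plane in coordinates, which the bundle
  topology controls.\<close>

lemma jac_eq_chart:
  assumes c: "c \<in> atlas M" "c' \<in> atlas M" and x: "x \<in> fst c" "h x \<in> fst c'" and E: "E \<in> grassmannian j"
  shows "jac j (riemannian.metric M x) (riemannian.metric M (h x)) (mderiv M h x) E =
    jac j (chart_metric M c (snd c x)) (chart_metric M c' (snd c' (h x))) (chart_deriv c c' h x)
      (tangent_coords M c x ` E)"
proof -
  note T = tangent_coords_bij[OF c(1) x(1)]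
  note T' = bij_is_inj[OF T(2)]
  obtain e where e: "frame j E e"
    by (rule grassmannian_frame_exists[OF inner_product_metric[of x] E])
  note 1 = jac_frame_inj(1)[OF inner_product_metric[of x] inner_product_metric[of "h x"] mderiv_bij(1)
      bij_is_inj[OF mderiv_bij(2)] E e]
  note 2 = jac_frame_inj(1)[OF inner_product_chart_metric[OF c(1) x(1)] inner_product_chart_metric[OF c(2) x(2)]
      chart_deriv_bij(1)[OF c x] bij_is_inj[OF chart_deriv_bij(2)[OF c x]]
      grassmannian_image[OF T(1) T' E] frame_image[OF T(1) e]]
  show ?thesis
    unfolding 1 2 gramd_def comp_def metric_eq_chart_metric[OF c(1) x(1)] metric_eq_chart_metric[OF c(2) x(2)]
      tangent_coords_mderiv[OF c x] ..
qed


text \<open>Near \<open>x\<close> the metric and its pullback under \<open>h\<close> are continuous,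
  positive forms on unit vectors. On a closed coordinate ball times the unit sphere, which is
  compact, both quotients are bounded, and homogeneity of degree two passes from unit vectors to all
  vectors.\<close>

lemma deriv_bounds_near:
  "\<exists>V C. open V \<and> x \<in> V \<and> C \<ge> 0 \<and> (\<forall>z\<in>V. \<forall>u.
     riemannian.metric M (h z) (mderiv M h z u) (mderiv M h z u) \<le> C * riemannian.metric M z u u \<and>
     riemannian.metric M z u u \<le> C * riemannian.metric M (h z) (mderiv M h z u) (mderiv M h z u))"
proof -
  define c where "c = chart_at M x"
  define c' where "c' = chart_at M (h x)"
  have c: "c \<in> atlas M" "c' \<in> atlas M" and x: "x \<in> fst c" "h x \<in> fst c'"
    unfolding c_def c'_def using chart_at by auto
  let ?W = "snd c ` (fst c \<inter> h -` fst c')"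
  note W = open_chart_domain(2)[OF c]
  define F where "F y v = chart_metric M c' (snd c' (h (chart_inv c y)))
    (chart_deriv c c' h (chart_inv c y) v) (chart_deriv c c' h (chart_inv c y) v)" for y v
  define G where "G y v = chart_metric M c y v v" for y v
  have FG_pos: "F y v > 0" "G y v > 0" if y: "y \<in> ?W" and v: "v \<noteq> 0" for y v
  proof -
    obtain z where z: "y = snd c z" "z \<in> fst c" "h z \<in> fst c'" using y by auto
    have "chart_deriv c c' h z v \<noteq> 0"
      using chart_deriv_bij[OF c z(2,3)] v linear_injective_0 by (metis bij_is_inj)
    then show "F y v > 0" "G y v > 0"
      unfolding F_def G_def z(1) chart(5)[OF c(1) z(2)]
      using inner_productD(3)[OF inner_product_chart_metric] c z v by blast+
  qed
  have bil: "chart_metric M d (snd d z) u w = (\<Sum>a\<in>UNIV. \<Sum>b\<in>UNIV. u $ a * (w $ b) *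
      chart_metric M d (snd d z) (axis a 1) (axis b 1))"
    if "d \<in> atlas M" "z \<in> fst d" for d z u w
    by (rule bilinear_axis_expand[OF inner_productD(1)[OF inner_product_chart_metric[OF that]]])
  have contG: "continuous_on (?W \<times> UNIV) (\<lambda>(y, v). G y v)"
  proof -
    have "continuous_on (?W \<times> UNIV) (\<lambda>p. \<Sum>a\<in>UNIV. \<Sum>b\<in>UNIV. snd p $ a * (snd p $ b) *
      chart_metric M c (fst p) (axis a 1) (axis b 1))"
      by (intro continuous_intros continuous_on_compose2[OF continuous_on_chart_metric[OF c(1)]]) auto
    then show ?thesis
      by (rule continuous_on_eq) (auto simp: G_def bil[OF c(1), symmetric])
  qed
  have contD: "continuous_on (?W \<times> UNIV) (\<lambda>p. chart_deriv c c' h (chart_inv c (fst p)) (snd p) $ a)" for a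
  proof -
    have "continuous_on (?W \<times> UNIV) (\<lambda>p. \<Sum>b\<in>UNIV. snd p $ b * (chart_deriv c c' h (chart_inv c (fst p)) (axis b 1) $ a))"
      by (intro continuous_intros continuous_on_compose2[OF continuous_on_chart_deriv[OF c]]) auto
    then show ?thesis
    proof (rule continuous_on_eq)
      fix p assume "p \<in> ?W \<times> (UNIV :: (real ^ 'm) set)"
      then obtain z where z: "fst p = snd c z" "z \<in> fst c" "h z \<in> fst c'" by auto
      show "(\<Sum>b\<in>UNIV. snd p $ b * (chart_deriv c c' h (chart_inv c (fst p)) (axis b 1) $ a)) =
          chart_deriv c c' h (chart_inv c (fst p)) (snd p) $ a"
        unfolding z(1) chart(5)[OF c(1) z(2)]
        by (rule linear_axis_expand[OF chart_deriv_bij(1)[OF c z(2,3)], symmetric])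
    qed
  qed
  have conth: "continuous_on (?W \<times> UNIV) (\<lambda>p. snd c' (h (chart_inv c (fst p))))"
    by (intro continuous_on_compose2[OF chart(3)[OF c(2)]] continuous_on_compose2[OF continuous_local_diffeo[of UNIV]]
        continuous_on_compose2[OF chart(4)[OF c(1)]] continuous_intros)
       (auto simp: chart(5)[OF c(1)])
  have contF: "continuous_on (?W \<times> UNIV) (\<lambda>(y, v). F y v)"
  proof -
    have "continuous_on (?W \<times> UNIV) (\<lambda>p. \<Sum>a\<in>UNIV. \<Sum>b\<in>UNIV.
      chart_deriv c c' h (chart_inv c (fst p)) (snd p) $ a *
      (chart_deriv c c' h (chart_inv c (fst p)) (snd p) $ b) *
      chart_metric M c' (snd c' (h (chart_inv c (fst p)))) (axis a 1) (axis b 1))"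
      by (intro continuous_on_sum continuous_on_mult contD continuous_on_compose2[OF continuous_on_chart_metric[OF c(2)] conth])
         (auto simp: chart(5)[OF c(1)])
    then show ?thesis
      by (rule continuous_on_eq) (auto simp: F_def chart(5)[OF c(1)] bil[OF c(2), symmetric])
  qed
  obtain r where r: "r > 0" "cball (snd c x) r \<subseteq> ?W"
    using W x open_contains_cball[of ?W] by blast
  let ?K = "cball (snd c x) r \<times> sphere (0 :: real ^ 'm) 1"
  have K: "compact ?K" by (intro compact_Times) auto
  have pos: "F y v > 0" "G y v > 0" if "(y, v) \<in> ?K" for y v
  proof -
    have "y \<in> ?W" "v \<noteq> 0" using that r(2) by (blast, auto)
    then show "F y v > 0" "G y v > 0" by (rule FG_pos)+
  qed
  have KW: "?K \<subseteq> ?W \<times> UNIV" using r(2) by auto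
  have "continuous_on ?K (\<lambda>p. (case p of (y, v) \<Rightarrow> F y v) / (case p of (y, v) \<Rightarrow> G y v))"
    "continuous_on ?K (\<lambda>p. (case p of (y, v) \<Rightarrow> G y v) / (case p of (y, v) \<Rightarrow> F y v))"
    using pos by (intro continuous_on_divide continuous_on_subset[OF contF KW] continuous_on_subset[OF contG KW]; force)+
  from this[THEN compact_continuous_image, OF K, THEN compact_imp_bounded]
  obtain C1 C2 where C: "\<And>y v. (y, v) \<in> ?K \<Longrightarrow> norm (F y v / G y v) \<le> C1"
    "\<And>y v. (y, v) \<in> ?K \<Longrightarrow> norm (G y v / F y v) \<le> C2"
    unfolding bounded_iff by fastforce
  define C where "C = max 0 (max C1 C2)"
  have FG: "F y v \<le> C * G y v \<and> G y v \<le> C * F y v" if "y \<in> cball (snd c x) r" "norm v = 1" for y v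
  proof -
    have K: "(y, v) \<in> ?K" using that by auto
    have "F y v / G y v \<le> C" "G y v / F y v \<le> C"
      using C(1)[OF K] C(2)[OF K] pos[OF K] by (auto simp: C_def le_max_iff_disj)
    then show ?thesis using pos[OF K] by (simp add: pos_divide_le_eq)
  qed
  let ?V = "fst c \<inter> snd c -` ball (snd c x) r"
  have "open ?V" by (rule continuous_open_preimage[OF chart(3)[OF c(1)] chart(1)[OF c(1)] open_ball])
  moreover have "x \<in> ?V" using x r by auto
  moreover have "C \<ge> 0" by (simp add: C_def)
  moreover have "riemannian.metric M (h z) (mderiv M h z u) (mderiv M h z u) \<le> C * riemannian.metric M z u u \<and>
     riemannian.metric M z u u \<le> C * riemannian.metric M (h z) (mderiv M h z u) (mderiv M h z u)"
    if z: "z \<in> ?V" for z u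
  proof (cases "u = 0")
    case True
    then show ?thesis
      using linear_0[OF mderiv_bij(1)] bilinear_lzero[OF inner_productD(1)[OF inner_product_metric]] by simp
  next
    case False
    have zc: "z \<in> fst c" and zK: "snd c z \<in> cball (snd c x) r" using z by auto
    then have "snd c z \<in> ?W" using r(2) by auto
    then have hz: "h z \<in> fst c'"
      using chart(5)[OF c(1)] zc by (metis (no_types, lifting) IntD1 IntD2 imageE vimage_eq)
    note lin = chart_deriv_bij(1)[OF c zc hz]
    let ?v = "tangent_coords M c z u"
    note bG = inner_productD(1)[OF inner_product_chart_metric[OF c(1) zc]]
    note bF = inner_productD(1)[OF inner_product_chart_metric[OF c(2) hz]]
    have v: "?v \<noteq> 0"
      using tangent_coords_bij[OF c(1) zc] False linear_injective_0 by (metis bij_is_inj)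
    have G: "riemannian.metric M z u u = (norm ?v)\<^sup>2 * G (snd c z) (sgn ?v)"
      using v unfolding metric_eq_chart_metric[OF c(1) zc] G_def sgn_div_norm
      by (simp add: bilinear_lmul[OF bG] bilinear_rmul[OF bG] power2_eq_square field_simps)
    have F: "riemannian.metric M (h z) (mderiv M h z u) (mderiv M h z u) = (norm ?v)\<^sup>2 * F (snd c z) (sgn ?v)"
      using v unfolding metric_eq_chart_metric[OF c(2) hz] F_def sgn_div_norm chart(5)[OF c(1) zc]
        tangent_coords_mderiv[OF c zc hz]
      by (simp add: linear_scale[OF lin] bilinear_lmul[OF bF] bilinear_rmul[OF bF] power2_eq_square field_simps)
    have "F (snd c z) (sgn ?v) \<le> C * G (snd c z) (sgn ?v) \<and> G (snd c z) (sgn ?v) \<le> C * F (snd c z) (sgn ?v)"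
      by (rule FG[OF zK]) (simp add: norm_sgn v)
    then show ?thesis unfolding F G
      by (auto intro: mult_left_mono simp: mult.left_commute[of C])
  qed
  ultimately show ?thesis by blast
qed

text \<open>A finite subcover of \<open>X\<close> suffices, with the sum of the local constants as
  common bound. The point is that the real-valued \<open>SUP\<close> in
  \<open>deriv_sup_norm\<close> and \<open>inv_deriv_sup_norm\<close> dominates its members only
  when these are bounded above.\<close>

lemma deriv_bounds:
  assumes X: "compact X"
  shows "\<exists>C\<ge>0. \<forall>z\<in>X. \<forall>u.
     riemannian.metric M (h z) (mderiv M h z u) (mderiv M h z u) \<le> C * riemannian.metric M z u u \<and>
     riemannian.metric M z u u \<le> C * riemannian.metric M (h z) (mderiv M h z u) (mderiv M h z u)"
proof -
  obtain V C where VC: "\<And>x. open (V x)" "\<And>x. x \<in> V x" "\<And>x. C x \<ge> 0"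
    "\<And>x z u. z \<in> V x \<Longrightarrow>
     riemannian.metric M (h z) (mderiv M h z u) (mderiv M h z u) \<le> C x * riemannian.metric M z u u \<and>
     riemannian.metric M z u u \<le> C x * riemannian.metric M (h z) (mderiv M h z u) (mderiv M h z u)"
    using deriv_bounds_near by metis
  obtain D where D: "D \<subseteq> X" "finite D" "X \<subseteq> (\<Union>x\<in>D. V x)"
    by (rule compactE_image[OF X, of X V]) (use VC(1,2) in auto)
  let ?C = "\<Sum>x\<in>D. C x"
  have "riemannian.metric M (h z) (mderiv M h z u) (mderiv M h z u) \<le> ?C * riemannian.metric M z u u \<and>
     riemannian.metric M z u u \<le> ?C * riemannian.metric M (h z) (mderiv M h z u) (mderiv M h z u)"
    if z: "z \<in> X" for z u
  proof -
    obtain x where x: "x \<in> D" "z \<in> V x" using D(3) z by blast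
    have "C x \<le> ?C" using x(1) D(2) VC(3) by (intro member_le_sum) auto
    then show ?thesis
      using VC(4)[OF x(2), of u] inner_productD(4)[OF inner_product_metric]
      by (meson mult_right_mono order_trans)
  qed
  moreover have "?C \<ge> 0" using VC(3) by (intro sum_nonneg) auto
  ultimately show ?thesis by blast
qed

end

section \<open>Operator norms and their suprema over a compact set\<close>

lemma op_norm_bound:
  assumes g: "inner_product g" and h: "inner_product h" and L: "linear L"
    and C: "C \<ge> 0" "\<And>u. h (L u) (L u) \<le> C * g u u"
  shows "0 \<le> op_norm g h L" "op_norm g h L \<le> sqrt C" "h (L u) (L u) \<le> (op_norm g h L)\<^sup>2 * g u u"
proof -
  let ?S = "(\<lambda>v. sqrt (h (L v) (L v))) ` {v. sqrt (g v v) \<le> 1}"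
  note bg = inner_productD(1)[OF g] and bh = inner_productD(1)[OF h]
  have le: "sqrt (h (L v) (L v)) \<le> sqrt C" if "sqrt (g v v) \<le> 1" for v
  proof -
    have "h (L v) (L v) \<le> C * g v v" by (rule C(2))
    also have "\<dots> \<le> C * 1" by (rule mult_left_mono) (use that C(1) in simp_all)
    finally show ?thesis by simp
  qed
  have bdd: "bdd_above ?S" using le by (intro bdd_aboveI[of _ "sqrt C"]) auto
  have upper: "sqrt (h (L v) (L v)) \<le> op_norm g h L" if "sqrt (g v v) \<le> 1" for v
    unfolding op_norm_def by (rule cSUP_upper[OF _ bdd]) (use that in simp)
  show nonneg: "0 \<le> op_norm g h L"
    using upper[of 0] by (simp add: linear_0[OF L] bilinear_lzero[OF bg] bilinear_lzero[OF bh])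
  show "op_norm g h L \<le> sqrt C"
    unfolding op_norm_def
    by (rule cSUP_least) (use le bilinear_lzero[OF bg, of 0] in \<open>auto intro!: exI[of _ 0]\<close>)
  show "h (L u) (L u) \<le> (op_norm g h L)\<^sup>2 * g u u"
  proof (cases "u = 0")
    case True
    then show ?thesis by (simp add: linear_0[OF L] bilinear_lzero[OF bg] bilinear_lzero[OF bh])
  next
    case False
    define s where "s = sqrt (g u u)"
    have s: "s > 0" "s\<^sup>2 = g u u" using inner_productD(3)[OF g False] by (simp_all add: s_def)
    let ?v = "inverse s *\<^sub>R u"
    have "g ?v ?v = 1"
      using s by (simp add: bilinear_lmul[OF bg] bilinear_rmul[OF bg] power2_eq_square field_simps flip: s(2))
    then have "sqrt (h (L ?v) (L ?v)) \<le> op_norm g h L" by (intro upper) simp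
    then have "h (L ?v) (L ?v) \<le> (op_norm g h L)\<^sup>2"
      by (rule sqrt_le_D)
    moreover have "h (L ?v) (L ?v) = h (L u) (L u) / s\<^sup>2"
      by (simp add: linear_scale[OF L] bilinear_lmul[OF bh] bilinear_rmul[OF bh] power2_eq_square field_simps)
    ultimately show ?thesis using s inner_productD(3)[OF g False] by (simp add: pos_divide_le_eq)
  qed
qed

lemma deriv_sup_norm_bounds:
  assumes h: "C1_local_diffeo M h" and X: "compact X" and z: "z \<in> X"
  shows "0 \<le> deriv_sup_norm M X h" "0 \<le> inv_deriv_sup_norm M X h"
    "riemannian.metric M (h z) (mderiv M h z u) (mderiv M h z u) \<le> (deriv_sup_norm M X h)\<^sup>2 * riemannian.metric M z u u"
    "riemannian.metric M z (inv_into UNIV (mderiv M h z) u) (inv_into UNIV (mderiv M h z) u) \<le>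
      (inv_deriv_sup_norm M X h)\<^sup>2 * riemannian.metric M (h z) u u"
proof -
  obtain C where C: "C \<ge> 0" and b: "\<And>z u. z \<in> X \<Longrightarrow>
     riemannian.metric M (h z) (mderiv M h z u) (mderiv M h z u) \<le> C * riemannian.metric M z u u"
     "\<And>z u. z \<in> X \<Longrightarrow> riemannian.metric M z u u \<le> C * riemannian.metric M (h z) (mderiv M h z u) (mderiv M h z u)"
    using deriv_bounds[OF h X] by blast
  let ?I = "\<lambda>z. inv_into UNIV (mderiv M h z)"
  have surj: "mderiv M h z (?I z u) = u" for z u
    by (rule surj_f_inv_f[OF bij_is_surj[OF mderiv_bij(2)[OF h]]])
  have b': "riemannian.metric M z (?I z u) (?I z u) \<le> C * riemannian.metric M (h z) u u" if "z \<in> X" for z u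
    using b(2)[OF that, of "?I z u"] by (simp add: surj)
  note lin = mderiv_bij(1)[OF h] and lin' = linear_inv_into[OF mderiv_bij[OF h]]
  note 1 = op_norm_bound[OF inner_product_metric inner_product_metric lin C b(1)]
  note 2 = op_norm_bound[OF inner_product_metric inner_product_metric lin' C b']
  have D: "op_norm (riemannian.metric M z) (riemannian.metric M (h z)) (mderiv M h z) \<le> deriv_sup_norm M X h"
    unfolding deriv_sup_norm_def by (rule cSUP_upper[OF z bdd_aboveI2[of _ _ "sqrt C"]]) (rule 1)
  have I: "op_norm (riemannian.metric M (h z)) (riemannian.metric M z) (?I z) \<le> inv_deriv_sup_norm M X h"
    unfolding inv_deriv_sup_norm_def by (rule cSUP_upper[OF z bdd_aboveI2[of _ _ "sqrt C"]]) (rule 2)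
  show "0 \<le> deriv_sup_norm M X h" using 1(1)[OF z] D by linarith
  show "0 \<le> inv_deriv_sup_norm M X h" using 2(1)[OF z] I by linarith
  show "riemannian.metric M (h z) (mderiv M h z u) (mderiv M h z u) \<le> (deriv_sup_norm M X h)\<^sup>2 * riemannian.metric M z u u"
    using 1(3)[OF z, of u] power_mono[OF D 1(1)[OF z], of 2] inner_productD(4)[OF inner_product_metric]
    by (meson mult_right_mono order_trans)
  show "riemannian.metric M z (?I z u) (?I z u) \<le> (inv_deriv_sup_norm M X h)\<^sup>2 * riemannian.metric M (h z) u u"
    using 2(3)[OF z, of u] power_mono[OF I 2(1)[OF z], of 2] inner_productD(4)[OF inner_product_metric]
    by (meson mult_right_mono order_trans)
qed

lemma abs_ln_jac_le:
  assumes h: "C1_local_diffeo M h" and X: "compact X" and z: "z \<in> X" and E: "E \<in> grassmannian j"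
  shows "\<bar>ln (jac j (riemannian.metric M z) (riemannian.metric M (h z)) (mderiv M h z) E)\<bar> \<le>
    ln (sqrt (fact j)) + j * (log_plus (deriv_sup_norm M X h) + log_plus (inv_deriv_sup_norm M X h))"
  by (rule abs_ln_jac_bound[OF inner_product_metric inner_product_metric mderiv_bij[OF h] E])
     (rule deriv_sup_norm_bounds[OF h X z])+

end

subsection \<open>Bundles of planes\<close>

lemma space_borel_of_topology [simp]: "space (borel_of_topology T) = topspace T"
  by (simp add: borel_of_topology_def space_measure_of_conv)

lemma openin_sets_borel_of_topology: "openin T U \<Longrightarrow> U \<in> sets (borel_of_topology T)"
  by (auto simp: borel_of_topology_def sets_measure_of_conv dest: openin_subset)

lemma measurable_borel_of_topology:
  assumes "f \<in> space N \<rightarrow> topspace T" "\<And>U. openin T U \<Longrightarrow> f -` U \<inter> space N \<in> sets N"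
  shows "f \<in> measurable N (borel_of_topology T)"
  unfolding borel_of_topology_def
  by (rule measurable_measure_of) (use assms in \<open>auto dest: openin_subset\<close>)

lemma continuous_map_borel_of_topology:
  assumes "continuous_map T T' f"
  shows "f \<in> measurable (borel_of_topology T) (borel_of_topology T')"
proof (rule measurable_borel_of_topology)
  show "f \<in> space (borel_of_topology T) \<rightarrow> topspace T'"
    using assms by (auto simp: continuous_map_def)
  show "f -` U \<inter> space (borel_of_topology T) \<in> sets (borel_of_topology T)" if "openin T' U" for U
  proof -
    have "f -` U \<inter> topspace T = {x \<in> topspace T. f x \<in> U}" by auto
    moreover have "openin T {x \<in> topspace T. f x \<in> U}"
      using assms that by (simp add: continuous_map_def)
    ultimately show ?thesis using openin_sets_borel_of_topology by simp
  qed
qed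

section \<open>The annihilator map on Grassmannians is a homeomorphism\<close>

lemma openin_grassmannian_topology:
  "openin (grassmannian_topology j) V \<longleftrightarrow>
    (\<exists>W. open W \<and> V = {E \<in> grassmannian j. (\<lambda>v. infdist v E) \<in> W})"
  unfolding grassmannian_topology_def openin_pullback_topology by (auto simp: vimage_def)

lemma openin_grassmannian: "openin (grassmannian_topology j) (grassmannian j)"
  unfolding openin_grassmannian_topology by (rule exI[of _ UNIV]) simp

lemma openin_infdist:
  assumes "open W"
  shows "openin (grassmannian_topology j) {E \<in> grassmannian j. infdist v E \<in> W}"
  unfolding openin_grassmannian_topology
proof (intro exI conjI)
  show "open ((\<lambda>\<phi>. \<phi> v) -` W)"
    by (rule open_vimage[OF assms]) (rule continuous_on_product_coordinates)
qed simp

context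
  fixes j k :: nat
  assumes jk: "j + k = DIM('v::euclidean_space)"
begin

lemma ann_grassmannian: "E \<in> grassmannian j \<Longrightarrow> ann (E :: 'v set) \<in> grassmannian k"
  using bij_betw_ann[OF jk] by (auto simp: bij_betw_def)

text \<open>By \<open>infdist_ann\<close> the distance function of \<open>ann E\<close> arises from
  that of \<open>E\<close> through \<open>?\<psi>\<close>, which is continuous for pointwise
  convergence.\<close>

lemma openin_ann_preimage:
  assumes "openin (grassmannian_topology k) V"
  shows "openin (grassmannian_topology j) {E :: 'v set. E \<in> grassmannian j \<and> ann E \<in> V}"
proof -
  obtain W where W: "open W" "V = {F \<in> grassmannian k. (\<lambda>\<xi>. infdist \<xi> F) \<in> W}"
    using assms unfolding openin_grassmannian_topology by blast
  let ?R = "blinfun_inner_right :: 'v \<Rightarrow> 'v \<Rightarrow>\<^sub>L real"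
  let ?S = "inv_into UNIV ?R"
  let ?\<psi> = "\<lambda>\<phi> \<xi>. sqrt ((norm (?S \<xi>))\<^sup>2 - (\<phi> (?S \<xi>))\<^sup>2)"
  have eq: "(\<lambda>\<xi>. infdist \<xi> (ann E)) = ?\<psi> (\<lambda>v. infdist v E)" if "E \<in> grassmannian j" for E :: "'v set"
  proof
    fix \<xi>
    have "infdist (?R (?S \<xi>)) (ann E) = sqrt (proj_form E (?S \<xi>))"
      using that by (intro infdist_ann) (simp add: grassmannian_def)
    then show "infdist \<xi> (ann E) = ?\<psi> (\<lambda>v. infdist v E) \<xi>"
      by (simp add: proj_form_def surj_f_inv_f[OF bij_is_surj[OF bij_blinfun_inner_right]])
  qed
  have "open (?\<psi> -` W)"
    by (intro open_vimage[OF W(1)] continuous_on_coordinatewise_then_product continuous_intros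
        continuous_on_product_coordinates)
  moreover have "{E. E \<in> grassmannian j \<and> ann E \<in> V} = {E \<in> grassmannian j. (\<lambda>v. infdist v E) \<in> ?\<psi> -` W}"
    using ann_grassmannian by (auto simp: W(2) eq)
  ultimately show ?thesis unfolding openin_grassmannian_topology by blast
qed

text \<open>The relation between the squared distances can be solved for either one; solving it for
  the distance to \<open>E\<close> gives continuity of the inverse.\<close>

lemma openin_ann_image:
  assumes "openin (grassmannian_topology j) V"
  shows "openin (grassmannian_topology k) (ann ` (V :: 'v set set))"
proof -
  obtain W where W: "open W" "V = {E \<in> grassmannian j. (\<lambda>v. infdist v E) \<in> W}"
    using assms unfolding openin_grassmannian_topology by blast
  let ?R = "blinfun_inner_right :: 'v \<Rightarrow> 'v \<Rightarrow>\<^sub>L real"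
  let ?\<psi> = "\<lambda>\<phi> v. sqrt ((norm v)\<^sup>2 - (\<phi> (?R v))\<^sup>2)"
  have eq: "(\<lambda>v. infdist v E) = ?\<psi> (\<lambda>\<xi>. infdist \<xi> (ann E))" if "E \<in> grassmannian j" for E :: "'v set"
  proof
    fix v
    have sub: "subspace E" using that by (simp add: grassmannian_def)
    have "0 \<le> infdist (?R v) (ann E)" by (rule infdist_nonneg)
    then have "(infdist (?R v) (ann E))\<^sup>2 = proj_form E v"
      unfolding infdist_ann[OF sub] by simp
    then show "infdist v E = ?\<psi> (\<lambda>\<xi>. infdist \<xi> (ann E)) v"
      by (simp add: proj_form_def infdist_nonneg)
  qed
  have "open (?\<psi> -` W)"
    by (intro open_vimage[OF W(1)] continuous_on_coordinatewise_then_product continuous_intros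
        continuous_on_product_coordinates)
  moreover have "ann ` V = {F \<in> grassmannian k. (\<lambda>\<xi>. infdist \<xi> F) \<in> ?\<psi> -` W}"
  proof (intro equalityI subsetI)
    fix F assume "F \<in> ann ` V"
    then show "F \<in> {F \<in> grassmannian k. (\<lambda>\<xi>. infdist \<xi> F) \<in> ?\<psi> -` W}"
      using ann_grassmannian eq by (auto simp: W(2))
  next
    fix F assume F: "F \<in> {F \<in> grassmannian k. (\<lambda>\<xi>. infdist \<xi> F) \<in> ?\<psi> -` W}"
    then obtain E where E: "E \<in> grassmannian j" "F = ann E"
      using bij_betw_ann[OF jk] by (auto simp: bij_betw_def)
    then show "F \<in> ann ` V" using F eq[OF E(1)] by (auto simp: W(2))
  qed
  ultimately show ?thesis unfolding openin_grassmannian_topology by blast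
qed

end

text \<open>Common ground for the tangent and the cotangent bundle. That the distinguished chart
  induces the identity on the fibre places every pair \<open>(x, E)\<close> in one of the generating
  open sets.\<close>

locale plane_bundle =
  fixes M :: "('a::topological_space, 'm::finite) riemannian" and X :: "'a set" and j :: nat
    and \<tau> :: "('a, 'm) chart \<Rightarrow> 'a \<Rightarrow> 'v::real_normed_vector \<Rightarrow> 'v"
  assumes chart_at_atlas: "\<And>x. chart_at M x \<in> atlas M" "\<And>x. x \<in> fst (chart_at M x)"
    and atlas_open: "\<And>c. c \<in> atlas M \<Longrightarrow> open (fst c)"
    and \<tau>_chart_at: "\<And>x E. \<tau> (chart_at M x) x ` E = E"
    and \<tau>_grassmannian: "\<And>c x E. c \<in> atlas M \<Longrightarrow> x \<in> fst c \<Longrightarrow> E \<in> grassmannian j \<Longrightarrow> \<tau> c x ` E \<in> grassmannian j"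
begin

abbreviation "bundle \<equiv> plane_bundle_topology M X j \<tau>"

lemma openin_bundle:
  assumes "c \<in> atlas M" "open U" "openin (grassmannian_topology j) V"
  shows "openin bundle {(x, E). x \<in> X \<inter> fst c \<inter> U \<and> E \<in> grassmannian j \<and> \<tau> c x ` E \<in> V}"
  unfolding plane_bundle_topology_def by (rule topology_generated_by_Basis) (use assms in blast)

lemma topspace_bundle: "topspace bundle = X \<times> grassmannian j"
proof (intro equalityI subsetI)
  fix z :: "'a \<times> 'v set" assume "z \<in> topspace bundle"
  then show "z \<in> X \<times> grassmannian j"
    unfolding plane_bundle_topology_def topology_generated_by_topspace by auto
next
  fix z :: "'a \<times> 'v set" assume "z \<in> X \<times> grassmannian j"
  then obtain x E where z: "z = (x, E)" "x \<in> X" "E \<in> grassmannian j" by auto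
  then have "z \<in> {(y, E). y \<in> X \<inter> fst (chart_at M x) \<inter> UNIV \<and> E \<in> grassmannian j \<and>
      \<tau> (chart_at M x) y ` E \<in> grassmannian j}"
    using chart_at_atlas \<tau>_chart_at by auto
  with openin_bundle[OF chart_at_atlas(1) open_UNIV openin_grassmannian, of x] show "z \<in> topspace bundle"
    by (meson openin_subset subsetD)
qed

lemma openin_bundle_fst:
  assumes "open U"
  shows "openin bundle ((X \<inter> U) \<times> grassmannian j)"
proof (subst openin_subopen, rule ballI)
  fix z :: "'a \<times> 'v set" assume "z \<in> (X \<inter> U) \<times> grassmannian j"
  then obtain x E where z: "z = (x, E)" "x \<in> X" "x \<in> U" "E \<in> grassmannian j" by auto
  let ?T = "{(y, E). y \<in> X \<inter> fst (chart_at M x) \<inter> U \<and> E \<in> grassmannian j \<and>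
      \<tau> (chart_at M x) y ` E \<in> grassmannian j}"
  have "openin bundle ?T" by (rule openin_bundle[OF chart_at_atlas(1) assms openin_grassmannian])
  moreover have "z \<in> ?T" using z chart_at_atlas \<tau>_chart_at by auto
  moreover have "?T \<subseteq> (X \<inter> U) \<times> grassmannian j" by auto
  ultimately show "\<exists>T. openin bundle T \<and> z \<in> T \<and> T \<subseteq> (X \<inter> U) \<times> grassmannian j" by blast
qed

lemma fst_measurable: "fst \<in> measurable (borel_of_topology bundle) (restrict_space borel X)"
proof (rule measurable_restrict_space2)
  show "fst \<in> space (borel_of_topology bundle) \<rightarrow> X" by (auto simp: topspace_bundle)
  show "fst \<in> borel_measurable (borel_of_topology bundle)"
  proof (rule borel_measurableI)
    fix S :: "'a set" assume "open S"
    have "fst -` S \<inter> space (borel_of_topology bundle) = (X \<inter> S) \<times> grassmannian j"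
      by (auto simp: topspace_bundle)
    then show "fst -` S \<inter> space (borel_of_topology bundle) \<in> sets (borel_of_topology bundle)"
      using openin_bundle_fst[OF \<open>open S\<close>] openin_sets_borel_of_topology by metis
  qed
qed

lemma infdist_measurable:
  assumes c: "c \<in> atlas M"
  shows "(\<lambda>z. if fst z \<in> fst c then infdist v (\<tau> c (fst z) ` snd z) else 0)
    \<in> borel_measurable (borel_of_topology bundle)" (is "?f \<in> _")
proof -
  let ?N = "borel_of_topology bundle"
  have P: "Measurable.pred ?N (\<lambda>z. fst z \<in> fst c)"
  proof -
    have "{z \<in> space ?N. fst z \<in> fst c} = (X \<inter> fst c) \<times> grassmannian j" by (auto simp: topspace_bundle)
    then show ?thesis
      using openin_sets_borel_of_topology[OF openin_bundle_fst[OF atlas_open[OF c]]]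
      by (simp add: pred_def)
  qed
  show ?thesis
  proof (rule borel_measurableI)
    fix W :: "real set" assume W: "open W"
    let ?G = "{(x, E). x \<in> X \<inter> fst c \<inter> UNIV \<and> E \<in> grassmannian j \<and>
      \<tau> c x ` E \<in> {E \<in> grassmannian j. infdist v E \<in> W}}"
    have G: "?G \<in> sets ?N"
      by (intro openin_sets_borel_of_topology openin_bundle[OF c open_UNIV] openin_infdist W)
    \<comment> \<open>The default value \<open>0\<close> matters here: if \<open>W\<close> contains
      \<open>0\<close>, everything off the chart domain lies in the preimage.\<close>
    have "?f -` W \<inter> space ?N = ?G \<union> (if 0 \<in> W then {z \<in> space ?N. \<not> fst z \<in> fst c} else {})"
      using \<tau>_grassmannian[OF c] by (auto simp: topspace_bundle split: if_splits)
    moreover have "{z \<in> space ?N. \<not> fst z \<in> fst c} \<in> sets ?N"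
      using P by measurable
    ultimately show "?f -` W \<inter> space ?N \<in> sets ?N"
      using G by auto
  qed
qed

text \<open>A subspace fixed by all coordinate maps defines a global section. The cases of interest
  are the whole space, for the determinant, and the zero space, for the lifts to
  \<open>0\<close>-planes.\<close>

lemma section_measurable:
  assumes E: "E \<in> grassmannian j" "\<And>c x. c \<in> atlas M \<Longrightarrow> x \<in> fst c \<Longrightarrow> \<tau> c x ` E = E"
  shows "(\<lambda>x. (x, E)) \<in> measurable (restrict_space borel X) (borel_of_topology bundle)"
proof (rule measurable_borel_of_topology)
  have "continuous_map (top_of_set X) bundle (\<lambda>x. (x, E))"
    unfolding plane_bundle_topology_def
  proof (rule continuous_on_generated_topo)
    fix S assume "S \<in> {{(x, E). x \<in> X \<inter> fst c \<inter> U \<and> E \<in> grassmannian j \<and> \<tau> c x ` E \<in> V} | c U V.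
        c \<in> atlas M \<and> open U \<and> openin (grassmannian_topology j) V}"
    then obtain c U V where S: "S = {(x, E). x \<in> X \<inter> fst c \<inter> U \<and> E \<in> grassmannian j \<and> \<tau> c x ` E \<in> V}"
      "c \<in> atlas M" "open U" by blast
    have "(\<lambda>x. (x, E)) -` S \<inter> topspace (top_of_set X) = (if E \<in> V then X \<inter> (fst c \<inter> U) else {})"
      using E(1) E(2)[OF S(2)] by (auto simp: S(1))
    moreover have "open (fst c \<inter> U)" using atlas_open[OF S(2)] S(3) by (rule open_Int)
    ultimately show "openin (top_of_set X) ((\<lambda>x. (x, E)) -` S \<inter> topspace (top_of_set X))"
      by (auto simp: openin_open)
  next
    show "(\<lambda>x. (x, E)) ` topspace (top_of_set X) \<subseteq> \<Union> {{(x, E). x \<in> X \<inter> fst c \<inter> U \<and> E \<in> grassmannian j \<and> \<tau> c x ` E \<in> V} | c U V.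
        c \<in> atlas M \<and> open U \<and> openin (grassmannian_topology j) V}"
      unfolding topspace_bundle[unfolded plane_bundle_topology_def topology_generated_by_topspace]
      using E(1) by auto
  qed
  then show "(\<lambda>x. (x, E)) -` U \<inter> space (restrict_space borel X) \<in> sets (restrict_space borel X)"
    if "openin bundle U" for U
  proof -
    have "openin (top_of_set X) {x \<in> X. (x, E) \<in> U}"
      using \<open>continuous_map (top_of_set X) bundle (\<lambda>x. (x, E))\<close> that by (simp add: continuous_map_def)
    then obtain T where T: "open T" "{x \<in> X. (x, E) \<in> U} = X \<inter> T" by (auto simp: openin_open)
    have "(\<lambda>x. (x, E)) -` U \<inter> space (restrict_space borel X) = X \<inter> T"
      using T(2) by (auto simp: space_restrict_space)
    then show ?thesis using T(1) by (auto simp: sets_restrict_space)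
  qed
  show "(\<lambda>x. (x, E)) \<in> space (restrict_space borel X) \<rightarrow> topspace bundle"
    using E(1) by (auto simp: topspace_bundle space_restrict_space)
qed

end

text \<open>No measurability of \<open>B\<close> is needed: \<open>B\<close> and its preimage are measurable simultaneously, and both
  sides are \<open>0\<close> otherwise.  This is what makes stationarity invariant under isomorphisms although
  the maps \<open>F \<omega>\<close> in its definition are not assumed measurable.\<close>

lemma emeasure_distr_iso:
  assumes \<nu>: "sets \<nu> = sets N"
    and \<Phi>: "\<Phi> \<in> measurable N N'" and \<Psi>: "\<Psi> \<in> measurable N' N"
    and inv: "\<And>z. z \<in> space N \<Longrightarrow> \<Psi> (\<Phi> z) = z" "\<And>w. w \<in> space N' \<Longrightarrow> \<Phi> (\<Psi> w) = w"
    and B: "B \<subseteq> space N'"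
  shows "emeasure (distr \<nu> N' \<Phi>) B = emeasure \<nu> (\<Phi> -` B \<inter> space N)"
proof (cases "B \<in> sets N'")
  case True
  have "\<Phi> \<in> measurable \<nu> N'" unfolding measurable_cong_sets[OF \<nu> refl] by (rule \<Phi>)
  then show ?thesis
    unfolding sets_eq_imp_space_eq[OF \<nu>, symmetric] by (rule emeasure_distr[OF _ True])
next
  case False
  have "\<Phi> -` B \<inter> space N \<notin> sets N"
  proof
    assume "\<Phi> -` B \<inter> space N \<in> sets N"
    then have "\<Psi> -` (\<Phi> -` B \<inter> space N) \<inter> space N' \<in> sets N'" by (rule measurable_sets[OF \<Psi>])
    moreover have "\<Psi> -` (\<Phi> -` B \<inter> space N) \<inter> space N' = B"
      using B inv(2) measurable_space[OF \<Psi>] by auto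
    ultimately show False using False by simp
  qed
  then show ?thesis using False \<nu> by (simp add: emeasure_notin_sets)
qed

text \<open>For almost every \<open>\<omega>\<close> the conjugacy matches the preimages under
  \<open>F \<omega>\<close> and \<open>F' \<omega>\<close>, so the integrands of the two
  stationarity equations agree. This serves both the annihilator map and the zero section of the
  bundle.\<close>

lemma stationary_iso:
  assumes st: "stationary P N F \<nu>"
    and \<Phi>: "\<Phi> \<in> measurable N N'" and \<Psi>: "\<Psi> \<in> measurable N' N"
    and inv: "\<And>z. z \<in> space N \<Longrightarrow> \<Psi> (\<Phi> z) = z" "\<And>w. w \<in> space N' \<Longrightarrow> \<Phi> (\<Psi> w) = w"
    and conj: "AE \<omega> in P. \<forall>z\<in>space N. F \<omega> z \<in> space N \<and> F' \<omega> (\<Phi> z) = \<Phi> (F \<omega> z)"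
  shows "stationary P N' F' (distr \<nu> N' \<Phi>)"
  unfolding stationary_def
proof (intro conjI ballI)
  have \<nu>: "prob_space \<nu>" "sets \<nu> = sets N"
    using st by (simp_all add: stationary_def)
  show "prob_space (distr \<nu> N' \<Phi>)"
    by (rule prob_space.prob_space_distr[OF \<nu>(1)]) (unfold measurable_cong_sets[OF \<nu>(2) refl], rule \<Phi>)
  have em: "emeasure (distr \<nu> N' \<Phi>) B = emeasure \<nu> (\<Phi> -` B \<inter> space N)" if "B \<subseteq> space N'" for B
    by (rule emeasure_distr_iso[OF \<nu>(2) \<Phi> \<Psi> _ _ that]) (simp_all add: inv)
  fix A assume A: "A \<in> sets N'"
  have "emeasure (distr \<nu> N' \<Phi>) A = emeasure \<nu> (\<Phi> -` A \<inter> space N)"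
    by (rule em[OF sets.sets_into_space[OF A]])
  also have "\<dots> = (\<integral>\<^sup>+\<omega>. emeasure \<nu> (F \<omega> -` (\<Phi> -` A \<inter> space N) \<inter> space N) \<partial>P)"
    using st measurable_sets[OF \<Phi> A] by (simp add: stationary_def)
  also have "\<dots> = (\<integral>\<^sup>+\<omega>. emeasure (distr \<nu> N' \<Phi>) (F' \<omega> -` A \<inter> space N') \<partial>P)"
  proof (rule nn_integral_cong_AE, use conj in eventually_elim)
    fix \<omega> assume *: "\<forall>z\<in>space N. F \<omega> z \<in> space N \<and> F' \<omega> (\<Phi> z) = \<Phi> (F \<omega> z)"
    then have "F \<omega> -` (\<Phi> -` A \<inter> space N) \<inter> space N = \<Phi> -` (F' \<omega> -` A \<inter> space N') \<inter> space N"
      using measurable_space[OF \<Phi>] by auto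
    then show "emeasure \<nu> (F \<omega> -` (\<Phi> -` A \<inter> space N) \<inter> space N) =
        emeasure (distr \<nu> N' \<Phi>) (F' \<omega> -` A \<inter> space N')"
      by (simp add: em)
  qed
  finally show "emeasure (distr \<nu> N' \<Phi>) A =
      (\<integral>\<^sup>+\<omega>. emeasure (distr \<nu> N' \<Phi>) (F' \<omega> -` A \<inter> space N') \<partial>P)" .
qed simp

section \<open>The annihilator isomorphism between the two plane bundles\<close>

definition ann_bundle :: "'a \<times> 'v::real_normed_vector set \<Rightarrow> 'a \<times> ('v \<Rightarrow>\<^sub>L real) set" where
  "ann_bundle = (\<lambda>(x, E). (x, ann E))"

definition ann_bundle_inv :: "nat \<Rightarrow> 'a \<times> ('v::real_normed_vector \<Rightarrow>\<^sub>L real) set \<Rightarrow> 'a \<times> 'v set" where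
  "ann_bundle_inv j = (\<lambda>(x, F). (x, the_inv_into (grassmannian j) ann F))"

context riemannian_mfd
begin

lemma dual_inverse_id: "dual_inverse (\<lambda>u. u) \<xi> = \<xi>" for \<xi> :: "(real ^ 'm) \<Rightarrow>\<^sub>L real"
proof (rule blinfun_eqI)
  fix w :: "real ^ 'm"
  have "bij (\<lambda>u :: real ^ 'm. u)" using bij_id unfolding id_def .
  moreover have "inv_into UNIV (\<lambda>u. u) w = w" by (rule inv_into_f_f[of "\<lambda>u. u" UNIV]) simp_all
  ultimately show "blinfun_apply (dual_inverse (\<lambda>u. u) \<xi>) w = blinfun_apply \<xi> w"
    by (simp only: dual_inverse_apply[OF linear_ident])
qed

lemma tangent_coords_chart_at: "tangent_coords M (chart_at M x) x = (\<lambda>u. u)"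
  using coord_change_self[OF chart_at] by (simp add: tangent_coords_def fun_eq_iff)

lemma plane_bundle_tangent: "plane_bundle M j (tangent_coords M)"
proof
  fix c x and E :: "(real ^ 'm) set" assume *: "c \<in> atlas M" "x \<in> fst c" "E \<in> grassmannian j"
  note T = tangent_coords_bij[OF *(1,2)]
  show "tangent_coords M c x ` E \<in> grassmannian j"
    by (rule grassmannian_image[OF T(1) bij_is_inj[OF T(2)] *(3)])
qed (simp_all add: chart_at chart(1) tangent_coords_chart_at)

lemma ann_tangent:
  assumes "c \<in> atlas M" "x \<in> fst c"
  shows "dual_inverse (tangent_coords M c x) ` ann E = ann (tangent_coords M c x ` E)"
  by (rule ann_image[OF tangent_coords_bij[OF assms], symmetric])

lemma plane_bundle_cotangent:
  assumes jk: "j + k = CARD('m)"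
  shows "plane_bundle M k (\<lambda>c x. dual_inverse (tangent_coords M c x))"
proof
  have jk': "j + k = DIM(real ^ 'm)" using jk by simp
  fix c x and F :: "((real ^ 'm) \<Rightarrow>\<^sub>L real) set" assume *: "c \<in> atlas M" "x \<in> fst c" "F \<in> grassmannian k"
  then obtain E where E: "E \<in> grassmannian j" "F = ann E"
    using bij_betw_ann[OF jk'] by (auto simp: bij_betw_def)
  note T = tangent_coords_bij[OF *(1,2)]
  show "dual_inverse (tangent_coords M c x) ` F \<in> grassmannian k"
    unfolding E(2) ann_tangent[OF *(1,2)]
    by (rule ann_grassmannian[OF jk' grassmannian_image[OF T(1) bij_is_inj[OF T(2)] E(1)]])
qed (simp_all add: chart_at chart(1) tangent_coords_chart_at dual_inverse_id)

context
  fixes j k :: nat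
  assumes jk: "j + k = CARD('m)"
begin

lemma jk': "j + k = DIM(real ^ 'm)" using jk by simp

interpretation T: plane_bundle M X j "tangent_coords M" for X by (rule plane_bundle_tangent)
interpretation C: plane_bundle M X k "\<lambda>c x. dual_inverse (tangent_coords M c x)" for X
  by (rule plane_bundle_cotangent[OF jk])

lemma inj_on_ann: "inj_on ann (grassmannian j :: (real ^ 'm) set set)"
  and image_ann: "ann ` (grassmannian j :: (real ^ 'm) set set) = grassmannian k"
  using bij_betw_ann[OF jk'] by (simp_all add: bij_betw_def)

lemma ann_inverse:
  fixes F :: "((real ^ 'm) \<Rightarrow>\<^sub>L real) set"
  assumes "F \<in> grassmannian k"
  shows "the_inv_into (grassmannian j) ann F \<in> grassmannian j"
    "ann (the_inv_into (grassmannian j) ann F) = F"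
  using the_inv_into_into[OF inj_on_ann _ order_refl, of F] f_the_inv_into_f[OF inj_on_ann, of F] assms
  by (simp_all only: image_ann)

lemma ann_bundle_inverse:
  "(z :: 'a \<times> (real ^ 'm) set) \<in> X \<times> grassmannian j \<Longrightarrow> ann_bundle_inv j (ann_bundle z) = z"
  "(w :: 'a \<times> ((real ^ 'm) \<Rightarrow>\<^sub>L real) set) \<in> X \<times> grassmannian k \<Longrightarrow>
    ann_bundle (ann_bundle_inv j w) = w"
  by (cases z, cases w, simp add: ann_bundle_def ann_bundle_inv_def the_inv_into_f_f[OF inj_on_ann])
    (cases w, simp add: ann_bundle_def ann_bundle_inv_def ann_inverse(2))

text \<open>Annihilators commute with taking coordinates, so over each chart the map is the identity
  of the base times \<open>ann\<close> on the Grassmannian, and continuity can be tested on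
  generating open sets.\<close>

lemma ann_bundle_measurable:
  "ann_bundle \<in> measurable (grass_bundle_borel M X j) (cograss_bundle_borel M X k)"
  unfolding grass_bundle_borel_def cograss_bundle_borel_def
proof (rule continuous_map_borel_of_topology)
  show "continuous_map (plane_bundle_topology M X j (tangent_coords M))
     (plane_bundle_topology M X k (\<lambda>c x. dual_inverse (tangent_coords M c x))) ann_bundle"
    unfolding plane_bundle_topology_def[of M X k]
  proof (rule continuous_on_generated_topo)
    fix S assume "S \<in> {{(x, E). x \<in> X \<inter> fst c \<inter> U \<and> E \<in> grassmannian k \<and>
          dual_inverse (tangent_coords M c x) ` E \<in> V} | c U V.
        c \<in> atlas M \<and> open U \<and> openin (grassmannian_topology k) V}"
    then obtain c U V where S: "S = {(x, E). x \<in> X \<inter> fst c \<inter> U \<and> E \<in> grassmannian k \<and>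
        dual_inverse (tangent_coords M c x) ` E \<in> V}"
      and c: "c \<in> atlas M" "open U" "openin (grassmannian_topology k) V" by blast
    have "ann_bundle -` S \<inter> topspace (plane_bundle_topology M X j (tangent_coords M)) =
      {(x, E). x \<in> X \<inter> fst c \<inter> U \<and> E \<in> grassmannian j \<and>
        tangent_coords M c x ` E \<in> {E. E \<in> grassmannian j \<and> ann E \<in> V}}"
      using ann_grassmannian[OF jk'] T.\<tau>_grassmannian[OF c(1)] ann_tangent[OF c(1)]
      by (auto simp: T.topspace_bundle S ann_bundle_def)
    then show "openin (plane_bundle_topology M X j (tangent_coords M))
        (ann_bundle -` S \<inter> topspace (plane_bundle_topology M X j (tangent_coords M)))"
      using T.openin_bundle[OF c(1,2) openin_ann_preimage[OF jk' c(3)]] by simp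
  next
    show "ann_bundle ` topspace (plane_bundle_topology M X j (tangent_coords M)) \<subseteq>
      \<Union> {{(x, E). x \<in> X \<inter> fst c \<inter> U \<and> E \<in> grassmannian k \<and>
          dual_inverse (tangent_coords M c x) ` E \<in> V} | c U V.
        c \<in> atlas M \<and> open U \<and> openin (grassmannian_topology k) V}"
      unfolding C.topspace_bundle[unfolded plane_bundle_topology_def topology_generated_by_topspace] T.topspace_bundle
      using ann_grassmannian[OF jk'] by (auto simp: ann_bundle_def)
  qed
qed

lemma ann_bundle_inv_measurable:
  "ann_bundle_inv j \<in> measurable (cograss_bundle_borel M X k) (grass_bundle_borel M X j)"
  unfolding grass_bundle_borel_def cograss_bundle_borel_def
proof (rule continuous_map_borel_of_topology)
  let ?I = "the_inv_into (grassmannian j) ann :: _ \<Rightarrow> (real ^ 'm) set"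
  note I = ann_inverse
  show "continuous_map (plane_bundle_topology M X k (\<lambda>c x. dual_inverse (tangent_coords M c x)))
     (plane_bundle_topology M X j (tangent_coords M)) (ann_bundle_inv j)"
    unfolding plane_bundle_topology_def[of M X j]
  proof (rule continuous_on_generated_topo)
    fix S assume "S \<in> {{(x, E). x \<in> X \<inter> fst c \<inter> U \<and> E \<in> grassmannian j \<and>
          tangent_coords M c x ` E \<in> V} | c U V.
        c \<in> atlas M \<and> open U \<and> openin (grassmannian_topology j) V}"
    then obtain c U V where S: "S = {(x, E). x \<in> X \<inter> fst c \<inter> U \<and> E \<in> grassmannian j \<and>
        tangent_coords M c x ` E \<in> V}"
      and c: "c \<in> atlas M" "open U" "openin (grassmannian_topology j) V" by blast
    have V: "V \<subseteq> grassmannian j" using c(3) by (auto simp: openin_grassmannian_topology)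
    have "tangent_coords M c x ` ?I F \<in> V \<longleftrightarrow> dual_inverse (tangent_coords M c x) ` F \<in> ann ` V"
      if x: "x \<in> fst c" and F: "F \<in> grassmannian k" for x F
    proof -
      have "dual_inverse (tangent_coords M c x) ` F = ann (tangent_coords M c x ` ?I F)"
        using ann_tangent[OF c(1) x, of "?I F"] I(2)[OF F] by simp
      moreover have "tangent_coords M c x ` ?I F \<in> grassmannian j"
        by (rule T.\<tau>_grassmannian[OF c(1) x I(1)[OF F]])
      ultimately show ?thesis using inj_on_image_mem_iff[OF inj_on_ann _ V] by simp
    qed
    then have "ann_bundle_inv j -` S \<inter> topspace (plane_bundle_topology M X k (\<lambda>c x. dual_inverse (tangent_coords M c x))) =
      {(x, F). x \<in> X \<inter> fst c \<inter> U \<and> F \<in> grassmannian k \<and>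
        dual_inverse (tangent_coords M c x) ` F \<in> ann ` V}"
      using I by (auto simp: C.topspace_bundle S ann_bundle_inv_def)
    then show "openin (plane_bundle_topology M X k (\<lambda>c x. dual_inverse (tangent_coords M c x)))
        (ann_bundle_inv j -` S \<inter> topspace (plane_bundle_topology M X k (\<lambda>c x. dual_inverse (tangent_coords M c x))))"
      using C.openin_bundle[OF c(1,2) openin_ann_image[OF jk' c(3)]] by simp
  next
    show "ann_bundle_inv j ` topspace (plane_bundle_topology M X k (\<lambda>c x. dual_inverse (tangent_coords M c x))) \<subseteq>
      \<Union> {{(x, E). x \<in> X \<inter> fst c \<inter> U \<and> E \<in> grassmannian j \<and>
          tangent_coords M c x ` E \<in> V} | c U V.
        c \<in> atlas M \<and> open U \<and> openin (grassmannian_topology j) V}"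
      unfolding T.topspace_bundle[unfolded plane_bundle_topology_def topology_generated_by_topspace] C.topspace_bundle
      using I by (auto simp: ann_bundle_inv_def)
  qed
qed

end

end

subsection \<open>Measurability of the Jacobian\<close>

lemma borel_measurable_jdet [measurable (raw)]:
  assumes "\<And>i l. i < n \<Longrightarrow> l < n \<Longrightarrow> (\<lambda>x. A x i l) \<in> borel_measurable N"
  shows "(\<lambda>x. jdet n (A x)) \<in> borel_measurable N"
proof -
  have "p i < n" if "p permutes {..<n}" "i < n" for p i
    using permutes_in_image[OF that(1), of i] that(2) by simp
  then show ?thesis
    unfolding jdet_expand
    by (intro borel_measurable_sum borel_measurable_times borel_measurable_const borel_measurable_prod assms)
       simp_all
qed

text \<open>The set where membership in \<open>A\<close> differs for \<open>F\<close> and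
  \<open>G\<close> lies in a null set, and all such sets are measurable in the completion.\<close>

lemma measurable_completion_AE:
  assumes G: "G \<in> measurable P N" and F: "F \<in> space P \<rightarrow> space N" and eq: "AE x in P. F x = G x"
  shows "F \<in> measurable (completion P) N"
proof (rule measurableI)
  show "F x \<in> space N" if "x \<in> space (completion P)" for x using F that by auto
  fix A assume A: "A \<in> sets N"
  have 1: "Measurable.pred (completion P) (\<lambda>x. G x \<in> A)"
    using measurable_sets[OF measurable_completion[OF G] A]
    by (simp add: pred_def vimage_def Int_def conj_commute)
  have 2: "Measurable.pred (completion P) (\<lambda>x. G x \<in> A \<and> F x \<notin> A)"
    by (rule sets_completion_AE) (use eq in \<open>eventually_elim, auto\<close>)
  have 3: "Measurable.pred (completion P) (\<lambda>x. G x \<notin> A \<and> F x \<in> A)"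
    by (rule sets_completion_AE) (use eq in \<open>eventually_elim, auto\<close>)
  have "Measurable.pred (completion P) (\<lambda>x. (G x \<in> A \<and> \<not> (G x \<in> A \<and> F x \<notin> A)) \<or> (G x \<notin> A \<and> F x \<in> A))"
    by (intro pred_intros_logic 1 2 3)
  also have "(\<lambda>x. (G x \<in> A \<and> \<not> (G x \<in> A \<and> F x \<notin> A)) \<or> (G x \<notin> A \<and> F x \<in> A)) = (\<lambda>x. F x \<in> A)"
    by (rule ext) blast
  finally have "Measurable.pred (completion P) (\<lambda>x. F x \<in> A)" .
  then show "F -` A \<inter> space (completion P) \<in> sets (completion P)"
    by (simp add: pred_def vimage_def Int_def conj_commute)
qed

text \<open>Turns the integrals over \<open>completion (noise p)\<close> in the definition of the
  exponents into integrals of measurable representatives over \<open>noise p\<close>.\<close>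

lemma integral_completion_AE:
  fixes F G :: "'a \<Rightarrow> real"
  assumes G: "G \<in> borel_measurable P" and eq: "AE x in P. F x = G x"
  shows "(\<integral>x. F x \<partial>completion P) = (\<integral>x. G x \<partial>P)"
proof -
  have F: "F \<in> borel_measurable (completion P)"
    by (rule measurable_completion_AE[OF G _ eq]) simp
  have "(\<integral>x. F x \<partial>completion P) = (\<integral>x. G x \<partial>completion P)"
    by (rule integral_cong_AE[OF F measurable_completion[OF G] AE_completion[OF eq]])
  then show ?thesis by (simp add: integral_completion[OF G])
qed

text \<open>The dominating function is not assumed measurable: its integral is then a lower integral,
  which still bounds the integral of any measurable function below it.\<close>

lemma integral_bounded_by_lower_integral:
  fixes u h :: "'a \<Rightarrow> real" and n :: nat
  assumes P: "prob_space P" and u: "u \<in> borel_measurable P"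
    and le: "AE x in P. \<bar>u x\<bar> \<le> c + n * h x" and c: "c \<ge> 0"
    and fin: "(\<integral>\<^sup>+x. ennreal (h x) \<partial>P) < \<infinity>"
  shows "integrable P u" "\<bar>\<integral>x. u x \<partial>P\<bar> \<le> c + Suc n * enn2real (\<integral>\<^sup>+x. ennreal (h x) \<partial>P)"
proof -
  interpret prob_space P by (rule P)
  let ?H = "\<integral>\<^sup>+x. ennreal (h x) \<partial>P"
  \<comment> \<open>A measurable function below \<open>h\<close> where \<open>h\<close> is
    nonnegative, obtained from the excess of \<open>\<bar>u x\<bar>\<close> over \<open>c\<close>.
    The divisor is \<open>Suc n\<close> to allow \<open>n = 0\<close>.\<close>
  let ?v = "\<lambda>x. max 0 ((\<bar>u x\<bar> - c) / Suc n)"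
  have v: "?v \<in> borel_measurable P" using u by measurable
  have vle: "AE x in P. ennreal (?v x) \<le> ennreal (h x)"
    using le
  proof eventually_elim
    fix x assume *: "\<bar>u x\<bar> \<le> c + n * h x"
    show "ennreal (?v x) \<le> ennreal (h x)"
    proof (cases "\<bar>u x\<bar> \<le> c")
      case True
      then have "(\<bar>u x\<bar> - c) / Suc n \<le> 0" by (intro divide_nonpos_pos) simp_all
      then have "?v x = 0" by (rule max_absorb1)
      then show ?thesis by simp
    next
      case False
      \<comment> \<open>\<open>ennreal\<close> truncates negative values of \<open>h\<close>; in
        this case \<open>h x\<close> cannot be negative.\<close>
      then have "0 < n * h x" using * by linarith
      then have "0 \<le> h x" by (simp add: zero_less_mult_iff)
      then have "\<bar>u x\<bar> - c \<le> h x * Suc n" using * by (simp add: algebra_simps)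
      then have "?v x \<le> h x" using \<open>0 \<le> h x\<close> by (simp add: pos_divide_le_eq)
      then show ?thesis by (rule ennreal_leI)
    qed
  qed
  then have nv: "(\<integral>\<^sup>+x. ennreal (?v x) \<partial>P) \<le> ?H" by (rule nn_integral_mono_AE)
  have iv: "integrable P ?v"
    using nv fin by (intro integrableI_bounded v) (auto simp: max_def order.strict_trans1)
  have "(\<integral>x. ?v x \<partial>P) = enn2real (\<integral>\<^sup>+x. ennreal (?v x) \<partial>P)"
    by (rule integral_eq_nn_integral[OF v]) simp
  also have "\<dots> \<le> enn2real ?H"
    using nv fin by (intro enn2real_mono) auto
  finally have Iv: "(\<integral>x. ?v x \<partial>P) \<le> enn2real ?H" .
  have ub: "\<bar>u x\<bar> \<le> c + Suc n * ?v x" for x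
  proof -
    have "\<bar>u x\<bar> - c = Suc n * ((\<bar>u x\<bar> - c) / Suc n)" by simp
    also have "\<dots> \<le> Suc n * ?v x" by (intro mult_left_mono) auto
    finally show ?thesis by simp
  qed
  have ib: "integrable P (\<lambda>x. c + Suc n * ?v x)" using iv by simp
  show iu: "integrable P u"
  proof (rule Bochner_Integration.integrable_bound[OF ib u AE_I2])
    show "norm (u x) \<le> norm (c + Suc n * ?v x)" for x
      unfolding real_norm_def by (rule order_trans[OF ub abs_ge_self])
  qed
  have "\<bar>\<integral>x. u x \<partial>P\<bar> \<le> (\<integral>x. \<bar>u x\<bar> \<partial>P)" by (rule integral_abs_bound)
  also have "\<dots> \<le> (\<integral>x. c + Suc n * ?v x \<partial>P)"
    by (rule integral_mono[OF integrable_abs[OF iu] ib ub])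
  also have "\<dots> = c + Suc n * (\<integral>x. ?v x \<partial>P)"
    using iv by (simp add: prob_space)
  also have "\<dots> \<le> c + Suc n * enn2real ?H"
    using Iv by (intro add_left_mono mult_left_mono) auto
  finally show "\<bar>\<integral>x. u x \<partial>P\<bar> \<le> c + Suc n * enn2real ?H" .
qed

text \<open>A derivative as the limit of a sequence of difference quotients inherits measurability
  in parameters.\<close>

lemma has_derivative_sequence:
  fixes r :: "'v::real_normed_vector \<Rightarrow> 'w::real_normed_vector"
  assumes r: "(r has_derivative D) (at y)" and v: "norm v = 1"
  shows "(\<lambda>n. real (Suc n) *\<^sub>R (r (y + (1 / real (Suc n)) *\<^sub>R v) - r y)) \<longlonglongrightarrow> D v"
proof -
  let ?h = "\<lambda>n. (1 / real (Suc n)) *\<^sub>R v"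
  have lin: "linear D" using r by (rule has_derivative_linear)
  have h0: "?h \<longlonglongrightarrow> 0"
    using tendsto_scaleR[OF LIMSEQ_inverse_real_of_nat tendsto_const[of v]] by (simp add: inverse_eq_divide)
  have lim: "(\<lambda>h. norm (r (y + h) - r y - D h) / norm h) \<midarrow>0\<rightarrow> 0"
    using r by (simp add: has_derivative_at)
  have "filterlim ?h (at 0) sequentially"
    by (rule filterlim_atI[OF h0]) (use v in auto)
  from filterlim_compose[OF lim this]
  have "(\<lambda>n. norm (r (y + ?h n) - r y - D (?h n)) / norm (?h n)) \<longlonglongrightarrow> 0" .
  moreover have "norm (r (y + ?h n) - r y - D (?h n)) / norm (?h n) =
      norm (real (Suc n) *\<^sub>R (r (y + ?h n) - r y) - D v)" for n
  proof -
    have "real (Suc n) *\<^sub>R D (?h n) = D v"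
      unfolding linear_scale[OF lin] by simp
    then have eq: "real (Suc n) *\<^sub>R (r (y + ?h n) - r y) - D v = real (Suc n) *\<^sub>R (r (y + ?h n) - r y - D (?h n))"
      by (simp only: scaleR_right_diff_distrib)
    have "norm (?h n) = 1 / real (Suc n)" using v by simp
    then show ?thesis unfolding eq norm_scaleR by (simp add: mult.commute)
  qed
  ultimately have "(\<lambda>n. norm (real (Suc n) *\<^sub>R (r (y + ?h n) - r y) - D v)) \<longlonglongrightarrow> 0" by simp
  then show ?thesis by (rule LIM_zero_cancel[OF tendsto_norm_zero_cancel])
qed

section \<open>Random maps and the exceptional null set\<close>

locale random_map = riemannian_mfd M
  for M :: "('a::{second_countable_topology,t2_space}, 'm::finite) riemannian" +
  fixes p :: "'t measure" and f :: "(nat \<Rightarrow> 't) \<Rightarrow> 'a \<Rightarrow> 'a" and X :: "'a set"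
  assumes p: "prob_space p" and f: "C1_random_map M p f" and X: "compact X"
    and fX: "AE \<omega> in noise p. f \<omega> ` X \<subseteq> X"
    and log_int: "(\<integral>\<^sup>+\<omega>. ennreal (log_plus (deriv_sup_norm M X (f \<omega>)) +
      log_plus (inv_deriv_sup_norm M X (f \<omega>))) \<partial>noise p) < \<infinity>"
begin

lemma prob_space_noise: "prob_space (noise p)"
  by (rule prob_space_PiM) (rule p)

definition good :: "(nat \<Rightarrow> 't) \<Rightarrow> bool" where
  "good \<omega> \<longleftrightarrow> C1_local_diffeo M (f \<omega>) \<and> f \<omega> ` X \<subseteq> X"

lemma AE_good: "AE \<omega> in noise p. good \<omega>"
proof -
  have "AE \<omega> in noise p. C1_local_diffeo M (f \<omega>)"
    by (rule f[unfolded C1_random_map_def, THEN conjunct2, THEN conjunct2])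
  with fX show ?thesis by eventually_elim (simp add: good_def)
qed

text \<open>The failure set of \<open>good\<close> need not be measurable. Fixing a measurable null
  set around it allows integrands to be redefined there while staying measurable.\<close>

definition exceptional :: "(nat \<Rightarrow> 't) set" where
  "exceptional = (SOME N. N \<in> null_sets (noise p) \<and> {\<omega> \<in> space (noise p). \<not> good \<omega>} \<subseteq> N)"

lemma exceptional:
  "exceptional \<in> null_sets (noise p)"
  "\<omega> \<in> space (noise p) \<Longrightarrow> \<omega> \<notin> exceptional \<Longrightarrow> good \<omega>"
proof -
  obtain N where "{\<omega> \<in> space (noise p). \<not> good \<omega>} \<subseteq> N" "emeasure (noise p) N = 0" "N \<in> sets (noise p)"
    by (rule AE_E[OF AE_good])
  then have "\<exists>N. N \<in> null_sets (noise p) \<and> {\<omega> \<in> space (noise p). \<not> good \<omega>} \<subseteq> N"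
    by (intro exI[of _ N]) (simp add: null_setsI)
  then have N: "exceptional \<in> null_sets (noise p) \<and> {\<omega> \<in> space (noise p). \<not> good \<omega>} \<subseteq> exceptional"
    unfolding exceptional_def by (rule someI_ex)
  then show "exceptional \<in> null_sets (noise p)" by simp
  show "good \<omega>" if "\<omega> \<in> space (noise p)" "\<omega> \<notin> exceptional"
    using N that by auto
qed

lemma AE_not_exceptional: "AE \<omega> in noise p. \<omega> \<in> space (noise p) \<and> \<omega> \<notin> exceptional"
  using AE_not_in[OF exceptional(1)] AE_space by eventually_elim simp

abbreviation "TB j \<equiv> grass_bundle_borel M X j"

lemma space_TB: "space (TB j) = X \<times> grassmannian j"
  unfolding grass_bundle_borel_def using plane_bundle.topspace_bundle[OF plane_bundle_tangent] by simp

lemma fst_TB: "fst \<in> measurable (TB j) borel"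
proof -
  have "fst \<in> measurable (TB j) (restrict_space borel X)"
    unfolding grass_bundle_borel_def by (rule plane_bundle.fst_measurable[OF plane_bundle_tangent])
  then show ?thesis by (simp add: measurable_restrict_space2_iff)
qed

lemma f_measurable:
  assumes "g \<in> measurable (N \<Otimes>\<^sub>M noise p) borel"
  shows "(\<lambda>w. f (snd w) (g w)) \<in> measurable (N \<Otimes>\<^sub>M noise p) borel"
proof -
  have "(\<lambda>(\<omega>, x). f \<omega> x) \<in> measurable (noise p \<Otimes>\<^sub>M borel) borel"
    by (rule f[unfolded C1_random_map_def, THEN conjunct1])
  from measurable_compose[OF measurable_Pair[OF measurable_snd assms] this] show ?thesis by simp
qed

text \<open>The values outside the chart domains are junk; they only serve to make these functions globally
  defined and Borel.\<close>

definition chart_map :: "('a, 'm) chart \<Rightarrow> 'a \<Rightarrow> real ^ 'm" where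
  "chart_map c x = (if x \<in> fst c then snd c x else 0)"

definition chart_inverse :: "('a, 'm) chart \<Rightarrow> real ^ 'm \<Rightarrow> 'a" where
  "chart_inverse c y = (if y \<in> snd c ` fst c then chart_inv c y else undefined)"

definition metric_entry :: "('a, 'm) chart \<Rightarrow> 'm \<Rightarrow> 'm \<Rightarrow> 'a \<Rightarrow> real" where
  "metric_entry c a b x = (if x \<in> fst c then chart_metric M c (snd c x) (axis a 1) (axis b 1) else 0)"

lemma chart_map_measurable: "c \<in> atlas M \<Longrightarrow> chart_map c \<in> borel_measurable borel"
  unfolding chart_map_def[abs_def]
  by (intro borel_measurable_continuous_on_if continuous_on_const chart(3) borel_open chart(1))

lemma chart_inverse_measurable: "c \<in> atlas M \<Longrightarrow> chart_inverse c \<in> borel_measurable borel"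
  unfolding chart_inverse_def[abs_def]
  by (intro borel_measurable_continuous_on_if continuous_on_const chart(4) borel_open chart(2))

lemma metric_entry_measurable: "c \<in> atlas M \<Longrightarrow> metric_entry c a b \<in> borel_measurable borel"
  unfolding metric_entry_def[abs_def]
  by (intro borel_measurable_continuous_on_if continuous_on_const borel_open chart(1)
      continuous_on_compose2[OF continuous_on_chart_metric chart(3)]) auto

text \<open>Its limit is the partial derivative when \<open>x\<close> and \<open>f \<omega> x\<close> lie in the two charts, since then all
  but finitely many terms avoid the junk values.\<close>

definition diff_quotient ::
  "('a, 'm) chart \<Rightarrow> ('a, 'm) chart \<Rightarrow> 'm \<Rightarrow> nat \<Rightarrow> (nat \<Rightarrow> 't) \<Rightarrow> 'a \<Rightarrow> real ^ 'm" where
  "diff_quotient c c' i n \<omega> x = real (Suc n) *\<^sub>R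
    (chart_map c' (f \<omega> (chart_inverse c (chart_map c x + (1 / real (Suc n)) *\<^sub>R axis i 1))) - chart_map c' (f \<omega> x))"

definition partial_deriv ::
  "('a, 'm) chart \<Rightarrow> ('a, 'm) chart \<Rightarrow> 'm \<Rightarrow> (nat \<Rightarrow> 't) \<Rightarrow> 'a \<Rightarrow> real ^ 'm" where
  "partial_deriv c c' i \<omega> x = lim (\<lambda>n. diff_quotient c c' i n \<omega> x)"

lemma partial_deriv_measurable:
  assumes c: "c \<in> atlas M" "c' \<in> atlas M" and g: "g \<in> measurable (N \<Otimes>\<^sub>M noise p) borel"
  shows "(\<lambda>w. partial_deriv c c' i (snd w) (g w)) \<in> borel_measurable (N \<Otimes>\<^sub>M noise p)"
proof -
  have "(\<lambda>w. diff_quotient c c' i n (snd w) (g w)) \<in> borel_measurable (N \<Otimes>\<^sub>M noise p)" for n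
  proof -
    have "(\<lambda>w. chart_inverse c (chart_map c (g w) + (1 / real (Suc n)) *\<^sub>R axis i 1)) \<in> measurable (N \<Otimes>\<^sub>M noise p) borel"
      by (intro measurable_compose[OF _ chart_inverse_measurable[OF c(1)]] borel_measurable_add
          borel_measurable_const measurable_compose[OF g chart_map_measurable[OF c(1)]])
    from f_measurable[OF this] f_measurable[OF g] show ?thesis
      unfolding diff_quotient_def
      by (intro borel_measurable_scaleR borel_measurable_const borel_measurable_diff
          measurable_compose[OF _ chart_map_measurable[OF c(2)]])
  qed
  \<comment> \<open>\<open>lim\<close> of measurable functions is measurable even where the sequence
    diverges: convergence holds on a measurable set, and \<open>lim\<close> is constant off
    it.\<close>
  then show ?thesis unfolding partial_deriv_def by (rule borel_measurable_lim_metric)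
qed

lemma partial_deriv_eq:
  assumes c: "c \<in> atlas M" "c' \<in> atlas M" and x: "x \<in> fst c" "f \<omega> x \<in> fst c'" and \<omega>: "good \<omega>"
  shows "partial_deriv c c' i \<omega> x = chart_deriv c c' (f \<omega>) x (axis i 1)"
  unfolding partial_deriv_def
proof (rule limI)
  have h: "C1_local_diffeo M (f \<omega>)" using \<omega> by (simp add: good_def)
  let ?r = "chart_rep c c' (f \<omega>)" and ?y = "\<lambda>n. snd c x + (1 / real (Suc n)) *\<^sub>R axis i 1 :: real ^ 'm"
  let ?W = "snd c ` (fst c \<inter> f \<omega> -` fst c')"
  have "(\<lambda>n. real (Suc n) *\<^sub>R (?r (?y n) - ?r (snd c x))) \<longlonglongrightarrow> chart_deriv c c' (f \<omega>) x (axis i 1)"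
    by (rule has_derivative_sequence[OF chart_deriv[OF h c x]]) simp
  moreover have "\<forall>\<^sub>F n in sequentially. real (Suc n) *\<^sub>R (?r (?y n) - ?r (snd c x)) = diff_quotient c c' i n \<omega> x"
  proof -
    have "?y \<longlonglongrightarrow> snd c x + 0 *\<^sub>R axis i 1"
      using LIMSEQ_inverse_real_of_nat by (intro tendsto_intros) (simp add: inverse_eq_divide)
    then have "?y \<longlonglongrightarrow> snd c x" by simp
    then have "\<forall>\<^sub>F n in sequentially. ?y n \<in> ?W"
      by (rule topological_tendstoD[OF _ open_chart_domain(2)[OF h c]]) (use x in auto)
    then show ?thesis
    proof eventually_elim
      fix n assume "?y n \<in> ?W"
      then obtain z where z: "?y n = snd c z" "z \<in> fst c" "f \<omega> z \<in> fst c'" by auto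
      show "real (Suc n) *\<^sub>R (?r (?y n) - ?r (snd c x)) = diff_quotient c c' i n \<omega> x"
        unfolding diff_quotient_def chart_map_def[of c x] if_P[OF x(1)] z(1)
        using z(2,3) x(2) by (simp add: chart_rep_def chart_inverse_def chart_map_def chart(5)[OF c(1)] x(1))
    qed
  qed
  ultimately show "(\<lambda>n. diff_quotient c c' i n \<omega> x) \<longlonglongrightarrow> chart_deriv c c' (f \<omega>) x (axis i 1)"
    by (rule Lim_transform_eventually)
qed

definition coord_infdist :: "('a, 'm) chart \<Rightarrow> real ^ 'm \<Rightarrow> 'a \<times> (real ^ 'm) set \<Rightarrow> real" where
  "coord_infdist c v z = (if fst z \<in> fst c then infdist v (tangent_coords M c (fst z) ` snd z) else 0)"

text \<open>A matrix entry of the orthogonal projection onto the plane read in the chart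
  \<open>c\<close>: the polarisation formula of \<open>proj\<close>, with the distances replaced by
  the Borel functions \<open>coord_infdist\<close>.\<close>

definition proj_entry :: "('a, 'm) chart \<Rightarrow> 'm \<Rightarrow> 'm \<Rightarrow> 'a \<times> (real ^ 'm) set \<Rightarrow> real" where
  "proj_entry c i l z =
    (((norm (axis i 1 + axis l 1 :: real ^ 'm))\<^sup>2 - (coord_infdist c (axis i 1 + axis l 1) z)\<^sup>2) -
     ((norm (axis i 1 - axis l 1 :: real ^ 'm))\<^sup>2 - (coord_infdist c (axis i 1 - axis l 1) z)\<^sup>2)) / 4"

lemma proj_entry_measurable: "c \<in> atlas M \<Longrightarrow> proj_entry c i l \<in> borel_measurable (TB j)"
proof -
  assume c: "c \<in> atlas M"
  have "coord_infdist c v \<in> borel_measurable (TB j)" for v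
    unfolding coord_infdist_def[abs_def] grass_bundle_borel_def
    by (rule plane_bundle.infdist_measurable[OF plane_bundle_tangent c])
  then show ?thesis
    unfolding proj_entry_def[abs_def]
    by (intro borel_measurable_divide borel_measurable_diff borel_measurable_power borel_measurable_const)
qed

lemma proj_entry_eq:
  "fst z \<in> fst c \<Longrightarrow> proj_entry c i l z = proj (tangent_coords M c (fst z) ` snd z) (axis i 1) $ l"
  by (simp add: proj_entry_def coord_infdist_def proj_def proj_form_def)

text \<open>The quotient of sums of minors from \<open>jac_sum_minors\<close>, spelled out in scalar
  entries each of which is a globally defined Borel function. It is the Jacobian where base point
  and image lie in the two charts.\<close>

definition jac_coords ::
  "nat \<Rightarrow> ('a, 'm) chart \<Rightarrow> ('a, 'm) chart \<Rightarrow> ('a \<times> (real ^ 'm) set) \<times> (nat \<Rightarrow> 't) \<Rightarrow> real" where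
  "jac_coords j c c' w =
    sqrt (\<Sum>I\<in>{..<j} \<rightarrow>\<^sub>E (UNIV :: 'm set). jdet j (\<lambda>i l. \<Sum>a\<in>UNIV. \<Sum>b\<in>UNIV.
        (\<Sum>q\<in>UNIV. proj_entry c (I i) q (fst w) * (partial_deriv c c' q (snd w) (fst (fst w)) $ a)) *
        (\<Sum>q\<in>UNIV. proj_entry c (I l) q (fst w) * (partial_deriv c c' q (snd w) (fst (fst w)) $ b)) *
        metric_entry c' a b (f (snd w) (fst (fst w))))) /
    sqrt (\<Sum>I\<in>{..<j} \<rightarrow>\<^sub>E (UNIV :: 'm set). jdet j (\<lambda>i l. \<Sum>a\<in>UNIV. \<Sum>b\<in>UNIV.
        proj_entry c (I i) a (fst w) * proj_entry c (I l) b (fst w) * metric_entry c a b (fst (fst w))))"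

lemma jac_coords_measurable:
  assumes c: "c \<in> atlas M" "c' \<in> atlas M"
  shows "jac_coords j c c' \<in> borel_measurable (TB j \<Otimes>\<^sub>M noise p)"
proof -
  let ?N = "TB j \<Otimes>\<^sub>M noise p"
  have x: "(\<lambda>w. fst (fst w)) \<in> measurable ?N borel"
    by (rule measurable_compose[OF measurable_fst fst_TB])
  have P: "(\<lambda>w. proj_entry c i l (fst w)) \<in> borel_measurable ?N" for i l
    by (rule measurable_compose[OF measurable_fst proj_entry_measurable[OF c(1)]])
  have G: "(\<lambda>w. metric_entry c a b (fst (fst w))) \<in> borel_measurable ?N" for a b
    by (rule measurable_compose[OF x metric_entry_measurable[OF c(1)]])
  have H: "(\<lambda>w. metric_entry c' a b (f (snd w) (fst (fst w)))) \<in> borel_measurable ?N" for a b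
    by (rule measurable_compose[OF f_measurable[OF x] metric_entry_measurable[OF c(2)]])
  have D: "(\<lambda>w. partial_deriv c c' q (snd w) (fst (fst w)) $ a) \<in> borel_measurable ?N" for q a
    using measurable_compose[OF partial_deriv_measurable[OF c x, of q] borel_measurable_nth] .
  show ?thesis
    unfolding jac_coords_def[abs_def]
    by (intro borel_measurable_divide measurable_compose[OF _ borel_measurable_sqrt] borel_measurable_sum borel_measurable_jdet
        borel_measurable_times P G H D)
qed

lemma jac_coords_eq:
  assumes c: "c \<in> atlas M" "c' \<in> atlas M" and x: "x \<in> fst c" "f \<omega> x \<in> fst c'" and \<omega>: "good \<omega>"
    and E: "E \<in> grassmannian j"
  shows "jac j (riemannian.metric M x) (riemannian.metric M (f \<omega> x)) (mderiv M (f \<omega>) x) E =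
    jac_coords j c c' ((x, E), \<omega>)"
proof -
  have h: "C1_local_diffeo M (f \<omega>)" using \<omega> by (simp add: good_def)
  note G = inner_product_chart_metric[OF c(1) x(1)] and H = inner_product_chart_metric[OF c(2) x(2)]
  note L = chart_deriv_bij[OF h c x] and T = tangent_coords_bij[OF c(1) x(1)]
  let ?E = "tangent_coords M c x ` E"
  have 1: "chart_metric M c (snd c x) (proj ?E (axis i 1)) (proj ?E (axis l 1)) =
    (\<Sum>a\<in>UNIV. \<Sum>b\<in>UNIV. proj_entry c i a (x, E) * proj_entry c l b (x, E) * metric_entry c a b x)" for i l
    by (subst bilinear_axis_expand[OF inner_productD(1)[OF G]])
       (simp add: proj_entry_eq x(1) metric_entry_def)
  have 2: "chart_deriv c c' (f \<omega>) x (proj ?E (axis i 1)) $ a =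
      (\<Sum>q\<in>UNIV. proj_entry c i q (x, E) * (partial_deriv c c' q \<omega> x $ a))" for i a
    by (subst linear_axis_expand[OF L(1)]) (simp add: proj_entry_eq x(1) partial_deriv_eq[OF c x \<omega>])
  have 3: "chart_metric M c' (snd c' (f \<omega> x)) (chart_deriv c c' (f \<omega>) x (proj ?E (axis i 1)))
      (chart_deriv c c' (f \<omega>) x (proj ?E (axis l 1))) =
    (\<Sum>a\<in>UNIV. \<Sum>b\<in>UNIV. (\<Sum>q\<in>UNIV. proj_entry c i q (x, E) * (partial_deriv c c' q \<omega> x $ a)) *
      (\<Sum>q\<in>UNIV. proj_entry c l q (x, E) * (partial_deriv c c' q \<omega> x $ b)) * metric_entry c' a b (f \<omega> x))" for i l
    by (subst bilinear_axis_expand[OF inner_productD(1)[OF H]]) (simp add: 2 x(2) metric_entry_def)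
  show ?thesis
    unfolding jac_eq_chart[OF h c x E]
      jac_sum_minors[OF G H L(1) bij_is_inj[OF L(2)] grassmannian_image[OF T(1) bij_is_inj[OF T(2)] E]]
      jac_coords_def gramd_def 1 3 fst_conv snd_conv ..
qed

text \<open>A jointly measurable representative of the logarithmic Jacobian, with value
  \<open>0\<close> where the derivative may be meaningless.\<close>

definition log_jac :: "nat \<Rightarrow> ('a \<times> (real ^ 'm) set) \<times> (nat \<Rightarrow> 't) \<Rightarrow> real" where
  "log_jac j = (\<lambda>((x, E), \<omega>). if \<omega> \<in> exceptional then 0
     else ln (jac j (riemannian.metric M x) (riemannian.metric M (f \<omega> x)) (mderiv M (f \<omega>) x) E))"

text \<open>By Lindelof countably many charts cover the manifold. The pairs of charts around the
  base point and its image cut the product into countably many measurable pieces, and on each the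
  function is given by \<open>jac_coords\<close>.\<close>

lemma log_jac_measurable: "log_jac j \<in> borel_measurable (TB j \<Otimes>\<^sub>M noise p)"
proof -
  let ?N = "TB j \<Otimes>\<^sub>M noise p"
  obtain D where D: "D \<subseteq> fst ` atlas M" "countable D" "\<Union> D = \<Union> (fst ` atlas M)"
    by (rule Lindelof[of "fst ` atlas M"]) (use chart(1) in auto)
  obtain C where C: "C \<subseteq> atlas M" "countable C" "D = fst ` C"
    using countable_subset_image[of D fst "atlas M"] D(1,2) by blast
  have cover: "\<exists>c\<in>C. x \<in> fst c" for x
  proof -
    have "x \<in> \<Union> (fst ` atlas M)" using chart_at[of x] by blast
    then have "x \<in> \<Union> (fst ` C)" unfolding D(3)[symmetric] C(3) .
    then show ?thesis by blast
  qed
  let ?S = "\<lambda>(c, c'). {w \<in> space ?N. fst (fst w) \<in> fst c \<and> f (snd w) (fst (fst w)) \<in> fst c'}"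
  have x: "(\<lambda>w. fst (fst w)) \<in> measurable ?N borel"
    by (rule measurable_compose[OF measurable_fst fst_TB])
  have exc: "Measurable.pred ?N (\<lambda>w. snd w \<in> exceptional)"
    using measurable_sets[OF measurable_snd null_setsD2[OF exceptional(1)], of "TB j"]
    by (simp add: pred_def vimage_def Int_def conj_commute)
  show ?thesis
  proof (rule measurable_piecewise_restrict[where C = "?S ` (C \<times> C)"])
    show "countable (?S ` (C \<times> C))" using C(2) by simp
    show "space ?N \<subseteq> \<Union> (?S ` (C \<times> C))"
    proof
      fix w assume w: "w \<in> space ?N"
      obtain c where c: "c \<in> C" "fst (fst w) \<in> fst c" using cover[of "fst (fst w)"] by blast
      obtain c' where c': "c' \<in> C" "f (snd w) (fst (fst w)) \<in> fst c'"
        using cover[of "f (snd w) (fst (fst w))"] by blast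
      show "w \<in> \<Union> (?S ` (C \<times> C))"
        by (rule UN_I[of "(c, c')"]) (use c c' w in simp_all)
    qed
    fix S assume "S \<in> ?S ` (C \<times> C)"
    then obtain z where z: "z \<in> C \<times> C" "S = ?S z" by blast
    obtain c c' where zc: "z = (c, c')" by (cases z)
    have c: "c \<in> atlas M" "c' \<in> atlas M" using z(1) C(1) unfolding zc by auto
    have S: "S = ?S (c, c')" using z(2) unfolding zc .
    have "?S (c, c') \<in> sets ?N"
    proof -
      have "?S (c, c') = ((\<lambda>w. fst (fst w)) -` fst c \<inter> space ?N) \<inter> ((\<lambda>w. f (snd w) (fst (fst w))) -` fst c' \<inter> space ?N)"
        by auto
      then show ?thesis
        using measurable_sets[OF x borel_open[OF chart(1)[OF c(1)]]]
          measurable_sets[OF f_measurable[OF x] borel_open[OF chart(1)[OF c(2)]]]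
        by (simp only: sets.Int)
    qed
    then show "S \<inter> space ?N \<in> sets ?N" unfolding S by (rule sets.Int) simp
    have "(\<lambda>w. if snd w \<in> exceptional then 0 else ln (jac_coords j c c' w)) \<in> borel_measurable ?N"
      by (intro measurable_If borel_measurable_const borel_measurable_ln jac_coords_measurable[OF c]
          exc[unfolded pred_def])
    then have "(\<lambda>w. if snd w \<in> exceptional then 0 else ln (jac_coords j c c' w)) \<in> borel_measurable (restrict_space ?N S)"
      by (rule measurable_restrict_space1)
    note meas = this
    have eq: "log_jac j w = (if snd w \<in> exceptional then 0 else ln (jac_coords j c c' w))"
      if "w \<in> space (restrict_space ?N S)" for w
    proof -
      obtain x E \<omega> where w: "w = ((x, E), \<omega>)" by (metis prod.exhaust)
      have *: "x \<in> fst c" "f \<omega> x \<in> fst c'" "E \<in> grassmannian j" "\<omega> \<in> space (noise p)"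
        using that unfolding w S by (auto simp: space_restrict_space space_pair_measure space_TB)
      show ?thesis
        unfolding w log_jac_def using jac_coords_eq[OF c *(1,2) exceptional(2)[OF *(4)] *(3)] by auto
    qed
    show "log_jac j \<in> borel_measurable (restrict_space ?N S)"
      by (rule measurable_cong[THEN iffD2, OF eq meas])
  qed
qed

end

subsection \<open>Comparison of the exponents\<close>

text \<open>The infimum need not be attained, so the strict inequality is carried by a real number
  in between, which survives the shift by \<open>s\<close>. For empty \<open>A\<close> both infima
  are infinite.\<close>

lemma INF_ereal_diff_pos_iff:
  "(INF x\<in>A. ereal (a x - s)) > 0 \<longleftrightarrow> (INF x\<in>A. ereal (a x)) > ereal s"
proof
  assume "(INF x\<in>A. ereal (a x - s)) > 0"
  then obtain r where r: "0 < ereal r" "ereal r < (INF x\<in>A. ereal (a x - s))"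
    using ereal_dense2 by blast
  have "ereal (s + r) \<le> (INF x\<in>A. ereal (a x))"
  proof (rule INF_greatest)
    fix x assume "x \<in> A"
    then have "ereal r < ereal (a x - s)" using r(2) by (rule less_INF_D[rotated])
    then show "ereal (s + r) \<le> ereal (a x)" by simp
  qed
  moreover have "ereal s < ereal (s + r)" using r(1) by simp
  ultimately show "(INF x\<in>A. ereal (a x)) > ereal s" by (rule less_le_trans[rotated])
next
  assume "(INF x\<in>A. ereal (a x)) > ereal s"
  then obtain r where r: "ereal s < ereal r" "ereal r < (INF x\<in>A. ereal (a x))"
    using ereal_dense2 by blast
  have "ereal (r - s) \<le> (INF x\<in>A. ereal (a x - s))"
  proof (rule INF_greatest)
    fix x assume "x \<in> A"
    then have "ereal r < ereal (a x)" using r(2) by (rule less_INF_D[rotated])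
    then show "ereal (r - s) \<le> ereal (a x - s)" by simp
  qed
  moreover have "0 < ereal (r - s)" using r(1) by simp
  ultimately show "(INF x\<in>A. ereal (a x - s)) > 0" by (rule less_le_trans[rotated])
qed

context random_map
begin

section \<open>Bounded measurable potentials\<close>

definition log_dist :: "(nat \<Rightarrow> 't) \<Rightarrow> real" where
  "log_dist \<omega> = log_plus (deriv_sup_norm M X (f \<omega>)) + log_plus (inv_deriv_sup_norm M X (f \<omega>))"

text \<open>The constant of \<open>integral_bounded_by_lower_integral\<close>; the factor
  \<open>Suc j\<close> comes from the divisor used there.\<close>

definition log_bound :: "nat \<Rightarrow> real" where
  "log_bound j = ln (sqrt (fact j)) + Suc j * enn2real (\<integral>\<^sup>+\<omega>. ennreal (log_dist \<omega>) \<partial>noise p)"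

lemma log_jac_section_measurable:
  assumes "z \<in> space (TB j)"
  shows "(\<lambda>\<omega>. log_jac j (z, \<omega>)) \<in> borel_measurable (noise p)"
  by (rule measurable_compose[OF measurable_Pair1'[OF assms] log_jac_measurable])

text \<open>The moment condition involves suprema over \<open>X\<close>, so the bound is uniform in
  \<open>z\<close>. This makes the potential integrable for every probability measure on the
  bundle.\<close>

lemma log_jac_integral:
  assumes z: "z \<in> space (TB j)"
  shows "integrable (noise p) (\<lambda>\<omega>. log_jac j (z, \<omega>))"
    "\<bar>\<integral>\<omega>. log_jac j (z, \<omega>) \<partial>noise p\<bar> \<le> log_bound j"
proof -
  obtain x E where xE: "z = (x, E)" "x \<in> X" "E \<in> grassmannian j"
    using z by (auto simp: space_TB)
  have "(1::real) \<le> sqrt (fact j)" by simp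
  then have c: "0 \<le> ln (sqrt (fact j))" by (rule ln_ge_zero)
  have le: "AE \<omega> in noise p. \<bar>log_jac j (z, \<omega>)\<bar> \<le> ln (sqrt (fact j)) + j * log_dist \<omega>"
    using AE_not_exceptional
  proof eventually_elim
    fix \<omega> assume \<omega>: "\<omega> \<in> space (noise p) \<and> \<omega> \<notin> exceptional"
    then have "good \<omega>" using exceptional(2) by blast
    then have "C1_local_diffeo M (f \<omega>)" by (simp add: good_def)
    from abs_ln_jac_le[OF this X xE(2,3)] \<omega>
    show "\<bar>log_jac j (z, \<omega>)\<bar> \<le> ln (sqrt (fact j)) + j * log_dist \<omega>"
      by (simp add: log_jac_def xE(1) log_dist_def)
  qed
  note bound = integral_bounded_by_lower_integral[OF prob_space_noise log_jac_section_measurable[OF z] le c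
      log_int[folded log_dist_def]]
  show "integrable (noise p) (\<lambda>\<omega>. log_jac j (z, \<omega>))" by (rule bound(1))
  show "\<bar>\<integral>\<omega>. log_jac j (z, \<omega>) \<partial>noise p\<bar> \<le> log_bound j"
    unfolding log_bound_def by (rule bound(2))
qed

lemma grass_potential_eq:
  assumes z: "z \<in> space (TB j)"
  shows "grass_potential M p f j z = (\<integral>\<omega>. log_jac j (z, \<omega>) \<partial>noise p)"
proof -
  obtain x E where xE: "z = (x, E)" by (cases z)
  show ?thesis
    unfolding grass_potential_def xE split_conv
  proof (rule integral_completion_AE[OF log_jac_section_measurable[OF z, unfolded xE]])
    show "AE \<omega> in noise p. ln (jac j (riemannian.metric M x) (riemannian.metric M (f \<omega> x)) (mderiv M (f \<omega>) x) E) =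
        log_jac j ((x, E), \<omega>)"
      using AE_not_exceptional by eventually_elim (simp add: log_jac_def)
  qed
qed

lemma grass_potential_bound:
  "z \<in> space (TB j) \<Longrightarrow> \<bar>grass_potential M p f j z\<bar> \<le> log_bound j"
  using log_jac_integral(2) grass_potential_eq by simp

lemma grass_potential_measurable: "grass_potential M p f j \<in> borel_measurable (TB j)"
proof -
  have "case_prod (\<lambda>z \<omega>. log_jac j (z, \<omega>)) = log_jac j" by auto
  then have "case_prod (\<lambda>z \<omega>. log_jac j (z, \<omega>)) \<in> borel_measurable (TB j \<Otimes>\<^sub>M noise p)"
    using log_jac_measurable by simp
  from sigma_finite_measure.borel_measurable_lebesgue_integral[OF
      prob_space_imp_sigma_finite[OF prob_space_noise] this]
  show ?thesis by (rule measurable_cong[THEN iffD2, rotated]) (rule grass_potential_eq)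
qed

section \<open>The determinant as a potential on the base\<close>

definition log_det :: "'a \<Rightarrow> real" where
  "log_det x = (\<integral>\<omega>. ln (abs_det (riemannian.metric M x) (riemannian.metric M (f \<omega> x)) (mderiv M (f \<omega>) x))
     \<partial>completion (noise p))"

lemma UNIV_TB: "x \<in> X \<Longrightarrow> (x, UNIV) \<in> space (TB CARD('m))"
  by (simp add: space_TB grassmannian_def)

lemma abs_det_log_jac:
  "AE \<omega> in noise p. good \<omega> \<and>
    ln (abs_det (riemannian.metric M x) (riemannian.metric M (f \<omega> x)) (mderiv M (f \<omega>) x)) =
    log_jac CARD('m) ((x, UNIV), \<omega>)"
  using AE_not_exceptional
proof eventually_elim
  fix \<omega> assume \<omega>: "\<omega> \<in> space (noise p) \<and> \<omega> \<notin> exceptional"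
  then have good: "good \<omega>" using exceptional(2) by blast
  then have "C1_local_diffeo M (f \<omega>)" by (simp add: good_def)
  from abs_det_eq_jac[OF inner_product_metric inner_product_metric mderiv_bij[OF this]] \<omega> good
  show "good \<omega> \<and> ln (abs_det (riemannian.metric M x) (riemannian.metric M (f \<omega> x)) (mderiv M (f \<omega>) x)) =
      log_jac CARD('m) ((x, UNIV), \<omega>)"
    by (simp add: log_jac_def)
qed

lemma log_det_eq:
  assumes x: "x \<in> X"
  shows "log_det x = (\<integral>\<omega>. log_jac CARD('m) ((x, UNIV), \<omega>) \<partial>noise p)"
  unfolding log_det_def
proof (rule integral_completion_AE[OF log_jac_section_measurable[OF UNIV_TB[OF x]]])
  show "AE \<omega> in noise p. ln (abs_det (riemannian.metric M x) (riemannian.metric M (f \<omega> x)) (mderiv M (f \<omega>) x)) =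
      log_jac CARD('m) ((x, UNIV), \<omega>)"
    using abs_det_log_jac[of x] by eventually_elim blast
qed

lemma section_TB:
  assumes "E \<in> grassmannian j" "\<And>L :: real ^ 'm \<Rightarrow> real ^ 'm. linear L \<Longrightarrow> bij L \<Longrightarrow> L ` E = E"
  shows "(\<lambda>x. (x, E)) \<in> measurable (restrict_space borel X) (TB j)"
  unfolding grass_bundle_borel_def
  by (rule plane_bundle.section_measurable[OF plane_bundle_tangent assms(1)])
     (rule assms(2)[OF tangent_coords_bij])

text \<open>Pulling the potential of full-dimensional planes back along the section
  \<open>(x, UNIV)\<close> gives \<open>log_det\<close>.\<close>

lemma log_det_measurable: "log_det \<in> borel_measurable (restrict_space borel X)"
proof -
  have "(\<lambda>x. (x, UNIV)) \<in> measurable (restrict_space borel X) (TB CARD('m))"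
    by (rule section_TB) (simp_all add: grassmannian_def bij_is_surj)
  from measurable_compose[OF this grass_potential_measurable]
  show ?thesis
  proof (rule measurable_cong[THEN iffD2, rotated])
    fix x assume "x \<in> space (restrict_space borel X)"
    then have x: "x \<in> X" by (simp add: space_restrict_space)
    show "log_det x = grass_potential M p f CARD('m) (x, UNIV)"
      unfolding log_det_eq[OF x] grass_potential_eq[OF UNIV_TB[OF x]] ..
  qed
qed

lemma log_det_bound: "x \<in> X \<Longrightarrow> \<bar>log_det x\<bar> \<le> log_bound CARD('m)"
  using log_det_eq log_jac_integral(2)[OF UNIV_TB] by simp

lemma sum_lyapunov_eq: "sum_lyapunov M p f \<mu> = (\<integral>x. log_det x \<partial>\<mu>)"
  by (simp add: sum_lyapunov_def log_det_def)

text \<open>Empty Gram determinants equal \<open>1\<close>, so the Jacobian on the zero plane is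
  \<open>1\<close>.\<close>

lemma grass_potential_0:
  assumes z: "z \<in> space (TB 0)"
  shows "grass_potential M p f 0 z = 0"
proof -
  have "\<bar>log_jac 0 (z, \<omega>)\<bar> = 0" if "\<omega> \<in> space (noise p)" for \<omega>
  proof (cases "\<omega> \<in> exceptional")
    case True
    then show ?thesis by (simp add: log_jac_def split_beta)
  next
    case False
    obtain x E where xE: "z = (x, E)" "x \<in> X" "E \<in> grassmannian 0" using z by (auto simp: space_TB)
    have "C1_local_diffeo M (f \<omega>)" using exceptional(2)[OF that False] by (simp add: good_def)
    note L = mderiv_bij[OF this]
    obtain e where e: "frame 0 E e" by (rule grassmannian_frame_exists[OF inner_product_metric[of x] xE(3)])
    show ?thesis
      using jac_frame_inj(1)[OF inner_product_metric inner_product_metric L(1) bij_is_inj[OF L(2)] xE(3) e]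
      by (simp add: log_jac_def xE(1) gramd_def)
  qed
  then show ?thesis
    unfolding grass_potential_eq[OF z] by (intro Bochner_Integration.integral_eq_zero_AE AE_I2) simp
qed

lemma integral_grass_potential:
  assumes \<nu>: "prob_space \<nu>" "sets \<nu> = sets (TB j)"
  shows "integrable \<nu> (grass_potential M p f j)"
proof -
  interpret prob_space \<nu> by (rule \<nu>(1))
  have sp: "space \<nu> = space (TB j)" by (rule sets_eq_imp_space_eq[OF \<nu>(2)])
  show ?thesis
  proof (rule integrable_const_bound[where B = "log_bound j"])
    show "grass_potential M p f j \<in> borel_measurable \<nu>"
      unfolding measurable_cong_sets[OF \<nu>(2) refl] by (rule grass_potential_measurable)
    show "AE z in \<nu>. norm (grass_potential M p f j z) \<le> log_bound j"
      by (rule AE_I2) (use grass_potential_bound sp in auto)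
  qed
qed

lemma sets_grass_lifts:
  assumes "\<nu> \<in> grass_lifts M p X f j \<mu>"
  shows "prob_space \<nu>" "sets \<nu> = sets (TB j)" "stationary (noise p) (TB j) (grass_map M f) \<nu>"
    "distr \<nu> (restrict_space borel X) fst = \<mu>"
  using assms by (simp_all add: grass_lifts_def stationary_def)

lemma fst_TB_X: "fst \<in> measurable (TB j) (restrict_space borel X)"
  unfolding grass_bundle_borel_def by (rule plane_bundle.fst_measurable[OF plane_bundle_tangent])

text \<open>The integrand depends on the base point alone, so every lift of \<open>\<mu>\<close>
  gives it the same integral.\<close>

lemma log_det_lift:
  assumes "\<nu> \<in> grass_lifts M p X f j \<mu>"
  shows "integrable \<nu> (\<lambda>z. log_det (fst z))" "(\<integral>z. log_det (fst z) \<partial>\<nu>) = sum_lyapunov M p f \<mu>"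
proof -
  note \<nu> = sets_grass_lifts[OF assms]
  interpret prob_space \<nu> by (rule \<nu>(1))
  have sp: "space \<nu> = space (TB j)" by (rule sets_eq_imp_space_eq[OF \<nu>(2)])
  have fst: "fst \<in> measurable \<nu> (restrict_space borel X)"
    unfolding measurable_cong_sets[OF \<nu>(2) refl] by (rule fst_TB_X)
  show "integrable \<nu> (\<lambda>z. log_det (fst z))"
  proof (rule integrable_const_bound[where B = "log_bound CARD('m)"])
    show "(\<lambda>z. log_det (fst z)) \<in> borel_measurable \<nu>"
      by (rule measurable_compose[OF fst log_det_measurable])
    show "AE z in \<nu>. norm (log_det (fst z)) \<le> log_bound CARD('m)"
      by (rule AE_I2) (use log_det_bound sp space_TB in auto)
  qed
  show "(\<integral>z. log_det (fst z) \<partial>\<nu>) = sum_lyapunov M p f \<mu>"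
    unfolding sum_lyapunov_eq \<nu>(4)[symmetric] by (rule integral_distr[OF fst log_det_measurable, symmetric])
qed

lemma AE_grass_map:
  "AE \<omega> in noise p. \<forall>z\<in>space (TB j). grass_map M f \<omega> z \<in> space (TB j)"
  using AE_good
proof eventually_elim
  fix \<omega> assume \<omega>: "good \<omega>"
  then have h: "C1_local_diffeo M (f \<omega>)" by (simp add: good_def)
  note L = mderiv_bij[OF h]
  show "\<forall>z\<in>space (TB j). grass_map M f \<omega> z \<in> space (TB j)"
  proof
    fix z assume "z \<in> space (TB j)"
    then obtain x E where z: "z = (x, E)" "x \<in> X" "E \<in> grassmannian j" by (auto simp: space_TB)
    then show "grass_map M f \<omega> z \<in> space (TB j)"
      using grassmannian_image[OF L(1) bij_is_inj[OF L(2)] z(3)] \<omega>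
      by (auto simp: grass_map_def space_TB good_def)
  qed
qed

text \<open>The bundle of \<open>0\<close>-planes is a copy of \<open>X\<close>, and
  \<open>\<mu>\<close> lifts along its zero section. Without a lift the infimum would be infinite
  instead of the conventional \<open>0\<close>.\<close>

lemma grass_lifts_0_nonempty:
  assumes \<mu>: "\<mu> \<in> stationary_measures p X f"
  shows "grass_lifts M p X f 0 \<mu> \<noteq> {}"
proof -
  let ?s = "\<lambda>x. (x, {0}) :: 'a \<times> (real ^ 'm) set"
  have \<mu>': "stationary (noise p) (restrict_space borel X) f \<mu>" using \<mu> by (simp add: stationary_measures_def)
  then have sets: "sets \<mu> = sets (restrict_space borel X)" by (simp add: stationary_def)
  have 0: "(grassmannian 0 :: (real ^ 'm) set set) = {{0}}"
    by (auto simp: grassmannian_def subspace_0)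
  have s: "?s \<in> measurable (restrict_space borel X) (TB 0)"
    by (rule section_TB) (simp_all add: 0 linear_0)
  have "stationary (noise p) (TB 0) (grass_map M f) (distr \<mu> (TB 0) ?s)"
  proof (rule stationary_iso[OF \<mu>' s fst_TB_X])
    show "AE \<omega> in noise p. \<forall>z\<in>space (restrict_space borel X). f \<omega> z \<in> space (restrict_space borel X) \<and>
        grass_map M f \<omega> (?s z) = ?s (f \<omega> z)"
      using AE_good
    proof eventually_elim
      fix \<omega> assume \<omega>: "good \<omega>"
      then have h: "C1_local_diffeo M (f \<omega>)" by (simp add: good_def)
      show "\<forall>z\<in>space (restrict_space borel X). f \<omega> z \<in> space (restrict_space borel X) \<and>
        grass_map M f \<omega> (?s z) = ?s (f \<omega> z)"
        using \<omega> by (auto simp: grass_map_def good_def space_restrict_space linear_0[OF mderiv_bij(1)[OF h]])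
    qed
  qed (auto simp: space_TB 0)
  moreover have "distr (distr \<mu> (TB 0) ?s) (restrict_space borel X) fst = \<mu>"
  proof -
    have "?s \<in> measurable \<mu> (TB 0)" unfolding measurable_cong_sets[OF sets refl] by (rule s)
    then have "distr (distr \<mu> (TB 0) ?s) (restrict_space borel X) fst = distr \<mu> (restrict_space borel X) (fst \<circ> ?s)"
      by (rule distr_distr[OF fst_TB_X])
    also have "fst \<circ> ?s = (\<lambda>x. x)" by auto
    finally show ?thesis by (simp add: distr_id2[OF sets[symmetric]])
  qed
  ultimately show ?thesis by (auto simp: grass_lifts_def)
qed

lemma lambda_minus_eq_INF:
  assumes "\<mu> \<in> stationary_measures p X f"
  shows "lambda_minus M p X f j \<mu> =
    (INF \<nu>\<in>grass_lifts M p X f j \<mu>. ereal (\<integral>z. grass_potential M p f j z \<partial>\<nu>))"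
proof (cases "j = 0")
  case True
  have "(\<integral>z. grass_potential M p f 0 z \<partial>\<nu>) = 0" if "\<nu> \<in> grass_lifts M p X f 0 \<mu>" for \<nu>
    using sets_eq_imp_space_eq[OF sets_grass_lifts(2)[OF that]]
    by (intro Bochner_Integration.integral_eq_zero_AE AE_I2) (simp add: grass_potential_0)
  then show ?thesis
    using grass_lifts_0_nonempty[OF assms] True by (simp add: lambda_minus_def zero_ereal_def cong: INF_cong)
qed (simp add: lambda_minus_def)

section \<open>Correspondence of stationary lifts and of the exponents\<close>

context
  fixes j k :: nat
  assumes jk: "j + k = CARD('m)"
begin

abbreviation "CB \<equiv> cograss_bundle_borel M X k"

lemma space_CB: "space CB = X \<times> grassmannian k"
  unfolding cograss_bundle_borel_def
  using plane_bundle.topspace_bundle[OF plane_bundle_cotangent[OF jk]] by simp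

lemma fst_CB: "fst \<in> measurable CB (restrict_space borel X)"
  unfolding cograss_bundle_borel_def
  by (rule plane_bundle.fst_measurable[OF plane_bundle_cotangent[OF jk]])

text \<open>This is \<open>jac_dual\<close> under the logarithm. Positivity of the Jacobian and the
  determinant splits the logarithm of the quotient, and integrability of both parts splits the
  integral.\<close>

lemma cograss_potential_ann:
  assumes z: "z \<in> space (TB j)"
  shows "cograss_potential M p f k (ann_bundle z) = grass_potential M p f j z - log_det (fst z)"
proof -
  obtain x E where xE: "z = (x, E)" "x \<in> X" "E \<in> grassmannian j" using z by (auto simp: space_TB)
  note U = UNIV_TB[OF xE(2)]
  have "cograss_potential M p f k (ann_bundle z) =
      (\<integral>\<omega>. log_jac j (z, \<omega>) - log_jac CARD('m) ((x, UNIV), \<omega>) \<partial>noise p)"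
    unfolding cograss_potential_def ann_bundle_def xE(1) split_conv
  proof (rule integral_completion_AE)
    show "(\<lambda>\<omega>. log_jac j ((x, E), \<omega>) - log_jac CARD('m) ((x, UNIV), \<omega>)) \<in> borel_measurable (noise p)"
      using log_jac_section_measurable[OF z] log_jac_section_measurable[OF U] unfolding xE(1)
      by (rule borel_measurable_diff)
    show "AE \<omega> in noise p. ln (jac k (cometric M x) (cometric M (f \<omega> x)) (dual_inverse (mderiv M (f \<omega>) x)) (ann E)) =
        log_jac j ((x, E), \<omega>) - log_jac CARD('m) ((x, UNIV), \<omega>)"
      using AE_not_exceptional abs_det_log_jac[of x]
    proof eventually_elim
      fix \<omega>
      assume \<omega>: "\<omega> \<in> space (noise p) \<and> \<omega> \<notin> exceptional"
        and det: "good \<omega> \<and> ln (abs_det (riemannian.metric M x) (riemannian.metric M (f \<omega> x)) (mderiv M (f \<omega>) x)) =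
          log_jac CARD('m) ((x, UNIV), \<omega>)"
      then have h: "C1_local_diffeo M (f \<omega>)" by (simp add: good_def)
      note L = mderiv_bij[OF h] and g = inner_product_metric[of x] and g' = inner_product_metric[of "f \<omega> x"]
      have J: "jac j (riemannian.metric M x) (riemannian.metric M (f \<omega> x)) (mderiv M (f \<omega>) x) E > 0"
        by (rule jac_pos[OF g g' L(1) bij_is_inj[OF L(2)] xE(3)])
      have D: "abs_det (riemannian.metric M x) (riemannian.metric M (f \<omega> x)) (mderiv M (f \<omega>) x) > 0"
        unfolding abs_det_eq_jac[OF g g' L]
        by (rule jac_pos[OF g g' L(1) bij_is_inj[OF L(2)]]) (simp add: grassmannian_def)
      have "ln (jac k (cometric M x) (cometric M (f \<omega> x)) (dual_inverse (mderiv M (f \<omega>) x)) (ann E)) =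
        ln (jac j (riemannian.metric M x) (riemannian.metric M (f \<omega> x)) (mderiv M (f \<omega>) x) E) -
        ln (abs_det (riemannian.metric M x) (riemannian.metric M (f \<omega> x)) (mderiv M (f \<omega>) x))"
        unfolding jac_dual[OF g g' L xE(3) jk] by (rule ln_divide_pos[OF J D])
      then show "ln (jac k (cometric M x) (cometric M (f \<omega> x)) (dual_inverse (mderiv M (f \<omega>) x)) (ann E)) =
          log_jac j ((x, E), \<omega>) - log_jac CARD('m) ((x, UNIV), \<omega>)"
        using \<omega> det by (simp add: log_jac_def[of j])
    qed
  qed
  also have "\<dots> = grass_potential M p f j z - log_det x"
    unfolding grass_potential_eq[OF z] log_det_eq[OF xE(2)]
    by (rule Bochner_Integration.integral_diff[OF log_jac_integral(1)[OF z] log_jac_integral(1)[OF U]])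
  also have "x = fst z" by (simp add: xE(1))
  finally show ?thesis .
qed

lemma ann_bundle_space: "z \<in> space (TB j) \<Longrightarrow> ann_bundle z \<in> space CB"
  using measurable_space[OF ann_bundle_measurable[OF jk]] .

lemma ann_bundle_inv_space: "w \<in> space CB \<Longrightarrow> ann_bundle_inv j w \<in> space (TB j)"
  using measurable_space[OF ann_bundle_inv_measurable[OF jk]] .

lemma ann_bundle_inv_TB: "z \<in> space (TB j) \<Longrightarrow> ann_bundle_inv j (ann_bundle z) = z"
  unfolding space_TB by (rule ann_bundle_inverse(1)[OF jk])

lemma ann_bundle_inv_CB: "w \<in> space CB \<Longrightarrow> ann_bundle (ann_bundle_inv j w) = w"
  unfolding space_CB by (rule ann_bundle_inverse(2)[OF jk])

lemma cograss_potential_measurable: "cograss_potential M p f k \<in> borel_measurable CB"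
proof -
  have "(\<lambda>z. grass_potential M p f j z - log_det (fst z)) \<in> borel_measurable (TB j)"
    by (rule borel_measurable_diff[OF grass_potential_measurable measurable_compose[OF fst_TB_X log_det_measurable]])
  from measurable_compose[OF ann_bundle_inv_measurable[OF jk] this]
  show ?thesis
  proof (rule measurable_cong[THEN iffD2, rotated])
    fix w assume w: "w \<in> space CB"
    show "cograss_potential M p f k w =
        grass_potential M p f j (ann_bundle_inv j w) - log_det (fst (ann_bundle_inv j w))"
      using cograss_potential_ann[OF ann_bundle_inv_space[OF w]] by (simp only: ann_bundle_inv_CB[OF w])
  qed
qed

lemma AE_cograss_map:
  "AE \<omega> in noise p. \<forall>z\<in>space (TB j). grass_map M f \<omega> z \<in> space (TB j) \<and>
    cograss_map M f \<omega> (ann_bundle z) = ann_bundle (grass_map M f \<omega> z)"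
  using AE_grass_map[of j] AE_good
proof eventually_elim
  fix \<omega> assume 1: "\<forall>z\<in>space (TB j). grass_map M f \<omega> z \<in> space (TB j)" and \<omega>: "good \<omega>"
  then have h: "C1_local_diffeo M (f \<omega>)" by (simp add: good_def)
  have "cograss_map M f \<omega> (ann_bundle z) = ann_bundle (grass_map M f \<omega> z)" for z
    by (cases z) (simp add: cograss_map_def ann_bundle_def grass_map_def ann_image[OF mderiv_bij[OF h]])
  with 1 show "\<forall>z\<in>space (TB j). grass_map M f \<omega> z \<in> space (TB j) \<and>
    cograss_map M f \<omega> (ann_bundle z) = ann_bundle (grass_map M f \<omega> z)" by blast
qed

lemma cograss_lift:
  assumes "\<nu> \<in> grass_lifts M p X f j \<mu>"
  shows "distr \<nu> CB ann_bundle \<in> cograss_lifts M p X f k \<mu>"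
    "(\<integral>w. cograss_potential M p f k w \<partial>distr \<nu> CB ann_bundle) =
      (\<integral>z. grass_potential M p f j z \<partial>\<nu>) - sum_lyapunov M p f \<mu>"
proof -
  note \<nu> = sets_grass_lifts[OF assms]
  have sp: "space \<nu> = space (TB j)" by (rule sets_eq_imp_space_eq[OF \<nu>(2)])
  have ann: "ann_bundle \<in> measurable \<nu> CB"
    unfolding measurable_cong_sets[OF \<nu>(2) refl] by (rule ann_bundle_measurable[OF jk])
  have "stationary (noise p) CB (cograss_map M f) (distr \<nu> CB ann_bundle)"
    by (rule stationary_iso[OF \<nu>(3) ann_bundle_measurable[OF jk] ann_bundle_inv_measurable[OF jk]
        ann_bundle_inv_TB ann_bundle_inv_CB AE_cograss_map])
  moreover have "distr (distr \<nu> CB ann_bundle) (restrict_space borel X) fst = \<mu>"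
  proof -
    have "distr (distr \<nu> CB ann_bundle) (restrict_space borel X) fst = distr \<nu> (restrict_space borel X) (fst \<circ> ann_bundle)"
      by (rule distr_distr[OF fst_CB ann])
    also have "fst \<circ> ann_bundle = (fst :: 'a \<times> (real ^ 'm) set \<Rightarrow> 'a)" by (auto simp: ann_bundle_def)
    finally show ?thesis by (simp only: \<nu>(4))
  qed
  ultimately show "distr \<nu> CB ann_bundle \<in> cograss_lifts M p X f k \<mu>" by (simp add: cograss_lifts_def)
  have "(\<integral>w. cograss_potential M p f k w \<partial>distr \<nu> CB ann_bundle) = (\<integral>z. cograss_potential M p f k (ann_bundle z) \<partial>\<nu>)"
    by (rule integral_distr[OF ann cograss_potential_measurable])
  also have "\<dots> = (\<integral>z. grass_potential M p f j z - log_det (fst z) \<partial>\<nu>)"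
    by (rule Bochner_Integration.integral_cong[OF refl]) (simp add: cograss_potential_ann sp)
  also have "\<dots> = (\<integral>z. grass_potential M p f j z \<partial>\<nu>) - sum_lyapunov M p f \<mu>"
    using Bochner_Integration.integral_diff[OF integral_grass_potential[OF \<nu>(1,2)] log_det_lift(1)[OF assms]]
    by (simp only: log_det_lift(2)[OF assms])
  finally show "(\<integral>w. cograss_potential M p f k w \<partial>distr \<nu> CB ann_bundle) =
      (\<integral>z. grass_potential M p f j z \<partial>\<nu>) - sum_lyapunov M p f \<mu>" .
qed

text \<open>The conjugacy of the two random maps, evaluated at \<open>ann_bundle_inv j z\<close>,
  becomes the conjugacy by the inverse isomorphism, so cotangent lifts can be carried back.\<close>

lemma cograss_lift_surj:
  assumes "\<nu>' \<in> cograss_lifts M p X f k \<mu>"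
  shows "\<exists>\<nu>\<in>grass_lifts M p X f j \<mu>. \<nu>' = distr \<nu> CB ann_bundle"
proof -
  let ?\<Psi> = "ann_bundle_inv j"
  let ?\<nu> = "distr \<nu>' (TB j) ?\<Psi>"
  have \<nu>': "stationary (noise p) CB (cograss_map M f) \<nu>'" "distr \<nu>' (restrict_space borel X) fst = \<mu>"
    using assms by (simp_all add: cograss_lifts_def)
  then have sets: "sets \<nu>' = sets CB" by (simp add: stationary_def)
  have sp: "space \<nu>' = space CB" by (rule sets_eq_imp_space_eq[OF sets])
  have \<Psi>: "?\<Psi> \<in> measurable \<nu>' (TB j)"
    unfolding measurable_cong_sets[OF sets refl] by (rule ann_bundle_inv_measurable[OF jk])
  have "stationary (noise p) (TB j) (grass_map M f) ?\<nu>"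
  proof (rule stationary_iso[OF \<nu>'(1) ann_bundle_inv_measurable[OF jk] ann_bundle_measurable[OF jk]
        ann_bundle_inv_CB ann_bundle_inv_TB])
    show "AE \<omega> in noise p. \<forall>z\<in>space CB. cograss_map M f \<omega> z \<in> space CB \<and>
        grass_map M f \<omega> (?\<Psi> z) = ?\<Psi> (cograss_map M f \<omega> z)"
      using AE_cograss_map
    proof eventually_elim
      fix \<omega> assume *: "\<forall>z\<in>space (TB j). grass_map M f \<omega> z \<in> space (TB j) \<and>
        cograss_map M f \<omega> (ann_bundle z) = ann_bundle (grass_map M f \<omega> z)"
      show "\<forall>z\<in>space CB. cograss_map M f \<omega> z \<in> space CB \<and>
        grass_map M f \<omega> (?\<Psi> z) = ?\<Psi> (cograss_map M f \<omega> z)"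
      proof
        fix z assume z: "z \<in> space CB"
        note \<Psi>z = ann_bundle_inv_space[OF z]
        have g: "grass_map M f \<omega> (?\<Psi> z) \<in> space (TB j)" using * \<Psi>z by blast
        have eq: "cograss_map M f \<omega> z = ann_bundle (grass_map M f \<omega> (?\<Psi> z))"
          using *[rule_format, OF \<Psi>z] by (simp only: ann_bundle_inv_CB[OF z])
        show "cograss_map M f \<omega> z \<in> space CB \<and> grass_map M f \<omega> (?\<Psi> z) = ?\<Psi> (cograss_map M f \<omega> z)"
          unfolding eq using ann_bundle_space[OF g] ann_bundle_inv_TB[OF g] by simp
      qed
    qed
  qed
  moreover have "distr ?\<nu> (restrict_space borel X) fst = \<mu>"
  proof -
    have "distr ?\<nu> (restrict_space borel X) fst = distr \<nu>' (restrict_space borel X) (fst \<circ> ?\<Psi>)"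
      by (rule distr_distr[OF fst_TB_X \<Psi>])
    also have "fst \<circ> ?\<Psi> = (fst :: 'a \<times> ((real ^ 'm) \<Rightarrow>\<^sub>L real) set \<Rightarrow> 'a)" by (auto simp: ann_bundle_inv_def)
    finally show ?thesis by (simp only: \<nu>'(2))
  qed
  ultimately have "?\<nu> \<in> grass_lifts M p X f j \<mu>" by (simp add: grass_lifts_def)
  moreover have "\<nu>' = distr ?\<nu> CB ann_bundle"
  proof -
    have "distr ?\<nu> CB ann_bundle = distr \<nu>' CB (ann_bundle \<circ> ?\<Psi>)"
      by (rule distr_distr[OF ann_bundle_measurable[OF jk] \<Psi>])
    also have "\<dots> = distr \<nu>' CB (\<lambda>w. w)"
      by (rule distr_cong[OF refl refl]) (simp add: sp ann_bundle_inv_CB)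
    also have "\<dots> = \<nu>'" by (rule distr_id2[OF sets[symmetric]])
    finally show ?thesis ..
  qed
  ultimately show ?thesis by blast
qed

text \<open>All integrals shift by one and the same number, \<open>sum_lyapunov M p f \<mu>\<close>,
  whichever lift is taken; hence the infima can be compared.\<close>

lemma colambda_minus_pos_iff:
  assumes \<mu>: "\<mu> \<in> stationary_measures p X f"
  shows "colambda_minus M p X f k \<mu> > 0 \<longleftrightarrow> lambda_minus M p X f j \<mu> > ereal (sum_lyapunov M p f \<mu>)"
proof -
  let ?A = "grass_lifts M p X f j \<mu>"
  let ?I = "\<lambda>\<nu>. \<integral>z. grass_potential M p f j z \<partial>\<nu>"
  have lifts: "cograss_lifts M p X f k \<mu> = (\<lambda>\<nu>. distr \<nu> CB ann_bundle) ` ?A"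
    using cograss_lift(1) cograss_lift_surj by blast
  have "colambda_minus M p X f k \<mu> = (INF \<nu>\<in>?A. ereal (?I \<nu> - sum_lyapunov M p f \<mu>))"
    unfolding colambda_minus_def lifts image_image
    by (rule INF_cong[OF refl]) (simp only: cograss_lift(2))
  then show ?thesis
    unfolding lambda_minus_eq_INF[OF \<mu>] by (simp only: INF_ereal_diff_pos_iff)
qed

end

end

theorem corollary5:
  fixes M :: "('a::{second_countable_topology,t2_space}, 'm::finite) riemannian"
    and p :: "'t measure"
    and f :: "(nat \<Rightarrow> 't) \<Rightarrow> 'a \<Rightarrow> 'a"
    and X :: "'a set"
    and k :: nat
  assumes "riemannian_manifold M"
    and "prob_space p"
    and "C1_random_map M p f"
    and "compact X"
    and "AE \<omega> in noise p. f \<omega> ` X \<subseteq> X"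
    and "(\<integral>\<^sup>+\<omega>. ennreal (log_plus (deriv_sup_norm M X (f \<omega>)) +
                     log_plus (inv_deriv_sup_norm M X (f \<omega>))) \<partial>noise p) < \<infinity>"
    and "1 \<le> k" and "k \<le> CARD('m)"
  shows "coexpanding M p X f k \<longleftrightarrow>
    (\<forall>\<mu>\<in>stationary_measures p X f.
       lambda_minus M p X f (CARD('m) - k) \<mu> > ereal (sum_lyapunov M p f \<mu>))"
proof -
  interpret random_map M p f X 
    by (rule random_map.intro[OF riemannian_mfd.intro[OF assms(1)] random_map_axioms.intro[OF assms(2-6)]])
  \<comment> \<open>The bound on \<open>k\<close> makes the truncated subtraction exact.\<close>
  have "CARD('m) - k + k = CARD('m)" using \<open>k \<le> CARD('m)\<close> by simp
  from colambda_minus_pos_iff[OF this] show ?thesis by (simp add: coexpanding_def)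
qed

end
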